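(* Let $A,B,C\in \mathcal{S}_n$ be such that $C \preceq A$ and $C \preceq B$, and let $(p,q,r)$ denote the inertia of $A-B$. The following statements are equivalent: (i) $C$ is a maximal lower bound of $A$ and $B$ in the Löwner order; (ii) $\operatorname{Ker}(A-C) + \operatorname{Ker}(B-C) = \mathbb{R}^n$; (iii) $\operatorname{rk}(A-C) = p$ and $\operatorname{rk}(B-C) = q$; (iv) for every $P \in \mathrm{GL}_n$ such that $A-B = P J_{p,q,r} P^T$, there exists a unique $M \in \mathcal{M}_{p,q}$ such that $$C = A - P S (I_p \oplus 0_q \oplus 0_r) S P^T, \quad\text{where}\quad S = \begin{pmatrix} (I_p + MM^T)^{1/2} & M \\ M^T & (I_q + M^TM)^{1/2}\end{pmatrix} \oplus 0_r .$$
   Context: $\mathcal{S}_n$ is the set of real symmetric $n\times n$ matrices and $\mathcal{M}_{p,q}$ the set of real $p\times q$ matrices. The Löwner order: $A \preceq B$ iff $x^TAx \le x^TBx$ for all $x\in\mathbb{R}^n$. A maximal lower bound of $A,B$ is a $C\in\mathcal{S}_n$ with $C\preceq A$, $C\preceq B$ such that no $C'\in\mathcal{S}_n$ with $C\preceq C'$, $C'\neq C$ satisfies $C'\preceq A$ and $C'\preceq B$. The inertia of $A\in\mathcal{S}_n$ is the triple $(p,q,r)$ of numbers of positive, negative and zero eigenvalues (with multiplicity). $J_{p,q,r}$ denotes the matrix $I_p\oplus(-I_q)\oplus 0_r$, where $X\oplus Y$ is the block-diagonal matrix with blocks $X,Y$, $I_k$ the $k\times k$ identity and $0_k$ the $k\times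 k$ zero matrix. For a positive semidefinite $X$, $X^{1/2}$ is its unique positive semidefinite square root. *)

theory Defs
  imports "Jordan_Normal_Form.DL_Rank" "Jordan_Normal_Form.Matrix_Kernel" "Jordan_Normal_Form.Char_Poly"
begin

definition sym_mat :: "nat \<Rightarrow> real mat \<Rightarrow> bool" where
  "sym_mat n A \<longleftrightarrow> A \<in> carrier_mat n n \<and> A\<^sup>T = A"

definition loewner_le :: "nat \<Rightarrow> real mat \<Rightarrow> real mat \<Rightarrow> bool" where
  "loewner_le n A B \<longleftrightarrow> (\<forall>x \<in> carrier_vec n. x \<bullet> (A *\<^sub>v x) \<le> x \<bullet> (B *\<^sub>v x))"

definition maximal_lower_bound :: "nat \<Rightarrow> real mat \<Rightarrow> real mat \<Rightarrow> real mat \<Rightarrow> bool" where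
  "maximal_lower_bound n A B C \<longleftrightarrow>
     sym_mat n C \<and> loewner_le n C A \<and> loewner_le n C B \<and>
     \<not> (\<exists>C'. sym_mat n C' \<and> loewner_le n C C' \<and> C' \<noteq> C \<and> loewner_le n C' A \<and> loewner_le n C' B)"

definition inertia :: "real mat \<Rightarrow> nat \<times> nat \<times> nat" where
  "inertia A =
    ((\<Sum>x\<in>{x. x > 0 \<and> poly (char_poly A) x = 0}. order x (char_poly A)),
     (\<Sum>x\<in>{x. x < 0 \<and> poly (char_poly A) x = 0}. order x (char_poly A)),
     order 0 (char_poly A))"

definition J_mat :: "nat \<Rightarrow> nat \<Rightarrow> nat \<Rightarrow> real mat" where
  "J_mat p q r = diag_block_mat [1\<^sub>m p, - (1\<^sub>m q), 0\<^sub>m r r]"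

definition Ip0_mat :: "nat \<Rightarrow> nat \<Rightarrow> nat \<Rightarrow> real mat" where
  "Ip0_mat p q r = diag_block_mat [1\<^sub>m p, 0\<^sub>m q q, 0\<^sub>m r r]"

definition dsum :: "real mat \<Rightarrow> real mat \<Rightarrow> real mat" where
  "dsum X Y = four_block_mat X (0\<^sub>m (dim_row X) (dim_col Y)) (0\<^sub>m (dim_row Y) (dim_col X)) Y"

definition psd :: "nat \<Rightarrow> real mat \<Rightarrow> bool" where
  "psd n X \<longleftrightarrow> sym_mat n X \<and> (\<forall>x \<in> carrier_vec n. 0 \<le> x \<bullet> (X *\<^sub>v x))"

definition psd_sqrt :: "nat \<Rightarrow> real mat \<Rightarrow> real mat" where
  "psd_sqrt n X = (THE Y. psd n Y \<and> Y * Y = X)"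

definition S_mat :: "nat \<Rightarrow> nat \<Rightarrow> nat \<Rightarrow> real mat \<Rightarrow> real mat" where
  "S_mat p q r M = dsum
     (four_block_mat (psd_sqrt p (1\<^sub>m p + M * M\<^sup>T)) M M\<^sup>T (psd_sqrt q (1\<^sub>m q + M\<^sup>T * M)))
     (0\<^sub>m r r)"

end

(*
  Put X = A - C and Y = B - C, two positive semidefinite matrices with X - Y = A - B.
  If the kernels of X and Y span, a matrix between 0 and both X and Y vanishes on both kernels,
  hence is 0. If they do not span, the ranges of X and Y share a nonzero vector v, and a small
  multiple of v v^T lies below both X and Y, so C is not maximal.

  For any Z with (X - Y) Z (X - Y) = X - Y the spanning condition is equivalent to the two identities
  X Z X = X and Y Z X = 0. After the congruence A - B = P J P^T one may take Z = J; then X has blocks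
  a, m, m^T, b with a >= 1, and the identities say exactly that a = 1 + M M^T, m = a^(1/2) M and
  b = M^T M for the unique matrix M = a^(-1/2) m, which is the parametrization in (iv). The lower right
  block of S plays no role. The same equations exhibit factorizations showing rk X <= p and rk Y <= q,
  while rk X + rk Y >= p + q is subadditivity. Conversely, from rank factorizations of X and Y of ranks
  p and q the identities follow since a one-sided inverse of a square matrix is two-sided.
*)
theory Submission
  imports Defs "HOL-Computational_Algebra.Fundamental_Theorem_Algebra"
begin

section \<open>Rank and inverses\<close>

text \<open>The spanning condition (ii) is the hub: each other statement is compared with it alone.
  The obstacle throughout is that \<open>X - Y\<close> may be singular. It excludes an inverse, so
  the identities are stated for a generalized inverse \<open>Z\<close>; after the congruence
  \<open>J\<close> itself serves because \<open>J * J * J = J\<close>. The reason for the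
  identities: if the kernels span, each value of \<open>X\<close> is \<open>X - Y\<close> applied to
  a vector in the kernel of \<open>Y\<close>, and each value of \<open>Y\<close> is minus
  \<open>X - Y\<close> applied to a vector in the kernel of \<open>X\<close>, so on the ranges of
  \<open>X\<close> and \<open>Y\<close> the bilinear form of \<open>Z\<close> is dictated by
  \<open>X - Y\<close>. Where ranks are counted, singularity is repaired by completing
  \<open>X - Y\<close> to an invertible matrix, with \<open>P\<close> acting on the last
  \<open>r\<close> coordinates. Rank factors are kept as square matrices of size \<open>n\<close>
  cut down by diagonal 0-1 matrices, so factors of different widths fit into one square product.
  Statement (iv) speaks about all \<open>P\<close>, so returning from it needs one \<open>P\<close>
  to exist: this is the task of the spectral theorem and of the reordering of eigenvalues.\<close>

lemma trivial_kernel_inverse: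
  fixes A :: "real mat"
  assumes A: "A \<in> carrier_mat n n"
    and ker: "\<And>v. v \<in> carrier_vec n \<Longrightarrow> A *\<^sub>v v = 0\<^sub>v n \<Longrightarrow> v = 0\<^sub>v n"
  obtains B where "B \<in> carrier_mat n n" "A * B = 1\<^sub>m n" "B * A = 1\<^sub>m n"
proof -
  have "det A \<noteq> 0" using det_0_iff_vec_prod_zero_field[OF A] ker by blast
  from det_non_zero_imp_unit[OF A this] show ?thesis
    using that unfolding Units_def ring_mat_simps by auto
qed

text \<open>Each column of the product is \<open>A\<close> applied to a column of \<open>B\<close>,
  so the column space can only shrink.\<close>

lemma rank_mult_le:
  fixes A B :: "real mat"
  assumes A: "A \<in> carrier_mat n m" and B: "B \<in> carrier_mat m k"
  shows "vec_space.rank n (A * B) \<le> vec_space.rank n A"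
proof -
  interpret vec_space "TYPE(real)" n .
  define W where "W = span (set (cols A))"
  have cA: "set (cols A) \<subseteq> carrier_vec n" using A cols_dim by blast
  have AB: "A * B \<in> carrier_mat n k" using A B by auto
  have sub: "set (cols (A * B)) \<subseteq> W"
  proof
    fix x assume "x \<in> set (cols (A * B))"
    then obtain j where j: "j < k" and x: "x = col (A * B) j"
      using AB by (metis carrier_matD(2) cols_length cols_nth in_set_conv_nth)
    have "x = A *\<^sub>v col B j" using x j A B by auto
    moreover have "col B j \<in> carrier_vec m" using B j by auto
    ultimately have "x \<in> col_space A" unfolding col_space_eq[OF A]
      using A by auto
    thus "x \<in> W" unfolding W_def col_space_def .
  qed
  have sW: "VectorSpace.subspace class_ring W V" unfolding W_def using cA by (rule span_is_subspace)
  have "span (set (cols (A * B))) \<subseteq> W"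
    using sub sW by (simp add: span_is_subset)
  moreover have "VectorSpace.subspace class_ring (span (set (cols (A * B)))) V"
    using AB cols_dim span_is_subspace by (metis carrier_matD(1))
  ultimately have "VectorSpace.subspace class_ring (span (set (cols (A * B)))) (vs W)"
    using nested_subspaces sW by blast
  moreover have "vectorspace.fin_dim class_ring (vs W)"
    unfolding W_def using fin_dim_span_cols[OF A] .
  moreover have "vectorspace.fin_dim class_ring (span_vs (set (cols (A * B))))"
    using fin_dim_span_cols[OF AB] .
  ultimately show ?thesis unfolding rank_def W_def
    using vectorspace.subspace_dim[OF subspace_is_vs[OF sW]] unfolding W_def by auto
qed

lemma rank_add_le:
  fixes A B :: "real mat"
  assumes "A \<in> carrier_mat n m" "B \<in> carrier_mat n m"
  shows "vec_space.rank n (A + B) \<le> vec_space.rank n A + vec_space.rank n B"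
proof -
  interpret vec_space "TYPE(real)" n .
  show ?thesis by (rule rank_subadditive[OF assms])
qed

lemma rank_one_mat: "vec_space.rank n (1\<^sub>m n :: real mat) = n"
proof -
  interpret vec_space "TYPE(real)" n .
  show ?thesis using det_rank_iff[of "1\<^sub>m n"] by simp
qed

text \<open>A diagonal matrix with k nonzero entries splits into k pieces, each of which contributes
  an outer product after multiplication by \<open>F\<close>.\<close>

lemma rank_mult_mat_diag_le:
  fixes F :: "real mat"
  assumes F: "F \<in> carrier_mat n n"
  shows "vec_space.rank n (F * mat_diag n f) \<le> card {i. i < n \<and> f i \<noteq> 0}"
proof -
  interpret vec_space "TYPE(real)" n .
  \<comment> \<open>The support is replaced by any finite set \<open>S\<close> containing it, with
    \<open>f\<close> arbitrary, so that the induction may zero one entry of \<open>f\<close> at a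
    time.\<close>
  have *: "rank (F * mat_diag n f) \<le> card S"
    if "finite S" "\<And>i. i < n \<Longrightarrow> f i \<noteq> 0 \<Longrightarrow> i \<in> S" for S f
    using that
  proof (induction S arbitrary: f rule: finite_induct)
    case empty
    hence "F * mat_diag n f = 0\<^sub>m n n"
      by (subst mat_diag_mult_right[OF F]) (intro eq_matI, auto)
    thus ?case using rank_0I by simp
  next
    case (insert x S)
    define g where "g = f(x := 0)"
    define R where "R = Matrix.mat n n (\<lambda>(i,j). (F $$ (i,x) * f x) * (if j = x then 1 else 0))"
    have "F * mat_diag n f = F * mat_diag n g + R"
      by (subst (1 2) mat_diag_mult_right[OF F]) (intro eq_matI, auto simp: g_def R_def)
    moreover have "rank (F * mat_diag n g) \<le> card S"
    proof (rule insert.IH)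
      fix i assume "i < n" "g i \<noteq> 0"
      thus "i \<in> S" using insert.prems[of i] by (auto simp: g_def split: if_splits)
    qed
    moreover have "rank R \<le> 1"
      by (rule rank_le_1_product_entries[where nc = n and f = "\<lambda>i. F $$ (i,x) * f x"
            and g = "\<lambda>j. if j = x then 1 else 0"]) (auto simp: R_def)
    moreover have "R \<in> carrier_mat n n" by (simp add: R_def)
    ultimately show ?case using insert.hyps rank_add_le[of "F * mat_diag n g" n n R] F
      by (auto intro!: order_trans[OF rank_subadditive] mult_carrier_mat[of _ n n])
  qed
  show ?thesis by (rule *) auto
qed

lemma rank_mat_diag_sandwich_le:
  fixes F G :: "real mat"
  assumes F: "F \<in> carrier_mat n n" and G: "G \<in> carrier_mat n n"
  shows "vec_space.rank n (F * mat_diag n f * G) \<le> card {i. i < n \<and> f i \<noteq> 0}"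
  using rank_mult_le[of "F * mat_diag n f" n n G n] rank_mult_mat_diag_le[OF F, of f] F G
  by (auto intro: order_trans mult_carrier_mat[of _ n n])

text \<open>The lower bound is a counting argument: the identity is a product starting with the
  given matrix plus a projection whose rank is at most the number of zero entries of
  \<open>e\<close>, and rank is subadditive.\<close>

lemma rank_diagonalized:
  fixes U U' :: "real mat"
  assumes U: "U \<in> carrier_mat n n" and U': "U' \<in> carrier_mat n n"
    and UU': "U * U' = 1\<^sub>m n" and U'U: "U' * U = 1\<^sub>m n"
  shows "vec_space.rank n (U * mat_diag n e * U') = card {i. i < n \<and> e i \<noteq> 0}"
proof (rule antisym)
  show "vec_space.rank n (U * mat_diag n e * U') \<le> card {i. i < n \<and> e i \<noteq> 0}"
    by (rule rank_mat_diag_sandwich_le[OF U U'])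
  let ?X = "U * mat_diag n e * U'"
  \<comment> \<open>By \<open>1 / 0 = 0\<close> this is a generalized inverse, so
    \<open>?X * ?Y\<close> projects onto the directions with \<open>e i \<noteq> 0\<close> and
    \<open>?Z\<close> projects onto the others.\<close>
  let ?Y = "U * mat_diag n (\<lambda>i. 1 / e i) * U'"
  let ?Z = "U * mat_diag n (\<lambda>i. if e i = 0 then 1 else 0) * U'"
  have c[simp]: "mat_diag n h \<in> carrier_mat n n" for h :: "nat \<Rightarrow> real" by simp
  have d: "mat_diag n (\<lambda>i. e i * (1 / e i)) + mat_diag n (\<lambda>i. if e i = 0 then 1 else 0) = 1\<^sub>m n"
    by (intro eq_matI) (auto simp: mat_diag_def)
  have "?X * ?Y = U * (mat_diag n e * ((U' * U) * mat_diag n (\<lambda>i. 1 / e i)) * U')"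
    using U U' by (simp add: assoc_mult_mat[of _ n n _ n _ n] mult_carrier_mat[of _ n n _ n])
  also have "\<dots> = U * mat_diag n (\<lambda>i. e i * (1 / e i)) * U'"
    unfolding U'U using U U' by (simp add: left_mult_one_mat[of _ n n] assoc_mult_mat[of _ n n _ n _ n])
  finally have "?X * ?Y + ?Z = U * 1\<^sub>m n * U'"
    unfolding d[symmetric] using U U'
    by (simp add: mult_add_distrib_mat[of _ n n _ n] add_mult_distrib_mat[of _ n n _ _ n] mult_carrier_mat[of _ n n _ n])
  hence "?X * ?Y + ?Z = 1\<^sub>m n" using U UU' by simp
  hence "n = vec_space.rank n (?X * ?Y + ?Z)" using rank_one_mat by simp
  also have "\<dots> \<le> vec_space.rank n (?X * ?Y) + vec_space.rank n ?Z"
    by (rule rank_add_le[of _ n n]) (use U U' in \<open>auto intro!: mult_carrier_mat[of _ n n]\<close>)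
  also have "\<dots> \<le> vec_space.rank n ?X + card {i. i < n \<and> e i = 0}"
  proof (rule add_mono)
    show "vec_space.rank n (?X * ?Y) \<le> vec_space.rank n ?X"
      using U U' by (intro rank_mult_le[of _ n n _ n]) (auto intro!: mult_carrier_mat[of _ n n])
    have "{i. i < n \<and> (if e i = 0 then 1 else 0) \<noteq> (0::real)} = {i. i < n \<and> e i = 0}" by auto
    thus "vec_space.rank n ?Z \<le> card {i. i < n \<and> e i = 0}"
      using rank_mat_diag_sandwich_le[OF U U', of "\<lambda>i. if e i = 0 then 1 else 0"] by simp
  qed
  finally have le: "n \<le> vec_space.rank n ?X + card {i. i < n \<and> e i = 0}" .
  have "{..<n} = {i. i < n \<and> e i \<noteq> 0} \<union> {i. i < n \<and> e i = 0}" by auto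
  hence "card {..<n} = card ({i. i < n \<and> e i \<noteq> 0} \<union> {i. i < n \<and> e i = 0})" by presburger
  also have "\<dots> = card {i. i < n \<and> e i \<noteq> 0} + card {i. i < n \<and> e i = 0}"
    by (rule card_Un_disjoint) auto
  finally show "card {i. i < n \<and> e i \<noteq> 0} \<le> vec_space.rank n ?X" using le by simp
qed

section \<open>The spectral theorem\<close>

lemma scalar_prod_self_nonneg: "0 \<le> (v :: real vec) \<bullet> v"
  unfolding scalar_prod_def by (intro sum_nonneg) simp

lemma scalar_prod_self_eq_0:
  fixes v :: "real vec"
  assumes "v \<in> carrier_vec n"
  shows "v \<bullet> v = 0 \<longleftrightarrow> v = 0\<^sub>v n"
proof
  assume "v \<bullet> v = 0"
  hence "\<forall>i\<in>{0..<n}. v $ i * v $ i = 0"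
    using assms unfolding scalar_prod_def by (subst (asm) sum_nonneg_eq_0_iff) auto
  thus "v = 0\<^sub>v n" using assms by (intro eq_vecI) auto
qed (use assms in auto)

lemma sym_scalar_prod:
  assumes "sym_mat n A" "x \<in> carrier_vec n" "y \<in> carrier_vec n"
  shows "x \<bullet> (A *\<^sub>v y) = (A *\<^sub>v x) \<bullet> y"
  using transpose_vec_mult_scalar[of A n n y x] assms unfolding sym_mat_def by simp

text \<open>A complex eigenvalue \<open>k\<close> exists by the fundamental theorem of algebra.
  Splitting its eigenvector into real and imaginary parts \<open>u\<close>, \<open>w\<close> keeps
  the rest of the argument real; symmetry forces \<open>Im k = 0\<close>, and then whichever of
  \<open>u\<close>, \<open>w\<close> is nonzero is a real eigenvector.\<close>

lemma sym_mat_real_eigenvector: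
  assumes A: "sym_mat n A" and n: "n > 0"
  obtains l v where "v \<in> carrier_vec n" "v \<noteq> 0\<^sub>v n" "A *\<^sub>v v = l \<cdot>\<^sub>v v"
proof -
  have Ac: "A \<in> carrier_mat n n" using A by (simp add: sym_mat_def)
  define C where "C = map_mat complex_of_real A"
  have C: "C \<in> carrier_mat n n" using Ac by (simp add: C_def)
  have "degree (char_poly C) = n" using degree_monic_char_poly[OF C] by simp
  hence "\<not> constant (poly (char_poly C))" using n by (simp add: constant_degree)
  then obtain k where "poly (char_poly C) k = 0" using fundamental_theorem_of_algebra by blast
  hence "eigenvalue C k" using eigenvalue_root_char_poly[OF C] by simp
  then obtain z where z: "z \<in> carrier_vec n" "z \<noteq> 0\<^sub>v n" and ev: "C *\<^sub>v z = k \<cdot>\<^sub>v z"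
    using C unfolding eigenvalue_def eigenvector_def by auto
  define u where "u = map_vec Re z"
  define w where "w = map_vec Im z"
  have uw: "u \<in> carrier_vec n" "w \<in> carrier_vec n" using z by (auto simp: u_def w_def)
  have ent: "(\<Sum>j\<in>{0..<n}. complex_of_real (A $$ (i,j)) * z $ j) = k * z $ i" if "i < n" for i
  proof -
    have "(C *\<^sub>v z) $ i = (k \<cdot>\<^sub>v z) $ i" using ev by simp
    thus ?thesis using that z Ac by (simp add: C_def scalar_prod_def)
  qed
  have Au: "A *\<^sub>v u = Re k \<cdot>\<^sub>v u - Im k \<cdot>\<^sub>v w"
  proof (rule eq_vecI)
    fix i assume "i < dim_vec (Re k \<cdot>\<^sub>v u - Im k \<cdot>\<^sub>v w)"
    hence i: "i < n" using uw by simp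
    show "(A *\<^sub>v u) $ i = (Re k \<cdot>\<^sub>v u - Im k \<cdot>\<^sub>v w) $ i"
      using arg_cong[OF ent[OF i], of Re] i z Ac
      by (simp add: u_def w_def scalar_prod_def)
  qed (use uw Ac in auto)
  have Aw: "A *\<^sub>v w = Re k \<cdot>\<^sub>v w + Im k \<cdot>\<^sub>v u"
  proof (rule eq_vecI)
    fix i assume "i < dim_vec (Re k \<cdot>\<^sub>v w + Im k \<cdot>\<^sub>v u)"
    hence i: "i < n" using uw by simp
    show "(A *\<^sub>v w) $ i = (Re k \<cdot>\<^sub>v w + Im k \<cdot>\<^sub>v u) $ i"
      using arg_cong[OF ent[OF i], of Im] i z Ac
      by (simp add: u_def w_def scalar_prod_def)
  qed (use uw Ac in auto)
  have nz: "u \<noteq> 0\<^sub>v n \<or> w \<noteq> 0\<^sub>v n"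
  proof (rule ccontr)
    assume "\<not> ?thesis"
    hence "u = 0\<^sub>v n" "w = 0\<^sub>v n" by auto
    hence "Re (z $ i) = 0 \<and> Im (z $ i) = 0" if "i < n" for i
      using that z by (metis carrier_vecD index_map_vec(1) index_zero_vec(1) u_def w_def)
    hence "z = 0\<^sub>v n" using z by (intro eq_vecI) (auto simp: complex_eq_iff)
    thus False using z by simp
  qed
  \<comment> \<open>The terms with \<open>Re k\<close> agree on both sides; what remains is
    \<open>- Im k * (w \<bullet> w) = Im k * (u \<bullet> u)\<close>.\<close>
  have "w \<bullet> (A *\<^sub>v u) = (A *\<^sub>v w) \<bullet> u" by (rule sym_scalar_prod[OF A uw(2,1)])
  hence "Im k * (u \<bullet> u + w \<bullet> w) = 0"
    unfolding Au Aw using uw comm_scalar_prod[OF uw]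
    by (simp add: scalar_prod_minus_distrib[of _ n] add_scalar_prod_distrib[of _ n] distrib_left)
  moreover have "u \<bullet> u + w \<bullet> w \<noteq> 0"
    using nz scalar_prod_self_nonneg[of u] scalar_prod_self_nonneg[of w]
      scalar_prod_self_eq_0[OF uw(1)] scalar_prod_self_eq_0[OF uw(2)] by linarith
  ultimately have "Im k = 0" by simp
  hence "A *\<^sub>v u = Re k \<cdot>\<^sub>v u" "A *\<^sub>v w = Re k \<cdot>\<^sub>v w"
    unfolding Au Aw using uw by (auto intro!: eq_vecI)
  thus ?thesis using nz uw that by blast
qed

text \<open>The Householder reflection exchanging the first unit vector and \<open>v\<close>; for \<open>w = 0\<close> the
  convention \<open>2 / 0 = 0\<close> makes it the identity.\<close>

lemma unit_vector_reflection:
  fixes v :: "real vec"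
  assumes v: "v \<in> carrier_vec n" and n: "n > 0" and unit: "v \<bullet> v = 1"
  obtains R where "sym_mat n R" "R * R = 1\<^sub>m n" "R *\<^sub>v unit_vec n 0 = v"
proof -
  define w where "w = v - unit_vec n 0"
  have w: "w \<in> carrier_vec n" using v by (simp add: w_def)
  define c where "c = 2 / (w \<bullet> w)"
  define R where "R = Matrix.mat n n (\<lambda>(i,j). (if i = j then 1 else 0) - c * (w $ i * w $ j))"
  have R: "sym_mat n R" unfolding sym_mat_def R_def by (auto intro!: eq_matI)
  have wi: "w $ i = v $ i - (if i = 0 then 1 else 0)" if "i < n" for i
    using that v n by (simp add: w_def unit_vec_def)
  have ww: "w \<bullet> w = (\<Sum>k\<in>{0..<n}. w $ k * w $ k)"
    using w by (simp add: scalar_prod_def)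
  have "w \<bullet> w = v \<bullet> v - 2 * v $ 0 + 1"
    unfolding w_def using v n
    by (simp add: scalar_prod_minus_distrib[of _ n] minus_scalar_prod_distrib[of _ n])
  \<comment> \<open>The unit length of \<open>v\<close> enters here. It gives
    \<open>c * w $ 0 = -1\<close> for nonzero \<open>w\<close>, so the reflection adds exactly
    \<open>w\<close> to the first unit vector.\<close>
  hence ww0: "w \<bullet> w = - 2 * w $ 0" using unit wi[of 0] n by simp
  have cc: "c * c * (w \<bullet> w) = 2 * c" by (simp add: c_def)
  have "R * R = 1\<^sub>m n"
  proof (rule eq_matI)
    fix i j assume "i < dim_row (1\<^sub>m n :: real mat)" "j < dim_col (1\<^sub>m n :: real mat)"
    hence ij: "i < n" "j < n" by auto
    have "(R * R) $$ (i,j) = (\<Sum>k\<in>{0..<n}. ((if i = k then 1 else 0) - c * (w $ i * w $ k))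
             * ((if k = j then 1 else 0) - c * (w $ k * w $ j)))"
      using ij by (simp add: R_def scalar_prod_def)
    also have "\<dots> = (\<Sum>k\<in>{0..<n}. (if k = i then (if i = j then 1 else 0) - c * (w $ i * w $ j) else 0)
          - (if k = j then c * (w $ i * w $ j) else 0) + (c * c * w $ i * w $ j) * (w $ k * w $ k))"
      by (intro sum.cong) (auto simp: algebra_simps)
    also have "\<dots> = (if i = j then 1 else 0) - 2 * c * (w $ i * w $ j) + (c * c * w $ i * w $ j) * (w \<bullet> w)"
      using ij unfolding ww by (simp add: sum.distrib sum_subtractf sum_distrib_left)
    also have "\<dots> = (if i = j then 1 else 0) + (c * c * (w \<bullet> w) - 2 * c) * (w $ i * w $ j)"
      by (simp add: algebra_simps)
    also have "\<dots> = (if i = j then 1 else 0)" using cc by simp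
    finally show "(R * R) $$ (i,j) = (1\<^sub>m n) $$ (i,j)" using ij by simp
  qed (auto simp: R_def)
  moreover have "R *\<^sub>v unit_vec n 0 = v"
  proof (rule eq_vecI)
    fix i assume "i < dim_vec v"
    hence i: "i < n" using v by simp
    have e: "(R *\<^sub>v unit_vec n 0) $ i = (if i = 0 then 1 else 0) - c * (w $ i * w $ 0)"
      using i n by (simp add: R_def)
    show "(R *\<^sub>v unit_vec n 0) $ i = v $ i"
    proof (cases "w $ 0 = 0")
      case True
      hence "w = 0\<^sub>v n" using ww0 scalar_prod_self_eq_0[OF w] by simp
      hence "w $ i = 0" using i by simp
      thus ?thesis using e wi[OF i] by simp
    next
      case False
      hence "c * w $ 0 = -1" unfolding c_def ww0 by simp
      have "c * (w $ i * w $ 0) = w $ i * (c * w $ 0)" by simp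
      also have "\<dots> = - (w $ i)" unfolding \<open>c * w $ 0 = -1\<close> by simp
      finally have "c * (w $ i * w $ 0) = - (w $ i)" .
      thus ?thesis using e wi[OF i] by simp
    qed
  qed (use v in \<open>simp add: R_def\<close>)
  ultimately show ?thesis using that R by blast
qed

definition orthonormal_mat :: "nat \<Rightarrow> real mat \<Rightarrow> bool" where
  "orthonormal_mat n U \<longleftrightarrow> U \<in> carrier_mat n n \<and> U * U\<^sup>T = 1\<^sub>m n \<and> U\<^sup>T * U = 1\<^sub>m n"

lemma orthonormal_matI:
  assumes "U \<in> carrier_mat n n" "U * U\<^sup>T = 1\<^sub>m n"
  shows "orthonormal_mat n U"
  unfolding orthonormal_mat_def using assms mat_mult_left_right_inverse[of U n "U\<^sup>T"] by auto

lemma transpose_mat_diag [simp]: "(mat_diag n f)\<^sup>T = mat_diag n f"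
  by (intro eq_matI) (auto simp: mat_diag_def)

text \<open>Deflation: a reflection moves a unit eigenvector to the first unit vector, which splits
  off a 1 by 1 block, and the induction hypothesis diagonalizes the remaining symmetric
  block.\<close>

lemma spectral_theorem:
  assumes "sym_mat n A"
  shows "\<exists>U e. orthonormal_mat n U \<and> A = U * mat_diag n e * U\<^sup>T"
  using assms
proof (induction n arbitrary: A)
  case 0
  hence "A = 1\<^sub>m 0 * mat_diag 0 undefined * (1\<^sub>m 0)\<^sup>T"
    by (intro eq_matI) (auto simp: sym_mat_def)
  moreover have "orthonormal_mat 0 (1\<^sub>m 0)" by (simp add: orthonormal_mat_def)
  ultimately show ?case by blast
next
  case (Suc n)
  let ?N = "Suc n"
  have A: "A \<in> carrier_mat ?N ?N" and AT: "A\<^sup>T = A" using Suc.prems by (auto simp: sym_mat_def)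
  note [simp] = assoc_mult_mat[of _ ?N ?N _ ?N _ ?N] mult_carrier_mat[of _ ?N ?N _ ?N]
  obtain l v where v: "v \<in> carrier_vec ?N" "v \<noteq> 0\<^sub>v ?N" and Av: "A *\<^sub>v v = l \<cdot>\<^sub>v v"
    using sym_mat_real_eigenvector[OF Suc.prems] by blast
  define s where "s = 1 / sqrt (v \<bullet> v)"
  define x where "x = s \<cdot>\<^sub>v v"
  have x: "x \<in> carrier_vec ?N" using v by (simp add: x_def)
  have "v \<bullet> v > 0"
    using scalar_prod_self_nonneg[of v] scalar_prod_self_eq_0[OF v(1)] v(2) by linarith
  hence unit: "x \<bullet> x = 1" unfolding x_def s_def using v by simp
  have Ax: "A *\<^sub>v x = l \<cdot>\<^sub>v x"
    unfolding x_def using A v Av by (simp add: mult_mat_vec smult_smult_assoc mult.commute)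
  obtain R where R: "sym_mat ?N R" and RR: "R * R = 1\<^sub>m ?N" and Re: "R *\<^sub>v unit_vec ?N 0 = x"
    using unit_vector_reflection[OF x _ unit] by blast
  have Rc: "R \<in> carrier_mat ?N ?N" and RT: "R\<^sup>T = R" using R by (auto simp: sym_mat_def)
  have Rx: "R *\<^sub>v x = unit_vec ?N 0"
    unfolding Re[symmetric] using Rc RR by (subst assoc_mult_mat_vec[symmetric, of _ ?N ?N _ ?N]) auto
  \<comment> \<open>\<open>R\<close> is its own inverse and transpose, so this is an orthogonal
    change of basis. Its first column is \<open>l\<close> times the first unit vector, and symmetry
    gives the same for the first row.\<close>
  define A' where "A' = R * A * R"
  have A': "A' \<in> carrier_mat ?N ?N" using A Rc by (simp add: A'_def)
  have A'T: "A'\<^sup>T = A'" unfolding A'_def using A Rc AT RT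
    by (simp add: transpose_mult[of _ ?N ?N _ ?N])
  have "A' *\<^sub>v unit_vec ?N 0 = R *\<^sub>v (A *\<^sub>v (R *\<^sub>v unit_vec ?N 0))"
    unfolding A'_def using A Rc by (simp add: assoc_mult_mat_vec[of _ ?N ?N _ ?N])
  also have "\<dots> = l \<cdot>\<^sub>v unit_vec ?N 0"
    unfolding Re Ax using Rc x by (simp add: mult_mat_vec Rx)
  finally have A'e: "A' *\<^sub>v unit_vec ?N 0 = l \<cdot>\<^sub>v unit_vec ?N 0" .
  have col0: "A' $$ (i,0) = (if i = 0 then l else 0)" if "i < ?N" for i
  proof -
    have "(A' *\<^sub>v unit_vec ?N 0) $ i = A' $$ (i,0)" using that A' by simp
    moreover have "(A' *\<^sub>v unit_vec ?N 0) $ i = l * (if i = 0 then 1 else 0)"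
      unfolding A'e using that by simp
    ultimately show ?thesis by (cases "i = 0") simp_all
  qed
  have row0: "A' $$ (0,i) = (if i = 0 then l else 0)" if "i < ?N" for i
    using col0[OF that] A'T that A' by (metis carrier_matD index_transpose_mat(1) zero_less_Suc)
  define B where "B = Matrix.mat n n (\<lambda>(i,j). A' $$ (Suc i, Suc j))"
  have "sym_mat n B" unfolding sym_mat_def
  proof
    show "B \<in> carrier_mat n n" by (simp add: B_def)
    show "B\<^sup>T = B"
    proof (rule eq_matI)
      fix i j assume "i < dim_row B" "j < dim_col B"
      hence "i < n" "j < n" by (auto simp: B_def)
      moreover from this have "A' $$ (Suc j, Suc i) = A' $$ (Suc i, Suc j)"
        using A'T A' by (metis Suc_mono carrier_matD index_transpose_mat(1))
      ultimately show "B\<^sup>T $$ (i,j) = B $$ (i,j)" by (simp add: B_def)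
    qed (auto simp: B_def)
  qed
  then obtain U e where U: "orthonormal_mat n U" and B: "B = U * mat_diag n e * U\<^sup>T"
    using Suc.IH by blast
  have Uc: "U \<in> carrier_mat n n" and UU: "U * U\<^sup>T = 1\<^sub>m n" using U by (auto simp: orthonormal_mat_def)
  define V where "V = four_block_mat (1\<^sub>m 1) (0\<^sub>m 1 n) (0\<^sub>m n 1) U"
  define f where "f = case_nat l e"
  have V: "V \<in> carrier_mat ?N ?N" using Uc by (auto simp: V_def)
  have VT: "V\<^sup>T = four_block_mat (1\<^sub>m 1) (0\<^sub>m 1 n) (0\<^sub>m n 1) (U\<^sup>T)"
    unfolding V_def using Uc by (subst transpose_four_block_mat[of _ 1 1 _ n _ n]) auto
  have D: "mat_diag ?N f = four_block_mat (mat_diag 1 (\<lambda>_. l)) (0\<^sub>m 1 n) (0\<^sub>m n 1) (mat_diag n e)"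
    by (rule eq_matI) (auto simp: mat_diag_def f_def split: nat.splits)
  have bd: "four_block_mat P (0\<^sub>m 1 n) (0\<^sub>m n 1) X * four_block_mat Q (0\<^sub>m 1 n) (0\<^sub>m n 1) Y
      = four_block_mat (P * Q) (0\<^sub>m 1 n) (0\<^sub>m n 1) (X * Y)"
    if "P \<in> carrier_mat 1 1" "Q \<in> carrier_mat 1 1" "X \<in> carrier_mat n n" "Y \<in> carrier_mat n n"
    for P Q X Y :: "real mat"
    using that by (subst mult_four_block_mat[of _ 1 1 _ n _ n _ _ 1 _ n]) auto
  have "V * V\<^sup>T = four_block_mat (1\<^sub>m 1) (0\<^sub>m 1 n) (0\<^sub>m n 1) (1\<^sub>m n)"
    unfolding VT unfolding V_def using Uc UU by (subst bd) auto
  hence VV: "V * V\<^sup>T = 1\<^sub>m ?N" by simp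
  have "A' = four_block_mat (mat_diag 1 (\<lambda>_. l)) (0\<^sub>m 1 n) (0\<^sub>m n 1) B"
    by (rule eq_matI) (use A' in \<open>auto simp: B_def mat_diag_def col0 row0 Suc_diff_Suc\<close>)
  also have "\<dots> = V * mat_diag ?N f * V\<^sup>T"
    unfolding D VT B unfolding V_def using Uc
    by (simp add: bd mult_carrier_mat[of _ n n _ n] mult_carrier_mat[of _ 1 1 _ 1]
        left_mult_one_mat[of _ 1 1] right_mult_one_mat[of _ 1 1] del: One_nat_def)
  finally have A'V: "A' = V * mat_diag ?N f * V\<^sup>T" .
  have RRX: "R * (R * X) = X" if "X \<in> carrier_mat ?N ?N" for X
    using that Rc RR by (metis assoc_mult_mat left_mult_one_mat)
  have dc: "mat_diag ?N f \<in> carrier_mat ?N ?N" by simp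
  have "A = R * A' * R" unfolding A'_def using A Rc by (simp add: RRX RR)
  also have "\<dots> = (R * V) * mat_diag ?N f * (R * V)\<^sup>T"
    unfolding A'V using V Rc RT dc by (simp add: transpose_mult[of _ ?N ?N _ ?N])
  finally have 1: "A = (R * V) * mat_diag ?N f * (R * V)\<^sup>T" .
  have "(R * V) * (R * V)\<^sup>T = R * (V * V\<^sup>T) * R"
    using V Rc RT by (simp add: transpose_mult[of _ ?N ?N _ ?N])
  hence "(R * V) * (R * V)\<^sup>T = 1\<^sub>m ?N" using VV Rc RR by simp
  moreover have "R * V \<in> carrier_mat ?N ?N" using V Rc by simp
  ultimately have "orthonormal_mat ?N (R * V)" by (intro orthonormal_matI)
  thus ?case using 1 by blast
qed

section \<open>Inertia, congruence and rank factorizations\<close>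

lemma orthonormal_matD:
  assumes "orthonormal_mat n U"
  shows "U \<in> carrier_mat n n" "U\<^sup>T \<in> carrier_mat n n" "U * U\<^sup>T = 1\<^sub>m n" "U\<^sup>T * U = 1\<^sub>m n"
  using assms by (auto simp: orthonormal_mat_def)

lemma orthonormal_mult_cancel:
  assumes "orthonormal_mat n U" "X \<in> carrier_mat n m"
  shows "U * (U\<^sup>T * X) = X" "U\<^sup>T * (U * X) = X"
  using orthonormal_matD[OF assms(1)] assms(2)
  by (simp_all add: assoc_mult_mat[of _ n n _ n _ m, symmetric])

lemma diagonalized_mult:
  assumes "orthonormal_mat n U"
  shows "(U * mat_diag n e * U\<^sup>T) * (U * mat_diag n f * U\<^sup>T)
    = U * mat_diag n (\<lambda>i. e i * f i) * U\<^sup>T"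
proof -
  note U = orthonormal_matD[OF assms]
  have "(U * mat_diag n e * U\<^sup>T) * (U * mat_diag n f * U\<^sup>T)
     = U * (mat_diag n e * (U\<^sup>T * (U * (mat_diag n f * U\<^sup>T))))"
    using U(1,2) by (simp add: assoc_mult_mat[of _ n n _ n _ n] mult_carrier_mat[of _ n n _ n])
  also have "\<dots> = U * (mat_diag n e * (mat_diag n f * U\<^sup>T))"
    using U(1,2) by (subst orthonormal_mult_cancel(2)[OF assms, of _ n])
      (auto intro: mult_carrier_mat[of _ n n _ n])
  also have "\<dots> = U * ((mat_diag n e * mat_diag n f) * U\<^sup>T)"
    using U(1,2) by (simp add: assoc_mult_mat[of _ n n _ n _ n] del: mat_diag_diag)
  also have "\<dots> = U * mat_diag n (\<lambda>i. e i * f i) * U\<^sup>T"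
    using U(1,2) unfolding mat_diag_diag by (subst assoc_mult_mat[of _ n n _ n _ n]) auto
  finally show ?thesis .
qed

lemma sym_mat_diagonalized:
  assumes "orthonormal_mat n U"
  shows "sym_mat n (U * mat_diag n e * U\<^sup>T)"
  using orthonormal_matD[OF assms] unfolding sym_mat_def
  by (simp add: assoc_mult_mat[of _ n n _ n _ n] mult_carrier_mat[of _ n n _ n]
      transpose_mult[of _ n n _ n])

lemma char_poly_diagonalized:
  assumes "orthonormal_mat n U"
  shows "char_poly (U * mat_diag n e * U\<^sup>T) = (\<Prod>i<n. [:- e i, 1:])"
proof -
  note U = orthonormal_matD[OF assms]
  have "similar_mat (U * mat_diag n e * U\<^sup>T) (mat_diag n e)"
    unfolding similar_mat_def similar_mat_wit_def
    by (intro exI[of _ U] exI[of _ "U\<^sup>T"])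
      (use U in \<open>auto simp: Let_def intro: mult_carrier_mat[of _ n n _ n]\<close>)
  hence "char_poly (U * mat_diag n e * U\<^sup>T) = char_poly (mat_diag n e)"
    by (rule char_poly_similar)
  also have "\<dots> = (\<Prod>a\<leftarrow>diag_mat (mat_diag n e). [:- a, 1:])"
    by (rule char_poly_upper_triangular[of _ n]) (auto simp: mat_diag_def)
  also have "diag_mat (mat_diag n e) = map e [0..<n]"
    by (auto simp: diag_mat_def mat_diag_def intro: nth_equalityI)
  also have "(\<Prod>a\<leftarrow>map e [0..<n]. [:- a, 1:]) = (\<Prod>i<n. [:- e i, 1:])"
    by (simp add: o_def prod.distinct_set_conv_list[symmetric] atLeast0LessThan
        flip: prod.distinct_set_conv_list)
  finally show ?thesis .
qed

lemma order_prod_linear_factors: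
  fixes e :: "nat \<Rightarrow> real"
  shows "order x (\<Prod>i<n. [:- e i, 1:]) = card {i. i < n \<and> e i = x}"
proof (induction n)
  case (Suc n)
  have "order x (\<Prod>i<Suc n. [:- e i, 1:]) = order x (\<Prod>i<n. [:- e i, 1:]) + order x [:- e n, 1:]"
    by (simp add: order_mult del: mult_pCons_right mult_pCons_left)
  also have "order x [:- e n, 1:] = (if e n = x then 1 else 0)"
    using order_power_n_n[of x 1] by (auto intro: order_0I)
  also have "order x (\<Prod>i<n. [:- e i, 1:]) = card {i. i < n \<and> e i = x}" by (rule Suc.IH)
  finally have "order x (\<Prod>i<Suc n. [:- e i, 1:])
    = card {i. i < n \<and> e i = x} + (if e n = x then 1 else 0)" .
  moreover have "{i. i < Suc n \<and> e i = x} = (if e n = x then insert n {i. i < n \<and> e i = x} else {i. i < n \<and> e i = x})"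
    by (auto simp: less_Suc_eq)
  ultimately show ?case by (simp del: prod.lessThan_Suc)
qed simp

text \<open>The order of a root \<open>x\<close> is the size of the fibre of \<open>e\<close> over
  \<open>x\<close>; summing fibre sizes over all values of one sign counts the indices of that
  sign.\<close>

lemma inertia_diagonalized:
  assumes "orthonormal_mat n U"
  shows "inertia (U * mat_diag n e * U\<^sup>T) =
    (card {i. i < n \<and> e i > 0}, card {i. i < n \<and> e i < 0}, card {i. i < n \<and> e i = 0})"
proof -
  let ?c = "\<Prod>i<n. [:- e i, 1:]"
  have sum: "(\<Sum>x\<in>{x. Q x \<and> poly ?c x = 0}. order x ?c) = card {i. i < n \<and> Q (e i)}" for Q
  proof -
    have roots: "{x. Q x \<and> poly ?c x = 0} = e ` {i. i < n \<and> Q (e i)}"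
      by (auto simp: poly_prod)
    have "(\<Sum>x\<in>e ` {i. i < n \<and> Q (e i)}. order x ?c)
        = (\<Sum>x\<in>e ` {i. i < n \<and> Q (e i)}. card {i \<in> {i. i < n \<and> Q (e i)}. e i = x})"
      unfolding order_prod_linear_factors by (intro sum.cong refl arg_cong[of _ _ card]) auto
    also have "\<dots> = card {i. i < n \<and> Q (e i)}"
      by (subst card_eq_sum, subst sum.image_gen[of _ _ e]) auto
    finally show ?thesis unfolding roots .
  qed
  show ?thesis unfolding inertia_def char_poly_diagonalized[OF assms] prod.inject
    by (intro conjI sum[of "\<lambda>x. x > 0"] sum[of "\<lambda>x. x < 0"] order_prod_linear_factors)
qed

text \<open>Lets eigenvalues be rearranged to a prescribed pattern when only the multiplicities are
  known. Bijections between corresponding fibres are glued; fibres stay apart because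
  \<open>g (h a)\<close> recovers \<open>f a\<close>.\<close>

lemma bij_betw_matching_fibres:
  assumes fin: "finite A" and card: "\<And>x. card {a\<in>A. f a = x} = card {a\<in>A. g a = x}"
  obtains h where "bij_betw h A A" "\<And>a. a \<in> A \<Longrightarrow> g (h a) = f a"
proof -
  have "\<forall>x. \<exists>k. bij_betw k {a\<in>A. f a = x} {a\<in>A. g a = x}"
    using fin card by (auto intro!: finite_same_card_bij)
  then obtain k where k: "\<And>x. bij_betw (k x) {a\<in>A. f a = x} {a\<in>A. g a = x}" by metis
  define h where "h a = k (f a) a" for a
  have h: "h a \<in> A \<and> g (h a) = f a" if "a \<in> A" for a
    using bij_betwE[OF k[of "f a"]] that by (auto simp: h_def)
  have "inj_on h A"
  proof (rule inj_onI)
    fix a b assume ab: "a \<in> A" "b \<in> A" "h a = h b"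
    hence "f a = f b" using h by metis
    thus "a = b" using ab bij_betw_imp_inj_on[OF k[of "f a"]] unfolding h_def inj_on_def by auto
  qed
  moreover have "h ` A \<subseteq> A" using h by auto
  ultimately have "bij_betw h A A" using fin by (simp add: bij_betw_def endo_inj_surj)
  thus ?thesis using that h by blast
qed

lemma diagonalized_permute:
  assumes U: "orthonormal_mat n U" and h: "bij_betw h {..<n} {..<n}"
  obtains V where "orthonormal_mat n V"
    "U * mat_diag n e * U\<^sup>T = V * mat_diag n (\<lambda>i. e (h i)) * V\<^sup>T"
proof
  note Uc = orthonormal_matD[OF U]
  define V where "V = Matrix.mat n n (\<lambda>(i,j). U $$ (i, h j))"
  have Vc: "V \<in> carrier_mat n n" by (simp add: V_def)
  have hn: "h i < n" if "i < n" for i using bij_betwE[OF h] that by auto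
  have eq: "U * mat_diag n f * U\<^sup>T = V * mat_diag n (\<lambda>i. f (h i)) * V\<^sup>T" for f
  proof (rule eq_matI)
    fix i j assume "i < dim_row (V * mat_diag n (\<lambda>i. f (h i)) * V\<^sup>T)"
      "j < dim_col (V * mat_diag n (\<lambda>i. f (h i)) * V\<^sup>T)"
    hence ij: "i < n" "j < n" using Vc by auto
    have "(U * mat_diag n f * U\<^sup>T) $$ (i,j) = (\<Sum>k<n. U $$ (i,k) * f k * U $$ (j,k))"
      using Uc(1) ij by (simp add: mat_diag_mult_right[OF Uc(1)] scalar_prod_def atLeast0LessThan)
    also have "\<dots> = (\<Sum>k<n. U $$ (i,h k) * f (h k) * U $$ (j,h k))"
      by (rule sum.reindex_bij_betw[OF h, symmetric])
    also have "\<dots> = (V * mat_diag n (\<lambda>i. f (h i)) * V\<^sup>T) $$ (i,j)"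
      using Vc ij unfolding mat_diag_mult_right[OF Vc]
      by (simp add: scalar_prod_def atLeast0LessThan) (simp add: V_def)
    finally show "(U * mat_diag n f * U\<^sup>T) $$ (i,j)
        = (V * mat_diag n (\<lambda>i. f (h i)) * V\<^sup>T) $$ (i,j)" .
  qed (use Uc Vc in auto)
  \<comment> \<open>Orthogonality of \<open>V\<close> is the same reindexing identity for the
    constant diagonal 1.\<close>
  have "V * V\<^sup>T = 1\<^sub>m n" using eq[of "\<lambda>_. 1"] Uc Vc by simp
  thus "orthonormal_mat n V" using Vc by (intro orthonormal_matI)
  show "U * mat_diag n e * U\<^sup>T = V * mat_diag n (\<lambda>i. e (h i)) * V\<^sup>T" by (rule eq)
qed

text \<open>The index set \<open>I\<close> is free apart from its size. This lets the factorizations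
  of \<open>X\<close> and \<open>Y\<close> occupy disjoint sets of coordinates, so that they can be
  added inside one square matrix.\<close>

lemma rank_factorization:
  assumes X: "sym_mat n X" and I: "I \<subseteq> {..<n}" and r: "vec_space.rank n X = card I"
  obtains F G where "F \<in> carrier_mat n n" "G \<in> carrier_mat n n"
    "X = F * mat_diag n (\<lambda>i. if i \<in> I then 1 else 0) * G"
proof -
  obtain U e where U: "orthonormal_mat n U" and Xe: "X = U * mat_diag n e * U\<^sup>T"
    using spectral_theorem[OF X] by blast
  have c: "card {i. i < n \<and> e i \<noteq> 0} = card I"
    using rank_diagonalized[OF orthonormal_matD[OF U], of e] r Xe by simp
  have I': "{a\<in>{..<n}. a \<in> I} = I" using I by auto
  have "card {a\<in>{..<n}. (a \<in> I) = x} = card {a\<in>{..<n}. (e a \<noteq> 0) = x}" for x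
  proof (cases x)
    case True
    have "{a\<in>{..<n}. e a \<noteq> 0} = {i. i < n \<and> e i \<noteq> 0}" by auto
    thus ?thesis using True c I' by simp
  next
    case False
    have "{a\<in>{..<n}. a \<notin> I} = {..<n} - I" "{a\<in>{..<n}. e a = 0} = {..<n} - {i. i < n \<and> e i \<noteq> 0}"
      by auto
    moreover have "card ({..<n} - I) = card {..<n} - card I"
      by (rule card_Diff_subset[OF finite_subset[OF I] I]) simp
    moreover have "card ({..<n} - {i. i < n \<and> e i \<noteq> 0}) = card {..<n} - card {i. i < n \<and> e i \<noteq> 0}"
      by (rule card_Diff_subset) auto
    ultimately show ?thesis using False c by simp
  qed
  then obtain h where h: "bij_betw h {..<n} {..<n}"
    and hI: "\<And>a. a \<in> {..<n} \<Longrightarrow> (e (h a) \<noteq> 0) = (a \<in> I)"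
    using bij_betw_matching_fibres[of "{..<n}" "\<lambda>a. a \<in> I" "\<lambda>a. e a \<noteq> 0"] by auto
  obtain V where V: "orthonormal_mat n V" and XV: "X = V * mat_diag n (\<lambda>i. e (h i)) * V\<^sup>T"
    using diagonalized_permute[OF U h] Xe by metis
  note Vc = orthonormal_matD(1,2)[OF V]
  \<comment> \<open>After the reordering the eigenvalues vanish off \<open>I\<close>, so the 0-1
    diagonal matrix of \<open>I\<close> can be split off as a factor.\<close>
  have "mat_diag n (\<lambda>i. e (h i)) = mat_diag n (\<lambda>i. (if i \<in> I then 1 else 0) * e (h i))"
    using hI by (intro eq_matI) (auto simp: mat_diag_def)
  hence "mat_diag n (\<lambda>i. e (h i)) = mat_diag n (\<lambda>i. if i \<in> I then 1 else 0) * mat_diag n (\<lambda>i. e (h i))"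
    unfolding mat_diag_diag .
  hence "X = V * (mat_diag n (\<lambda>i. if i \<in> I then 1 else 0) * mat_diag n (\<lambda>i. e (h i))) * V\<^sup>T" using XV by metis
  also have "\<dots> = V * mat_diag n (\<lambda>i. if i \<in> I then 1 else 0) * (mat_diag n (\<lambda>i. e (h i)) * V\<^sup>T)"
    using Vc by (simp add: assoc_mult_mat[of _ n n _ n _ n] mult_carrier_mat[of _ n n _ n] del: mat_diag_diag)
  finally show ?thesis using that[OF Vc(1), of "mat_diag n (\<lambda>i. e (h i)) * V\<^sup>T"] Vc
    by (simp add: mult_carrier_mat[of _ n n _ n])
qed

text \<open>The existence half of Sylvester's law: permute the eigenvalues so that their signs
  follow \<open>j\<close>, then scale each eigenvector by the root of the absolute
  eigenvalue.\<close>

lemma sym_mat_congruent_diag: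
  assumes A: "sym_mat n A" and j: "\<And>k. k < n \<Longrightarrow> j k \<in> {-1, 0, 1 :: real}"
    and inertia: "inertia A = (card {i. i < n \<and> j i = 1}, card {i. i < n \<and> j i = -1}, card {i. i < n \<and> j i = 0})"
  obtains P where "P \<in> carrier_mat n n" "invertible_mat P" "A = P * mat_diag n j * P\<^sup>T"
proof -
  obtain U e where U: "orthonormal_mat n U" and Ae: "A = U * mat_diag n e * U\<^sup>T"
    using spectral_theorem[OF A] by blast
  have c: "card {i. i < n \<and> j i = 1} = card {i. i < n \<and> e i > 0}"
    "card {i. i < n \<and> j i = -1} = card {i. i < n \<and> e i < 0}"
    "card {i. i < n \<and> j i = 0} = card {i. i < n \<and> e i = 0}"
    using inertia inertia_diagonalized[OF U, of e] Ae by auto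
  have "card {a\<in>{..<n}. j a = x} = card {a\<in>{..<n}. sgn (e a) = x}" for x
  proof -
    consider "x = 1" | "x = -1" | "x = 0" | "x \<notin> {-1,0,1}" by auto
    thus ?thesis
    proof cases
      case 4
      have "j a \<noteq> x" if "a < n" for a using 4 j[OF that] by auto
      moreover have "sgn (e a) \<noteq> x" for a using 4 by (auto simp: sgn_if)
      ultimately have "{a\<in>{..<n}. j a = x} = {}" "{a\<in>{..<n}. sgn (e a) = x} = {}" by auto
      thus ?thesis by (simp only:)
    qed (use c in \<open>auto simp: sgn_eq_0_iff sgn_1_pos sgn_1_neg\<close>)
  qed
  then obtain h where h: "bij_betw h {..<n} {..<n}"
    and hj: "\<And>a. a \<in> {..<n} \<Longrightarrow> sgn (e (h a)) = j a"
    using bij_betw_matching_fibres[of "{..<n}" j "\<lambda>a. sgn (e a)"] by auto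
  obtain V where V: "orthonormal_mat n V" and AV: "A = V * mat_diag n (\<lambda>i. e (h i)) * V\<^sup>T"
    using diagonalized_permute[OF U h] Ae by metis
  note Vc = orthonormal_matD[OF V]
  \<comment> \<open>On the kernel the scale is 1 instead of 0, which keeps \<open>P\<close>
    invertible while \<open>s i * j i * s i\<close> is still 0 there.\<close>
  define s where "s i = (if e (h i) = 0 then 1 else sqrt \<bar>e (h i)\<bar>)" for i
  have s0: "s i \<noteq> 0" for i by (simp add: s_def)
  define P where "P = V * mat_diag n s"
  have P: "P \<in> carrier_mat n n" using Vc by (simp add: P_def mult_carrier_mat[of _ n n _ n])
  define W where "W = mat_diag n (\<lambda>i. 1 / s i) * V\<^sup>T"
  have W: "W \<in> carrier_mat n n" using Vc by (simp add: W_def mult_carrier_mat[of _ n n _ n])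
  have "P * W = V * (mat_diag n s * mat_diag n (\<lambda>i. 1 / s i)) * V\<^sup>T"
    unfolding P_def W_def using Vc(1,2)
    by (simp add: assoc_mult_mat[of _ n n _ n _ n] mult_carrier_mat[of _ n n _ n] del: mat_diag_diag)
  also have "\<dots> = 1\<^sub>m n" using s0 Vc by simp
  finally have inv: "P * W = 1\<^sub>m n" .
  have "invertible_mat P" unfolding invertible_mat_def inverts_mat_def
    using P W inv mat_mult_left_right_inverse[OF P W inv] by auto
  have "s i * j i * s i = e (h i)" if "i < n" for i
  proof -
    have "s i * sgn (e (h i)) * s i = e (h i)" by (auto simp: s_def sgn_if)
    thus ?thesis using hj[of i] that by simp
  qed
  hence "mat_diag n (\<lambda>i. e (h i)) = mat_diag n (\<lambda>i. s i * j i * s i)"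
    by (intro eq_matI) (auto simp: mat_diag_def)
  also have "\<dots> = mat_diag n s * mat_diag n j * mat_diag n s" by simp
  finally have "A = V * (mat_diag n s * mat_diag n j * mat_diag n s) * V\<^sup>T" using AV by metis
  also have "\<dots> = P * mat_diag n j * P\<^sup>T" unfolding P_def using Vc(1,2)
    by (simp add: assoc_mult_mat[of _ n n _ n _ n] mult_carrier_mat[of _ n n _ n]
        transpose_mult[of _ n n _ n] del: mat_diag_diag)
  finally show ?thesis using that P \<open>invertible_mat P\<close> by blast
qed

text \<open>Inverting the eigenvalues with \<open>1 / 0 = 0\<close> satisfies the identity on the
  kernel as well.\<close>

lemma sym_mat_generalized_inverse:
  assumes "sym_mat n A"
  obtains Z where "sym_mat n Z" "A * Z * A = A"
proof -
  obtain U e where U: "orthonormal_mat n U" and A: "A = U * mat_diag n e * U\<^sup>T"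
    using spectral_theorem[OF assms] by blast
  have "e i * (1 / e i) * e i = e i" for i by simp
  hence "A * (U * mat_diag n (\<lambda>i. 1 / e i) * U\<^sup>T) * A = A"
    unfolding A diagonalized_mult[OF U] by presburger
  thus ?thesis using that sym_mat_diagonalized[OF U] by blast
qed

section \<open>Positive semidefinite matrices and their square roots\<close>

lemma psdD:
  assumes "psd n X"
  shows "sym_mat n X" "X \<in> carrier_mat n n" "X\<^sup>T = X"
    "x \<in> carrier_vec n \<Longrightarrow> 0 \<le> x \<bullet> (X *\<^sub>v x)"
  using assms by (auto simp: psd_def sym_mat_def)

lemma psd_mult_transpose:
  assumes F: "F \<in> carrier_mat n m"
  shows "psd n (F * F\<^sup>T)"
  unfolding psd_def
proof (intro conjI ballI)
  show "sym_mat n (F * F\<^sup>T)" using F by (auto simp: sym_mat_def transpose_mult[of _ n m _ n])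
  fix x :: "real vec" assume x: "x \<in> carrier_vec n"
  have "x \<bullet> (F * F\<^sup>T *\<^sub>v x) = x \<bullet> (F *\<^sub>v (F\<^sup>T *\<^sub>v x))"
    using F x by (simp add: assoc_mult_mat_vec[of _ n m _ n])
  also have "\<dots> = (F\<^sup>T *\<^sub>v x) \<bullet> (F\<^sup>T *\<^sub>v x)"
    using transpose_vec_mult_scalar[of F n m "F\<^sup>T *\<^sub>v x" x] F x by simp
  finally show "0 \<le> x \<bullet> (F * F\<^sup>T *\<^sub>v x)" using scalar_prod_self_nonneg by metis
qed

lemma psd_square:
  assumes "sym_mat n R"
  shows "psd n (R * R)"
  using psd_mult_transpose[of R n n] assms by (simp add: sym_mat_def)

lemma diagonalized_eigenvector:
  assumes U: "orthonormal_mat n U" and i: "i < n"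
  shows "(U * mat_diag n e * U\<^sup>T) *\<^sub>v col U i = e i \<cdot>\<^sub>v col U i"
proof -
  note Uc = orthonormal_matD[OF U]
  have "U * mat_diag n e * U\<^sup>T * U = U * mat_diag n e"
    using Uc by (simp add: assoc_mult_mat[of _ n n _ n _ n] mult_carrier_mat[of _ n n _ n]
        right_mult_one_mat[of _ n n])
  hence "(U * mat_diag n e * U\<^sup>T) *\<^sub>v col U i = col (U * mat_diag n e) i"
    using Uc i by (subst col_mult2[symmetric, of _ n n _ n]) auto
  also have "\<dots> = e i \<cdot>\<^sub>v col U i"
    unfolding mat_diag_mult_right[OF Uc(1)] using Uc i by (intro eq_vecI) auto
  finally show ?thesis .
qed

lemma orthonormal_mat_col:
  assumes U: "orthonormal_mat n U" and i: "i < n"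
  shows "col U i \<in> carrier_vec n" "col U i \<bullet> col U i = 1"
proof -
  note Uc = orthonormal_matD[OF U]
  show "col U i \<in> carrier_vec n" using Uc i by auto
  have "(U\<^sup>T * U) $$ (i,i) = col U i \<bullet> col U i" using Uc(1) i by simp
  thus "col U i \<bullet> col U i = 1" using Uc(4) i by simp
qed

lemma psd_diagonalized_nonneg:
  assumes U: "orthonormal_mat n U" and i: "i < n" and X: "psd n (U * mat_diag n e * U\<^sup>T)"
  shows "e i \<ge> 0"
  using psdD(4)[OF X orthonormal_mat_col(1)[OF U i]] diagonalized_eigenvector[OF U i, of e]
    orthonormal_mat_col[OF U i] by simp

lemma psd_sqrt_exists:
  assumes X: "psd n X"
  shows "\<exists>Y. psd n Y \<and> Y * Y = X"
proof -
  obtain U e where U: "orthonormal_mat n U" and Xe: "X = U * mat_diag n e * U\<^sup>T"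
    using spectral_theorem[OF psdD(1)[OF X]] by blast
  have e: "e i \<ge> 0" if "i < n" for i using psd_diagonalized_nonneg[OF U that] X Xe by simp
  have sq: "(U * mat_diag n (\<lambda>i. sqrt (f i)) * U\<^sup>T) * (U * mat_diag n (\<lambda>i. sqrt (f i)) * U\<^sup>T)
      = U * mat_diag n f * U\<^sup>T" if "\<And>i. i < n \<Longrightarrow> f i \<ge> 0" for f
  proof -
    have "mat_diag n (\<lambda>i. sqrt (f i) * sqrt (f i)) = mat_diag n f"
      using that by (intro eq_matI) (auto simp: mat_diag_def)
    thus ?thesis unfolding diagonalized_mult[OF U] by simp
  qed
  \<comment> \<open>The candidate root is psd because it is itself the square of a symmetric matrix,
    the one with the fourth roots of the eigenvalues.\<close>
  have "psd n (U * mat_diag n (\<lambda>i. sqrt (e i)) * U\<^sup>T)"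
    using psd_square[OF sym_mat_diagonalized[OF U, of "\<lambda>i. sqrt (sqrt (e i))"]] sq[of "\<lambda>i. sqrt (e i)"] e
    by simp
  thus ?thesis using sq[of e] e Xe by blast
qed

lemma mat_eq_by_vecs:
  fixes A B :: "real mat"
  assumes A: "A \<in> carrier_mat n m" and B: "B \<in> carrier_mat n m"
    and eq: "\<And>x. x \<in> carrier_vec m \<Longrightarrow> A *\<^sub>v x = B *\<^sub>v x"
  shows "A = B"
proof (rule eq_matI)
  fix i j assume "i < dim_row B" "j < dim_col B"
  hence ij: "i < n" "j < m" using B by auto
  have "(A *\<^sub>v unit_vec m j) $ i = (B *\<^sub>v unit_vec m j) $ i" using eq by simp
  thus "A $$ (i,j) = B $$ (i,j)" using ij A B by simp
qed (use A B in auto)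

lemma vec_eq_by_scalar_prod:
  fixes v w :: "real vec"
  assumes v: "v \<in> carrier_vec n" and w: "w \<in> carrier_vec n"
    and eq: "\<And>x. x \<in> carrier_vec n \<Longrightarrow> x \<bullet> v = x \<bullet> w"
  shows "v = w"
proof (rule eq_vecI)
  fix i assume "i < dim_vec w"
  thus "v $ i = w $ i" using eq[of "unit_vec n i"] v w by simp
qed (use v w in auto)

text \<open>For an eigenvector \<open>v\<close> of \<open>Y'\<close> with eigenvalue
  \<open>l\<close>, the vector \<open>g = Y v - l v\<close> satisfies \<open>Y g = - l g\<close>,
  since \<open>Y\<close> and \<open>Y'\<close> have the same square. A psd \<open>Y\<close> has no
  negative eigenvalue, so \<open>g = 0\<close>; hence \<open>Y\<close> and \<open>Y'\<close> agree
  on an eigenbasis.\<close>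

lemma psd_square_inj:
  assumes Y: "psd n Y" and Y': "psd n Y'" and eq: "Y * Y = Y' * Y'"
  shows "Y = Y'"
proof -
  obtain U e where U: "orthonormal_mat n U" and Ye: "Y' = U * mat_diag n e * U\<^sup>T"
    using spectral_theorem[OF psdD(1)[OF Y']] by blast
  note Uc = orthonormal_matD[OF U]
  note c = psdD(2)[OF Y] psdD(2)[OF Y']
  have col: "Y *\<^sub>v col U i = Y' *\<^sub>v col U i" if i: "i < n" for i
  proof -
    define v where "v = col U i"
    define l where "l = e i"
    have v: "v \<in> carrier_vec n" using orthonormal_mat_col(1)[OF U i] by (simp add: v_def)
    have l: "l \<ge> 0" using psd_diagonalized_nonneg[OF U i] Y' Ye by (simp add: l_def)
    have Y'v: "Y' *\<^sub>v v = l \<cdot>\<^sub>v v"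
      unfolding v_def l_def Ye by (rule diagonalized_eigenvector[OF U i])
    define g where "g = Y *\<^sub>v v - l \<cdot>\<^sub>v v"
    have g: "g \<in> carrier_vec n" using v c by (simp add: g_def)
    have "Y *\<^sub>v (Y *\<^sub>v v) = Y' *\<^sub>v (Y' *\<^sub>v v)"
      using eq c v by (metis assoc_mult_mat_vec)
    hence YYv: "Y *\<^sub>v (Y *\<^sub>v v) = (l * l) \<cdot>\<^sub>v v"
      using c v by (simp add: Y'v mult_mat_vec smult_smult_assoc)
    have "Y *\<^sub>v g = (l * l) \<cdot>\<^sub>v v - l \<cdot>\<^sub>v (Y *\<^sub>v v)"
      unfolding g_def using c v by (simp add: mult_minus_distrib_mat_vec[of _ n n] YYv mult_mat_vec)
    also have "\<dots> = - l \<cdot>\<^sub>v g"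
      unfolding g_def using c v by (intro eq_vecI) (auto simp: algebra_simps)
    finally have Yg: "Y *\<^sub>v g = - l \<cdot>\<^sub>v g" .
    have "g \<bullet> g = 0"
    proof (cases "l = 0")
      case True
      \<comment> \<open>For \<open>l = 0\<close> the sign argument says nothing. Here
        \<open>g\<close> lies both in the range and in the kernel of the symmetric \<open>Y\<close>,
        hence is orthogonal to itself.\<close>
      have gv: "g = Y *\<^sub>v v" unfolding g_def True using c v by (intro eq_vecI) auto
      have "g \<bullet> g = v \<bullet> (Y *\<^sub>v g)"
        using sym_scalar_prod[OF psdD(1)[OF Y] v g] gv by simp
      thus ?thesis using Yg True v g by simp
    next
      case False
      have "0 \<le> - l * (g \<bullet> g)" using psdD(4)[OF Y g] Yg g by simp
      hence "l * (g \<bullet> g) \<le> 0" by simp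
      hence "g \<bullet> g \<le> 0" using l False by (simp add: mult_le_0_iff)
      thus ?thesis using scalar_prod_self_nonneg[of g] by linarith
    qed
    hence "g = 0\<^sub>v n" using scalar_prod_self_eq_0[OF g] by simp
    hence "Y *\<^sub>v v = l \<cdot>\<^sub>v v"
    proof -
      assume g0: "g = 0\<^sub>v n"
      show ?thesis
      proof (rule eq_vecI)
        fix i assume "i < dim_vec (l \<cdot>\<^sub>v v)"
        hence i: "i < n" using v by simp
        have "g $ i = 0" using g0 i by simp
        thus "(Y *\<^sub>v v) $ i = (l \<cdot>\<^sub>v v) $ i" unfolding g_def using v c i by simp
      qed (use v c in auto)
    qed
    thus ?thesis using Y'v by (simp add: v_def)
  qed
  have "Y * U = Y' * U"
  proof (rule mat_col_eqI)
    fix i assume "i < dim_col (Y' * U)"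
    hence i: "i < n" using Uc by simp
    show "col (Y * U) i = col (Y' * U) i" unfolding col_mult2[OF c(1) Uc(1) i] col_mult2[OF c(2) Uc(1) i] by (rule col[OF i])
  qed (use c Uc in auto)
  hence "Y * U * U\<^sup>T = Y' * U * U\<^sup>T" by simp
  thus ?thesis using c Uc by (simp add: assoc_mult_mat[of _ n n _ n _ n])
qed

lemma psd_sqrt:
  assumes "psd n X"
  shows "psd n (psd_sqrt n X)" "psd_sqrt n X * psd_sqrt n X = X"
proof -
  have "\<exists>!Y. psd n Y \<and> Y * Y = X"
    using psd_sqrt_exists[OF assms] psd_square_inj by metis
  from theI'[OF this] show "psd n (psd_sqrt n X)" "psd_sqrt n X * psd_sqrt n X = X"
    unfolding psd_sqrt_def by auto
qed

lemma psd_sqrt_eqI: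
  assumes "psd n Y" "Y * Y = X"
  shows "psd_sqrt n X = Y"
  unfolding psd_sqrt_def using assms psd_square_inj by (intro the_equality) auto

text \<open>Turns the semi-inner product of \<open>X\<close> into the Euclidean one, from which
  definiteness modulo the kernel and the Cauchy-Schwarz inequality are inherited.\<close>

lemma psd_form_eq_sqrt:
  assumes X: "psd n X" and x: "x \<in> carrier_vec n" and y: "y \<in> carrier_vec n"
  shows "x \<bullet> (X *\<^sub>v y) = (psd_sqrt n X *\<^sub>v x) \<bullet> (psd_sqrt n X *\<^sub>v y)"
proof -
  let ?Y = "psd_sqrt n X"
  note Y = psd_sqrt[OF X] and Yc = psdD(2)[OF psd_sqrt(1)[OF X]]
  have "x \<bullet> (X *\<^sub>v y) = x \<bullet> (?Y *\<^sub>v (?Y *\<^sub>v y))"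
    using assoc_mult_mat_vec[OF Yc Yc y] Y(2) by simp
  also have "\<dots> = (?Y *\<^sub>v x) \<bullet> (?Y *\<^sub>v y)"
    by (rule sym_scalar_prod[OF psdD(1)[OF Y(1)] x]) (use Yc y in auto)
  finally show ?thesis .
qed

lemma psd_form_eq_0:
  assumes X: "psd n X" and x: "x \<in> carrier_vec n" and z: "x \<bullet> (X *\<^sub>v x) = 0"
  shows "X *\<^sub>v x = 0\<^sub>v n"
proof -
  let ?Y = "psd_sqrt n X"
  have Yc: "?Y \<in> carrier_mat n n" using psd_sqrt(1)[OF X] by (rule psdD(2))
  have "?Y *\<^sub>v x = 0\<^sub>v n"
    using z psd_form_eq_sqrt[OF X x x] scalar_prod_self_eq_0[of "?Y *\<^sub>v x" n] Yc x by simp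
  hence "?Y *\<^sub>v (?Y *\<^sub>v x) = 0\<^sub>v n" using Yc by (auto intro!: eq_vecI)
  thus ?thesis using assoc_mult_mat_vec[OF Yc Yc x] psd_sqrt(2)[OF X] by simp
qed

lemma scalar_prod_Cauchy_Schwarz:
  fixes p q :: "real vec"
  assumes p: "p \<in> carrier_vec n" and q: "q \<in> carrier_vec n"
  shows "(p \<bullet> q)\<^sup>2 \<le> (p \<bullet> p) * (q \<bullet> q)"
proof (cases "p \<bullet> p = 0")
  case True
  thus ?thesis using scalar_prod_self_eq_0[OF p] q by simp
next
  case False
  define s where "s = p \<bullet> p"
  define t where "t = p \<bullet> q"
  have s: "s > 0" using False scalar_prod_self_nonneg[of p] by (simp add: s_def)
  have "0 \<le> (s \<cdot>\<^sub>v q - t \<cdot>\<^sub>v p) \<bullet> (s \<cdot>\<^sub>v q - t \<cdot>\<^sub>v p)" by (rule scalar_prod_self_nonneg)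
  also have "\<dots> = s * (s * (q \<bullet> q) - t\<^sup>2)"
    using p q comm_scalar_prod[OF q p]
    by (simp add: scalar_prod_minus_distrib[of _ n] minus_scalar_prod_distrib[of _ n]
        s_def[symmetric] t_def[symmetric] algebra_simps power2_eq_square)
  finally show ?thesis using s by (simp add: zero_le_mult_iff s_def t_def)
qed

lemma psd_Cauchy_Schwarz:
  assumes X: "psd n X" and x: "x \<in> carrier_vec n" and y: "y \<in> carrier_vec n"
  shows "(x \<bullet> (X *\<^sub>v y))\<^sup>2 \<le> (x \<bullet> (X *\<^sub>v x)) * (y \<bullet> (X *\<^sub>v y))"
  unfolding psd_form_eq_sqrt[OF X x y] psd_form_eq_sqrt[OF X x x] psd_form_eq_sqrt[OF X y y]
  using psdD(2)[OF psd_sqrt(1)[OF X]] x y by (intro scalar_prod_Cauchy_Schwarz[of _ n]) auto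

section \<open>Lower bounds and kernels\<close>

definition kernel_sum :: "real mat \<Rightarrow> real mat \<Rightarrow> real vec set" where
  "kernel_sum X Y = {u + v | u v. u \<in> mat_kernel X \<and> v \<in> mat_kernel Y}"

text \<open>In a decomposition \<open>x = (x - v) + v\<close>, membership of \<open>x - v\<close> in
  the kernel of \<open>X\<close> means that \<open>X\<close> takes the same value on
  \<open>v\<close> and \<open>x\<close>. This form names a single witness \<open>v\<close>, which
  the later proofs either use or construct.\<close>

lemma kernel_sum_eq_carrier_iff:
  assumes X: "X \<in> carrier_mat n n" and Y: "Y \<in> carrier_mat n n"
  shows "kernel_sum X Y = carrier_vec n \<longleftrightarrow>
    (\<forall>x\<in>carrier_vec n. \<exists>v\<in>carrier_vec n. X *\<^sub>v v = X *\<^sub>v x \<and> Y *\<^sub>v v = 0\<^sub>v n)"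
proof
  assume eq: "kernel_sum X Y = carrier_vec n"
  show "\<forall>x\<in>carrier_vec n. \<exists>v\<in>carrier_vec n. X *\<^sub>v v = X *\<^sub>v x \<and> Y *\<^sub>v v = 0\<^sub>v n"
  proof
    fix x :: "real vec" assume "x \<in> carrier_vec n"
    hence "x \<in> kernel_sum X Y" using eq by simp
    then obtain u v where uv: "u \<in> mat_kernel X" "v \<in> mat_kernel Y" and x: "x = u + v"
      unfolding kernel_sum_def by auto
    have u: "u \<in> carrier_vec n" "X *\<^sub>v u = 0\<^sub>v n" and v: "v \<in> carrier_vec n" "Y *\<^sub>v v = 0\<^sub>v n"
      using mat_kernelD[OF X uv(1)] mat_kernelD[OF Y uv(2)] by auto
    have "X *\<^sub>v v = X *\<^sub>v x"
      unfolding x using u v X by (simp add: mult_add_distrib_mat_vec[of _ n n])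
    thus "\<exists>v\<in>carrier_vec n. X *\<^sub>v v = X *\<^sub>v x \<and> Y *\<^sub>v v = 0\<^sub>v n" using v by auto
  qed
next
  assume *: "\<forall>x\<in>carrier_vec n. \<exists>v\<in>carrier_vec n. X *\<^sub>v v = X *\<^sub>v x \<and> Y *\<^sub>v v = 0\<^sub>v n"
  show "kernel_sum X Y = carrier_vec n"
  proof
    show "kernel_sum X Y \<subseteq> carrier_vec n"
      using mat_kernelD(1)[OF X] mat_kernelD(1)[OF Y] by (auto simp: kernel_sum_def)
    show "carrier_vec n \<subseteq> kernel_sum X Y"
    proof
      fix x :: "real vec" assume x: "x \<in> carrier_vec n"
      obtain v where v: "v \<in> carrier_vec n" "X *\<^sub>v v = X *\<^sub>v x" "Y *\<^sub>v v = 0\<^sub>v n" using * x by blast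
      have "X *\<^sub>v (x - v) = 0\<^sub>v n"
        using v x X by (simp add: mult_minus_distrib_mat_vec[of _ n n])
      hence "x - v \<in> mat_kernel X" "v \<in> mat_kernel Y"
        using v x mat_kernelI[OF X] mat_kernelI[OF Y] by simp_all
      moreover have "x = (x - v) + v" using x v by (intro eq_vecI) auto
      ultimately show "x \<in> kernel_sum X Y" unfolding kernel_sum_def by blast
    qed
  qed
qed

text \<open>The witness for \<open>x\<close> is \<open>Z *\<^sub>v (X *\<^sub>v x)\<close>: one
  identity says that \<open>X\<close> does not distinguish it from \<open>x\<close>, the other that
  \<open>Y\<close> annihilates it.\<close>

lemma kernel_sum_if_reflexive:
  assumes X: "X \<in> carrier_mat n n" and Y: "Y \<in> carrier_mat n n" and Z: "Z \<in> carrier_mat n n"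
    and XZX: "X * Z * X = X" and YZX: "Y * Z * X = 0\<^sub>m n n"
  shows "kernel_sum X Y = carrier_vec n"
  unfolding kernel_sum_eq_carrier_iff[OF X Y]
proof
  fix x :: "real vec" assume x: "x \<in> carrier_vec n"
  have "X *\<^sub>v (Z *\<^sub>v (X *\<^sub>v x)) = (X * Z * X) *\<^sub>v x" "Y *\<^sub>v (Z *\<^sub>v (X *\<^sub>v x)) = (Y * Z * X) *\<^sub>v x"
    using X Y Z x by (simp_all add: assoc_mult_mat_vec[of _ n n _ n] mult_carrier_mat[of _ n n _ n])
  hence "X *\<^sub>v (Z *\<^sub>v (X *\<^sub>v x)) = X *\<^sub>v x" "Y *\<^sub>v (Z *\<^sub>v (X *\<^sub>v x)) = 0\<^sub>v n"
    unfolding XZX YZX using x by (auto intro!: eq_vecI)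
  moreover have "Z *\<^sub>v (X *\<^sub>v x) \<in> carrier_vec n" using X Z x by simp
  ultimately show "\<exists>v\<in>carrier_vec n. X *\<^sub>v v = X *\<^sub>v x \<and> Y *\<^sub>v v = 0\<^sub>v n" by blast
qed

text \<open>Both identities are tested as bilinear forms. With \<open>X x = D v\<close>,
  \<open>X v = X x\<close> and \<open>X y = D w\<close>, the form of \<open>X * Z * X\<close> at
  \<open>x\<close>, \<open>y\<close> is that of \<open>D * Z * D = D\<close> at \<open>v\<close>,
  \<open>w\<close>, which is \<open>v \<bullet> X y = x \<bullet> X y\<close>. With
  \<open>Y x = - D u\<close> and \<open>X u = 0\<close>, the form of \<open>Y * Z * X\<close>
  becomes \<open>- (u \<bullet> X y) = 0\<close>.\<close>

lemma reflexive_if_kernel_sum: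
  assumes X: "sym_mat n X" and Y: "sym_mat n Y" and Z: "Z \<in> carrier_mat n n"
    and sum: "kernel_sum X Y = carrier_vec n"
    and DZD: "(X - Y) * Z * (X - Y) = X - Y"
  shows "X * Z * X = X" "Y * Z * X = 0\<^sub>m n n"
proof -
  have Xc: "X \<in> carrier_mat n n" and Yc: "Y \<in> carrier_mat n n" using X Y by (auto simp: sym_mat_def)
  define D where "D = X - Y"
  have Dc: "D \<in> carrier_mat n n" unfolding D_def by (rule minus_carrier_mat[OF Yc])
  have D: "sym_mat n D" using X Y unfolding D_def sym_mat_def by (auto simp: transpose_minus)
  have DZD: "D * Z * D = D" using DZD by (simp add: D_def)
  have Dv: "D *\<^sub>v v = X *\<^sub>v v - Y *\<^sub>v v" if "v \<in> carrier_vec n" for v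
    unfolding D_def using Xc Yc that by (simp add: minus_mult_distrib_mat_vec[of _ n n])
  have ex: "\<exists>v\<in>carrier_vec n. X *\<^sub>v v = X *\<^sub>v x \<and> Y *\<^sub>v v = 0\<^sub>v n" if "x \<in> carrier_vec n" for x
    using sum that unfolding kernel_sum_eq_carrier_iff[OF Xc Yc] by blast
  have decomp: "\<exists>v\<in>carrier_vec n. X *\<^sub>v x = D *\<^sub>v v \<and> Y *\<^sub>v v = 0\<^sub>v n \<and> X *\<^sub>v v = X *\<^sub>v x"
    if x: "x \<in> carrier_vec n" for x
  proof -
    obtain v where v: "v \<in> carrier_vec n" "X *\<^sub>v v = X *\<^sub>v x" "Y *\<^sub>v v = 0\<^sub>v n" using ex[OF x] by blast
    have "X *\<^sub>v x = D *\<^sub>v v" unfolding Dv[OF v(1)] v(2,3) using Xc x by simp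
    thus ?thesis using v by blast
  qed
  have decompY: "\<exists>u\<in>carrier_vec n. Y *\<^sub>v x = - (D *\<^sub>v u) \<and> X *\<^sub>v u = 0\<^sub>v n"
    if x: "x \<in> carrier_vec n" for x
  proof -
    obtain v where v: "v \<in> carrier_vec n" "X *\<^sub>v v = X *\<^sub>v x" "Y *\<^sub>v v = 0\<^sub>v n" using ex[OF x] by blast
    have "X *\<^sub>v (x - v) = 0\<^sub>v n" "Y *\<^sub>v (x - v) = Y *\<^sub>v x"
      using v x Xc Yc by (simp_all add: mult_minus_distrib_mat_vec[of _ n n])
    moreover from this have "Y *\<^sub>v x = - (D *\<^sub>v (x - v))"
      using v x Xc Yc by (subst Dv) (auto intro!: eq_vecI)
    ultimately show ?thesis using v x by (intro bexI[of _ "x - v"]) auto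
  qed
  have DZDv: "(D *\<^sub>v v) \<bullet> (Z *\<^sub>v (D *\<^sub>v w)) = v \<bullet> (D *\<^sub>v w)" if "v \<in> carrier_vec n" "w \<in> carrier_vec n" for v w
  proof -
    have "(D *\<^sub>v v) \<bullet> (Z *\<^sub>v (D *\<^sub>v w)) = v \<bullet> (D *\<^sub>v (Z *\<^sub>v (D *\<^sub>v w)))"
      using sym_scalar_prod[OF D that(1), of "Z *\<^sub>v (D *\<^sub>v w)"] that Dc Z by simp
    also have "D *\<^sub>v (Z *\<^sub>v (D *\<^sub>v w)) = (D * Z * D) *\<^sub>v w"
      using Dc Z that by (simp add: assoc_mult_mat_vec[of _ n n _ n] mult_carrier_mat[of _ n n _ n])
    finally show ?thesis using DZD by simp
  qed
  show "X * Z * X = X"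
  proof (rule mat_eq_by_vecs[of _ n n])
    fix y :: "real vec" assume y: "y \<in> carrier_vec n"
    show "(X * Z * X) *\<^sub>v y = X *\<^sub>v y"
    proof (rule vec_eq_by_scalar_prod[of _ n])
      fix x :: "real vec" assume x: "x \<in> carrier_vec n"
      obtain v where v: "v \<in> carrier_vec n" "X *\<^sub>v x = D *\<^sub>v v" "Y *\<^sub>v v = 0\<^sub>v n" "X *\<^sub>v v = X *\<^sub>v x"
        using decomp[OF x] by blast
      obtain w where w: "w \<in> carrier_vec n" "X *\<^sub>v y = D *\<^sub>v w" using decomp[OF y] by blast
      have "x \<bullet> ((X * Z * X) *\<^sub>v y) = x \<bullet> (X *\<^sub>v (Z *\<^sub>v (X *\<^sub>v y)))"
        using Xc Z y by (simp add: assoc_mult_mat_vec[of _ n n _ n] mult_carrier_mat[of _ n n _ n])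
      also have "\<dots> = (X *\<^sub>v x) \<bullet> (Z *\<^sub>v (X *\<^sub>v y))"
        by (rule sym_scalar_prod[OF X x]) (use Xc Z y in simp)
      also have "\<dots> = v \<bullet> (X *\<^sub>v y)" unfolding v(2) w(2) by (rule DZDv[OF v(1) w(1)])
      also have "\<dots> = (X *\<^sub>v x) \<bullet> y" using sym_scalar_prod[OF X v(1) y] v(4) by simp
      also have "\<dots> = x \<bullet> (X *\<^sub>v y)" using sym_scalar_prod[OF X x y] by simp
      finally show "x \<bullet> ((X * Z * X) *\<^sub>v y) = x \<bullet> (X *\<^sub>v y)" .
    qed (use Xc Z y in \<open>auto intro!: mult_mat_vec_carrier[of _ n n] mult_carrier_mat[of _ n n]\<close>)
  qed (use Xc Z in \<open>auto intro!: mult_carrier_mat[of _ n n]\<close>)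
  show "Y * Z * X = 0\<^sub>m n n"
  proof (rule mat_eq_by_vecs[of _ n n])
    fix y :: "real vec" assume y: "y \<in> carrier_vec n"
    have "(Y * Z * X) *\<^sub>v y = 0\<^sub>v n"
    proof (rule vec_eq_by_scalar_prod[of _ n])
      fix x :: "real vec" assume x: "x \<in> carrier_vec n"
      obtain u where u: "u \<in> carrier_vec n" "Y *\<^sub>v x = - (D *\<^sub>v u)" "X *\<^sub>v u = 0\<^sub>v n"
        using decompY[OF x] by blast
      obtain w where w: "w \<in> carrier_vec n" "X *\<^sub>v y = D *\<^sub>v w" using decomp[OF y] by blast
      have "x \<bullet> ((Y * Z * X) *\<^sub>v y) = x \<bullet> (Y *\<^sub>v (Z *\<^sub>v (X *\<^sub>v y)))"
        using Xc Yc Z y by (simp add: assoc_mult_mat_vec[of _ n n _ n] mult_carrier_mat[of _ n n _ n])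
      also have "\<dots> = (Y *\<^sub>v x) \<bullet> (Z *\<^sub>v (X *\<^sub>v y))"
        by (rule sym_scalar_prod[OF Y x]) (use Xc Z y in simp)
      also have "\<dots> = - (u \<bullet> (X *\<^sub>v y))"
        unfolding u(2) w(2) using DZDv[OF u(1) w(1)] Dc Z u(1) w(1) by simp
      also have "\<dots> = 0" using sym_scalar_prod[OF X u(1) y] u(3) y by simp
      finally show "x \<bullet> ((Y * Z * X) *\<^sub>v y) = x \<bullet> 0\<^sub>v n" using x by simp
    qed (use Xc Yc Z y in \<open>auto intro!: mult_mat_vec_carrier[of _ n n] mult_carrier_mat[of _ n n]\<close>)
    thus "(Y * Z * X) *\<^sub>v y = 0\<^sub>m n n *\<^sub>v y" using y by (auto intro!: eq_vecI)
  qed (use Xc Yc Z in \<open>auto intro!: mult_carrier_mat[of _ n n]\<close>)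
qed

text \<open>The substitution \<open>C' = C + E\<close> moves the question from lower bounds above
  \<open>C\<close> to psd matrices below both gaps.\<close>

lemma maximal_lower_bound_iff:
  assumes A: "sym_mat n A" and B: "sym_mat n B" and C: "sym_mat n C"
    and CA: "loewner_le n C A" and CB: "loewner_le n C B"
  shows "maximal_lower_bound n A B C \<longleftrightarrow>
    (\<forall>E. psd n E \<and> loewner_le n E (A - C) \<and> loewner_le n E (B - C) \<longrightarrow> E = 0\<^sub>m n n)"
proof -
  have c: "A \<in> carrier_mat n n" "B \<in> carrier_mat n n" "C \<in> carrier_mat n n"
    using A B C by (auto simp: sym_mat_def)
  have form: "x \<bullet> ((G - H) *\<^sub>v x) = x \<bullet> (G *\<^sub>v x) - x \<bullet> (H *\<^sub>v x)"
    if "x \<in> carrier_vec n" "G \<in> carrier_mat n n" "H \<in> carrier_mat n n" for x :: "real vec" and G H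
    using that by (simp add: minus_mult_distrib_mat_vec[of _ n n] scalar_prod_minus_distrib[of _ n])
  show ?thesis
  proof
    assume max: "maximal_lower_bound n A B C"
    show "\<forall>E. psd n E \<and> loewner_le n E (A - C) \<and> loewner_le n E (B - C) \<longrightarrow> E = 0\<^sub>m n n"
    proof (intro allI impI, elim conjE)
      fix E assume E: "psd n E" and EA: "loewner_le n E (A - C)" and EB: "loewner_le n E (B - C)"
      note Ec = psdD(2)[OF E]
      have CE: "(C + E) *\<^sub>v x = C *\<^sub>v x + E *\<^sub>v x" if "x \<in> carrier_vec n" for x
        using that c Ec by (simp add: add_mult_distrib_mat_vec[of _ n n])
      have CE: "x \<bullet> ((C + E) *\<^sub>v x) = x \<bullet> (C *\<^sub>v x) + x \<bullet> (E *\<^sub>v x)" if "x \<in> carrier_vec n" for x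
        using that c Ec CE[OF that] by (simp add: scalar_prod_add_distrib[of _ n])
      have "sym_mat n (C + E)" using C psdD(1)[OF E] by (auto simp: sym_mat_def transpose_add)
      moreover have "loewner_le n C (C + E)"
        using CE psdD(4)[OF E] by (simp add: loewner_le_def)
      moreover have "loewner_le n (C + E) A" "loewner_le n (C + E) B"
        using CE EA EB form[OF _ c(1,3)] form[OF _ c(2,3)] unfolding loewner_le_def
        by (metis add.commute le_diff_eq)+
      ultimately have CEC: "C + E = C" using max unfolding maximal_lower_bound_def by blast
      show "E = 0\<^sub>m n n"
      proof (rule eq_matI)
        fix i j assume ij: "i < dim_row (0\<^sub>m n n :: real mat)" "j < dim_col (0\<^sub>m n n :: real mat)"
        have "(C + E) $$ (i,j) = C $$ (i,j)" unfolding CEC ..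
        thus "E $$ (i,j) = 0\<^sub>m n n $$ (i,j)" using ij c Ec by simp
      qed (use Ec in auto)
    qed
  next
    assume *: "\<forall>E. psd n E \<and> loewner_le n E (A - C) \<and> loewner_le n E (B - C) \<longrightarrow> E = 0\<^sub>m n n"
    have "C' = C" if C': "sym_mat n C'" "loewner_le n C C'" "loewner_le n C' A" "loewner_le n C' B" for C'
    proof -
      have c': "C' \<in> carrier_mat n n" using C' by (simp add: sym_mat_def)
      have "sym_mat n (C' - C)" using C C' by (auto simp: sym_mat_def transpose_minus)
      hence "psd n (C' - C)" using C'(2) form c c' by (simp add: psd_def loewner_le_def)
      moreover have "loewner_le n (C' - C) (A - C)" "loewner_le n (C' - C) (B - C)"
        using C'(3,4) form c c' by (auto simp: loewner_le_def)
      ultimately have z: "C' - C = 0\<^sub>m n n" using * by blast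
      show "C' = C"
      proof (rule eq_matI)
        fix i j assume ij: "i < dim_row C" "j < dim_col C"
        have "(C' - C) $$ (i,j) = 0\<^sub>m n n $$ (i,j)" unfolding z ..
        thus "C' $$ (i,j) = C $$ (i,j)" using ij c c' by simp
      qed (use c c' in auto)
    qed
    thus "maximal_lower_bound n A B C" unfolding maximal_lower_bound_def using C CA CB by blast
  qed
qed

lemma below_both_eq_0_if_kernel_sum:
  assumes X: "X \<in> carrier_mat n n" and Y: "Y \<in> carrier_mat n n"
    and sum: "kernel_sum X Y = carrier_vec n"
    and E: "psd n E" and EX: "loewner_le n E X" and EY: "loewner_le n E Y"
  shows "E = 0\<^sub>m n n"
proof (rule mat_eq_by_vecs[of _ n n])
  note Ec = psdD(2)[OF E]
  \<comment> \<open>The form of \<open>E\<close> is squeezed between 0 and the form of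
    \<open>W\<close>, which vanishes at \<open>u\<close>; a psd form that vanishes at a vector has
    it in its kernel.\<close>
  have ker: "E *\<^sub>v u = 0\<^sub>v n" if "loewner_le n E W" "u \<in> carrier_vec n" "W *\<^sub>v u = 0\<^sub>v n" for W u
  proof (rule psd_form_eq_0[OF E that(2)])
    have "u \<bullet> (E *\<^sub>v u) \<le> u \<bullet> (W *\<^sub>v u)" using that(1,2) unfolding loewner_le_def by blast
    also have "\<dots> = 0" using that(2,3) by simp
    finally show "u \<bullet> (E *\<^sub>v u) = 0" using psdD(4)[OF E that(2)] by simp
  qed
  fix x :: "real vec" assume x: "x \<in> carrier_vec n"
  obtain v where v: "v \<in> carrier_vec n" "X *\<^sub>v v = X *\<^sub>v x" "Y *\<^sub>v v = 0\<^sub>v n"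
    using sum x unfolding kernel_sum_eq_carrier_iff[OF X Y] by blast
  have "X *\<^sub>v (x - v) = 0\<^sub>v n" using v x X by (simp add: mult_minus_distrib_mat_vec[of _ n n])
  hence "E *\<^sub>v (x - v) = 0\<^sub>v n" using ker[OF EX] x v by simp
  moreover have "E *\<^sub>v v = 0\<^sub>v n" using ker[OF EY] v by simp
  moreover have "E *\<^sub>v x = E *\<^sub>v (x - v) + E *\<^sub>v v"
  proof -
    have "x = (x - v) + v" using x v by (intro eq_vecI) auto
    thus ?thesis using x v Ec mult_add_distrib_mat_vec[of E n n "x - v" v] by auto
  qed
  ultimately show "E *\<^sub>v x = 0\<^sub>m n n *\<^sub>v x" using x by (auto intro!: eq_vecI)
qed (use psdD(2)[OF E] in auto)

text \<open>The rank one matrix of a vector in the intersection of both ranges is a common lower bound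
  after rescaling, by the Cauchy-Schwarz inequality for the two forms.\<close>

lemma common_range_trivial:
  assumes X: "psd n X" and Y: "psd n Y"
    and none: "\<And>E. psd n E \<Longrightarrow> loewner_le n E X \<Longrightarrow> loewner_le n E Y \<Longrightarrow> E = 0\<^sub>m n n"
    and a: "a \<in> carrier_vec n" and b: "b \<in> carrier_vec n" and ab: "X *\<^sub>v a = Y *\<^sub>v b"
  shows "X *\<^sub>v a = 0\<^sub>v n"
proof -
  define v where "v = X *\<^sub>v a"
  have v: "v \<in> carrier_vec n" using psdD(2)[OF X] a by (simp add: v_def)
  \<comment> \<open>One scale for both comparisons: it dominates the two form values that
    Cauchy-Schwarz produces, and the summand 1 keeps it positive.\<close>
  define t where "t = 1 + a \<bullet> (X *\<^sub>v a) + b \<bullet> (Y *\<^sub>v b)"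
  have t: "t > 0" "a \<bullet> (X *\<^sub>v a) \<le> t" "b \<bullet> (Y *\<^sub>v b) \<le> t"
    using psdD(4)[OF X a] psdD(4)[OF Y b] by (auto simp: t_def)
  define E where "E = Matrix.mat n n (\<lambda>(i,j). v $ i * v $ j / t)"
  have Ec: "E \<in> carrier_mat n n" by (simp add: E_def)
  have Ex: "E *\<^sub>v x = ((v \<bullet> x) / t) \<cdot>\<^sub>v v" if x: "x \<in> carrier_vec n" for x
  proof (rule eq_vecI)
    fix i assume "i < dim_vec (((v \<bullet> x) / t) \<cdot>\<^sub>v v)"
    hence i: "i < n" using v by simp
    have "(E *\<^sub>v x) $ i = (\<Sum>k\<in>{0..<n}. (v $ i * v $ k / t) * x $ k)"
      using i x by (simp add: E_def scalar_prod_def)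
    also have "\<dots> = (\<Sum>k\<in>{0..<n}. v $ k * x $ k) / t * v $ i"
      by (simp add: sum_divide_distrib sum_distrib_left sum_distrib_right mult_ac)
    finally show "(E *\<^sub>v x) $ i = (((v \<bullet> x) / t) \<cdot>\<^sub>v v) $ i" using i x v by (simp add: scalar_prod_def)
  qed (use v Ec in simp)
  have form: "x \<bullet> (E *\<^sub>v x) = (v \<bullet> x)\<^sup>2 / t" if "x \<in> carrier_vec n" for x
    unfolding Ex[OF that] using that v comm_scalar_prod[OF that v] by (simp add: power2_eq_square)
  have "psd n E" unfolding psd_def
  proof (intro conjI ballI)
    show "sym_mat n E" unfolding sym_mat_def E_def by (auto intro!: eq_matI simp: mult.commute)
  qed (use form t in simp)
  moreover have le: "loewner_le n E W"
    if W: "psd n W" and c: "c \<in> carrier_vec n" "v = W *\<^sub>v c" "c \<bullet> (W *\<^sub>v c) \<le> t" for W c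
    unfolding loewner_le_def
  proof
    fix x :: "real vec" assume x: "x \<in> carrier_vec n"
    have "(v \<bullet> x)\<^sup>2 = (c \<bullet> (W *\<^sub>v x))\<^sup>2" using sym_scalar_prod[OF psdD(1)[OF W] c(1) x] c(2) by simp
    also have "\<dots> \<le> (c \<bullet> (W *\<^sub>v c)) * (x \<bullet> (W *\<^sub>v x))" by (rule psd_Cauchy_Schwarz[OF W c(1) x])
    also have "\<dots> \<le> t * (x \<bullet> (W *\<^sub>v x))" by (rule mult_right_mono[OF c(3) psdD(4)[OF W x]])
    finally show "x \<bullet> (E *\<^sub>v x) \<le> x \<bullet> (W *\<^sub>v x)"
      unfolding form[OF x] using t(1) by (simp add: divide_le_eq mult.commute)
  qed
  have "loewner_le n E X" by (rule le[OF X a v_def t(2)])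
  moreover have "loewner_le n E Y" using le[OF Y b _ t(3)] ab v_def by simp
  ultimately have "E = 0\<^sub>m n n" by (rule none)
  hence "v \<bullet> (E *\<^sub>v v) = 0" using v by (auto simp: scalar_prod_def)
  hence "v \<bullet> v = 0" unfolding form[OF v] using t by simp
  thus ?thesis using scalar_prod_self_eq_0[OF v] by (simp add: v_def)
qed

text \<open>With a generalized inverse \<open>Z\<close> of \<open>X + Y\<close>, the parallel sum \<open>X Z Y = Y - Y Z Y\<close> maps into
  the intersection of both ranges.\<close>

lemma kernel_sum_if_none_below_both:
  assumes X: "psd n X" and Y: "psd n Y"
    and none: "\<And>E. psd n E \<Longrightarrow> loewner_le n E X \<Longrightarrow> loewner_le n E Y \<Longrightarrow> E = 0\<^sub>m n n"
  shows "kernel_sum X Y = carrier_vec n"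
proof -
  note Xc = psdD(2)[OF X] and Yc = psdD(2)[OF Y]
  note [simp] = assoc_mult_mat[of _ n n _ n _ n] mult_carrier_mat[of _ n n _ n]
    assoc_mult_mat_vec[of _ n n _ n]
  define S where "S = X + Y"
  have Sc: "S \<in> carrier_mat n n" using Xc Yc by (simp add: S_def)
  have "sym_mat n S" using psdD[OF X] psdD[OF Y] by (auto simp: S_def sym_mat_def transpose_add)
  then obtain Z where Z: "sym_mat n Z" and SZS: "S * Z * S = S"
    using sym_mat_generalized_inverse by blast
  have Zc: "Z \<in> carrier_mat n n" and ZT: "Z\<^sup>T = Z" using Z by (auto simp: sym_mat_def)
  have Sv: "S *\<^sub>v x = X *\<^sub>v x + Y *\<^sub>v x" if "x \<in> carrier_vec n" for x
    unfolding S_def using Xc Yc that by (simp add: add_mult_distrib_mat_vec[of _ n n])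
  \<comment> \<open>Two nonnegative form values with sum 0 both vanish, so the kernel of
    \<open>X + Y\<close> lies in both kernels.\<close>
  have kerS: "W *\<^sub>v w = 0\<^sub>v n"
    if w: "w \<in> carrier_vec n" "S *\<^sub>v w = 0\<^sub>v n" and W: "W = X \<or> W = Y" for w W
  proof -
    have "w \<bullet> (X *\<^sub>v w) + w \<bullet> (Y *\<^sub>v w) = w \<bullet> (S *\<^sub>v w)"
      unfolding Sv[OF w(1)] using w Xc Yc by (simp add: scalar_prod_add_distrib[of _ n])
    hence "w \<bullet> (X *\<^sub>v w) = 0" "w \<bullet> (Y *\<^sub>v w) = 0"
      using w psdD(4)[OF X w(1)] psdD(4)[OF Y w(1)] by auto
    thus ?thesis using psd_form_eq_0[OF X w(1)] psd_form_eq_0[OF Y w(1)] W by blast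
  qed
  \<comment> \<open>By \<open>S * Z * S = S\<close> the vector \<open>x - Z S x\<close> is in the
    kernel of \<open>S\<close>, hence \<open>W\<close> annihilates it.\<close>
  have WZS: "W * Z * S = W" if W: "W = X \<or> W = Y" for W
  proof (rule mat_eq_by_vecs[of _ n n])
    have Wc: "W \<in> carrier_mat n n" using W Xc Yc by auto
    fix x :: "real vec" assume x: "x \<in> carrier_vec n"
    let ?w = "x - (Z * S) *\<^sub>v x"
    have w: "?w \<in> carrier_vec n" using x Zc Sc by simp
    have "S *\<^sub>v ?w = S *\<^sub>v x - (S * Z * S) *\<^sub>v x"
      using x Zc Sc by (simp add: mult_minus_distrib_mat_vec[of _ n n])
    also have "\<dots> = 0\<^sub>v n" unfolding SZS using x Sc by simp
    finally have "W *\<^sub>v ?w = 0\<^sub>v n" using kerS[OF w _ W] by blast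
    hence z: "W *\<^sub>v x - (W * Z * S) *\<^sub>v x = 0\<^sub>v n"
      using x Zc Sc Wc by (simp add: mult_minus_distrib_mat_vec[of _ n n])
    show "(W * Z * S) *\<^sub>v x = W *\<^sub>v x"
    proof (rule eq_vecI)
      fix i assume i: "i < dim_vec (W *\<^sub>v x)"
      have "(W *\<^sub>v x - (W * Z * S) *\<^sub>v x) $ i = 0" unfolding z using i Wc by simp
      thus "((W * Z * S) *\<^sub>v x) $ i = (W *\<^sub>v x) $ i" using i Wc Sc by simp
    qed (use Wc in auto)
  qed (use W Xc Yc Zc Sc in auto)
  \<comment> \<open>The transposed identity; this is why the generalized inverse was chosen
    symmetric.\<close>
  have SZW: "S * Z * W = W" if W: "W = X \<or> W = Y" for W
  proof -
    have Wc: "W \<in> carrier_mat n n" and WT: "W\<^sup>T = W"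
      using W Xc Yc psdD(3)[OF X] psdD(3)[OF Y] by auto
    have ST: "S\<^sup>T = S" using \<open>sym_mat n S\<close> by (simp add: sym_mat_def)
    have "(W * Z * S)\<^sup>T = S * Z * W"
      using Wc Zc Sc WT ZT ST by (simp add: transpose_mult[of _ n n _ n])
    thus ?thesis using WZS[OF W] WT by simp
  qed
  have parallel: "V *\<^sub>v (Z *\<^sub>v (W *\<^sub>v x)) = 0\<^sub>v n"
    if x: "x \<in> carrier_vec n" and VW: "(V = X \<and> W = Y) \<or> (V = Y \<and> W = X)" for V W x
  proof -
    have V: "psd n V" and W: "psd n W" and Vc: "V \<in> carrier_mat n n" and Wc: "W \<in> carrier_mat n n"
      using VW X Y Xc Yc by auto
    have SVW: "S *\<^sub>v y = V *\<^sub>v y + W *\<^sub>v y" if "y \<in> carrier_vec n" for y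
      using VW Sv[OF that] comm_add_vec[of "X *\<^sub>v y" n "Y *\<^sub>v y"] Xc Yc that by auto
    have none': "E = 0\<^sub>m n n" if "psd n E" "loewner_le n E V" "loewner_le n E W" for E
      using VW none[OF that(1)] that(2,3) by blast
    define a where "a = Z *\<^sub>v (W *\<^sub>v x)"
    have a: "a \<in> carrier_vec n" using x Zc Wc by (simp add: a_def)
    have "S * Z * W = W" using SZW VW by blast
    hence "W *\<^sub>v x = (S * Z * W) *\<^sub>v x" by (simp only:)
    also have "\<dots> = S *\<^sub>v a" using x Zc Wc Sc by (simp add: a_def)
    also have "\<dots> = V *\<^sub>v a + W *\<^sub>v a" by (rule SVW[OF a])
    finally have Wx: "W *\<^sub>v x = V *\<^sub>v a + W *\<^sub>v a" .
    \<comment> \<open>The two ways of writing this vector, \<open>V a\<close> and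
      \<open>W (x - a)\<close>, put it into both ranges, where only 0 is left.\<close>
    have "V *\<^sub>v a = W *\<^sub>v x - W *\<^sub>v a" unfolding Wx using Vc Wc a by (intro eq_vecI) (auto simp del: index_mult_mat_vec)
    also have "\<dots> = W *\<^sub>v (x - a)" using x a Wc by (simp add: mult_minus_distrib_mat_vec[of _ n n])
    finally have "V *\<^sub>v a = W *\<^sub>v (x - a)" .
    thus ?thesis using common_range_trivial[OF V W none' a] x a by (simp add: a_def)
  qed
  show ?thesis unfolding kernel_sum_eq_carrier_iff[OF Xc Yc]
  proof
    fix x :: "real vec" assume x: "x \<in> carrier_vec n"
    let ?v = "Z *\<^sub>v (X *\<^sub>v x)"
    have v: "?v \<in> carrier_vec n" using x Zc Xc by simp
    have "S * Z * X = X" using SZW by blast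
    hence "X *\<^sub>v x = (S * Z * X) *\<^sub>v x" by (simp only:)
    also have "\<dots> = S *\<^sub>v ?v" using x Zc Xc Sc by simp
    also have "\<dots> = X *\<^sub>v ?v + Y *\<^sub>v ?v" by (rule Sv[OF v])
    also have "Y *\<^sub>v ?v = 0\<^sub>v n" by (rule parallel[OF x]) simp
    finally have "X *\<^sub>v ?v = X *\<^sub>v x" using v Xc by simp
    moreover have "Y *\<^sub>v ?v = 0\<^sub>v n" by (rule parallel[OF x]) simp
    ultimately show "\<exists>v\<in>carrier_vec n. X *\<^sub>v v = X *\<^sub>v x \<and> Y *\<^sub>v v = 0\<^sub>v n" using v by blast
  qed
qed

section \<open>Block matrices\<close>

text \<open>\<open>J_mat\<close>, \<open>Ip0_mat\<close> and \<open>S_mat\<close> all vanish on the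
  last \<open>r\<close> coordinates, and so will the normalized \<open>X\<close> and
  \<open>Y\<close>. Padding with zeros therefore reduces their algebra to 2 by 2 blocks.\<close>

definition blk :: "nat \<Rightarrow> real mat \<Rightarrow> real mat \<Rightarrow> real mat \<Rightarrow> real mat \<Rightarrow> real mat" where
  "blk r a b c d = dsum (four_block_mat a b c d) (0\<^sub>m r r)"

context
  fixes p q r :: nat
begin

definition block_carrier :: "real mat \<Rightarrow> real mat \<Rightarrow> real mat \<Rightarrow> real mat \<Rightarrow> bool" where
  "block_carrier a b c d \<longleftrightarrow> a \<in> carrier_mat p p \<and> b \<in> carrier_mat p q
     \<and> c \<in> carrier_mat q p \<and> d \<in> carrier_mat q q"

lemma blk_carrier:
  "block_carrier a b c d \<Longrightarrow> blk r a b c d \<in> carrier_mat (p + q + r) (p + q + r)"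
  unfolding blk_def dsum_def block_carrier_def by (auto simp: add.assoc)

lemma blk_eq_four_block_mat:
  "block_carrier a b c d \<Longrightarrow> blk r a b c d
    = four_block_mat (four_block_mat a b c d) (0\<^sub>m (p + q) r) (0\<^sub>m r (p + q)) (0\<^sub>m r r)"
  unfolding blk_def dsum_def block_carrier_def by auto

lemma four_block_carrier:
  "block_carrier a b c d \<Longrightarrow> four_block_mat a b c d \<in> carrier_mat (p + q) (p + q)"
  unfolding block_carrier_def by auto

lemma blk_mult:
  assumes 1: "block_carrier a b c d" and 2: "block_carrier a' b' c' d'"
  shows "blk r a b c d * blk r a' b' c' d'
    = blk r (a * a' + b * c') (a * b' + b * d') (c * a' + d * c') (c * b' + d * d')"
proof -
  have 3: "block_carrier (a * a' + b * c') (a * b' + b * d') (c * a' + d * c') (c * b' + d * d')"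
    using 1 2 by (auto simp: block_carrier_def)
  have m: "four_block_mat a b c d * four_block_mat a' b' c' d'
     = four_block_mat (a * a' + b * c') (a * b' + b * d') (c * a' + d * c') (c * b' + d * d')"
    using 1 2 unfolding block_carrier_def by (intro mult_four_block_mat[of _ p p _ q _ q _ _ p _ q]) auto
  show ?thesis
    unfolding blk_eq_four_block_mat[OF 1] blk_eq_four_block_mat[OF 2] blk_eq_four_block_mat[OF 3]
      m[symmetric]
    using four_block_carrier[OF 1] four_block_carrier[OF 2]
    by (subst mult_four_block_mat[of _ "p + q" "p + q" _ r _ r _ _ "p + q" _ r])
      (auto simp: left_mult_zero_mat[of _ "p + q" "p + q"] right_mult_zero_mat[of _ "p + q" "p + q"])
qed

lemma blk_transpose:
  assumes "block_carrier a b c d"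
  shows "(blk r a b c d)\<^sup>T = blk r a\<^sup>T c\<^sup>T b\<^sup>T d\<^sup>T"
proof -
  have 2: "block_carrier a\<^sup>T c\<^sup>T b\<^sup>T d\<^sup>T" using assms by (auto simp: block_carrier_def)
  have "(four_block_mat a b c d)\<^sup>T = four_block_mat a\<^sup>T c\<^sup>T b\<^sup>T d\<^sup>T"
    using assms unfolding block_carrier_def by (intro transpose_four_block_mat) auto
  thus ?thesis unfolding blk_eq_four_block_mat[OF assms] blk_eq_four_block_mat[OF 2]
    using four_block_carrier[OF assms]
    by (subst transpose_four_block_mat[of _ "p + q" "p + q" _ r _ r]) auto
qed

lemma blk_minus:
  assumes 1: "block_carrier a b c d" and 2: "block_carrier a' b' c' d'"
  shows "blk r a b c d - blk r a' b' c' d' = blk r (a - a') (b - b') (c - c') (d - d')"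
  using 1 2 unfolding blk_def dsum_def block_carrier_def by (intro eq_matI) auto

lemma blk_index:
  assumes "block_carrier a b c d" "i < p + q + r" "j < p + q + r"
  shows "blk r a b c d $$ (i,j) =
    (if i < p then if j < p then a $$ (i,j) else if j < p + q then b $$ (i,j - p) else 0
     else if i < p + q then if j < p then c $$ (i - p,j) else if j < p + q then d $$ (i - p,j - p) else 0
     else 0)"
  using assms unfolding blk_def dsum_def block_carrier_def by auto

lemma blk_inject:
  assumes 1: "block_carrier a b c d" and 2: "block_carrier a' b' c' d'"
    and eq: "blk r a b c d = blk r a' b' c' d'"
  shows "a = a'" "b = b'" "c = c'" "d = d'"
proof -
  have ix: "blk r a b c d $$ (i,j) = blk r a' b' c' d' $$ (i,j)" for i j using eq by simp
  show "a = a'"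
  proof (rule eq_matI)
    fix i j assume "i < dim_row a'" "j < dim_col a'"
    hence "i < p" "j < p" using 2 by (auto simp: block_carrier_def)
    thus "a $$ (i,j) = a' $$ (i,j)" using ix[of i j] by (simp add: blk_index[OF 1] blk_index[OF 2])
  qed (use 1 2 in \<open>auto simp: block_carrier_def\<close>)
  show "b = b'"
  proof (rule eq_matI)
    fix i j assume "i < dim_row b'" "j < dim_col b'"
    hence "i < p" "j < q" using 2 by (auto simp: block_carrier_def)
    thus "b $$ (i,j) = b' $$ (i,j)" using ix[of i "p + j"] by (simp add: blk_index[OF 1] blk_index[OF 2])
  qed (use 1 2 in \<open>auto simp: block_carrier_def\<close>)
  show "c = c'"
  proof (rule eq_matI)
    fix i j assume "i < dim_row c'" "j < dim_col c'"
    hence "i < q" "j < p" using 2 by (auto simp: block_carrier_def)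
    thus "c $$ (i,j) = c' $$ (i,j)" using ix[of "p + i" j] by (simp add: blk_index[OF 1] blk_index[OF 2])
  qed (use 1 2 in \<open>auto simp: block_carrier_def\<close>)
  show "d = d'"
  proof (rule eq_matI)
    fix i j assume "i < dim_row d'" "j < dim_col d'"
    hence "i < q" "j < q" using 2 by (auto simp: block_carrier_def)
    thus "d $$ (i,j) = d' $$ (i,j)" using ix[of "p + i" "p + j"]
      by (simp add: blk_index[OF 1] blk_index[OF 2])
  qed (use 1 2 in \<open>auto simp: block_carrier_def\<close>)
qed

text \<open>The form is tested on vectors supported in a single block.\<close>

lemma psd_blk_diagonal:
  assumes 1: "block_carrier a b b\<^sup>T d" and psd: "psd (p + q + r) (blk r a b b\<^sup>T d)"
  shows "psd p a" "psd q d"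
proof -
  have c: "a \<in> carrier_mat p p" "b \<in> carrier_mat p q" "b\<^sup>T \<in> carrier_mat q p" "d \<in> carrier_mat q q"
    using 1 by (auto simp: block_carrier_def)
  have form: "((x @\<^sub>v y) @\<^sub>v 0\<^sub>v r) \<bullet> (blk r a b b\<^sup>T d *\<^sub>v ((x @\<^sub>v y) @\<^sub>v 0\<^sub>v r))
     = x \<bullet> (a *\<^sub>v x + b *\<^sub>v y) + y \<bullet> (b\<^sup>T *\<^sub>v x + d *\<^sub>v y)"
    if xy: "x \<in> carrier_vec p" "y \<in> carrier_vec q" for x y
  proof -
    have "blk r a b b\<^sup>T d *\<^sub>v ((x @\<^sub>v y) @\<^sub>v 0\<^sub>v r)
        = (four_block_mat a b b\<^sup>T d *\<^sub>v (x @\<^sub>v y) + 0\<^sub>m (p + q) r *\<^sub>v 0\<^sub>v r) @\<^sub>v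
          (0\<^sub>m r (p + q) *\<^sub>v (x @\<^sub>v y) + 0\<^sub>m r r *\<^sub>v 0\<^sub>v r)"
      unfolding blk_eq_four_block_mat[OF 1] using four_block_carrier[OF 1] xy
      by (intro four_block_mat_mult_vec) auto
    also have "0\<^sub>m (p + q) r *\<^sub>v 0\<^sub>v r = 0\<^sub>v (p + q)" by (auto intro!: eq_vecI)
    also have "0\<^sub>m r (p + q) *\<^sub>v (x @\<^sub>v y) + 0\<^sub>m r r *\<^sub>v 0\<^sub>v r = 0\<^sub>v r"
      using xy by (auto intro!: eq_vecI)
    also have "four_block_mat a b b\<^sup>T d *\<^sub>v (x @\<^sub>v y) = (a *\<^sub>v x + b *\<^sub>v y) @\<^sub>v (b\<^sup>T *\<^sub>v x + d *\<^sub>v y)"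
      using c xy by (intro four_block_mat_mult_vec) auto
    finally have "blk r a b b\<^sup>T d *\<^sub>v ((x @\<^sub>v y) @\<^sub>v 0\<^sub>v r)
        = ((a *\<^sub>v x + b *\<^sub>v y) @\<^sub>v (b\<^sup>T *\<^sub>v x + d *\<^sub>v y)) @\<^sub>v 0\<^sub>v r"
      using c xy by simp
    thus ?thesis using c xy
      by (simp add: scalar_prod_append[of _ "p + q" _ r] scalar_prod_append[of _ p _ q])
  qed
  have nonneg: "0 \<le> x \<bullet> (a *\<^sub>v x + b *\<^sub>v y) + y \<bullet> (b\<^sup>T *\<^sub>v x + d *\<^sub>v y)"
    if "x \<in> carrier_vec p" "y \<in> carrier_vec q" for x y
    using psdD(4)[OF psd, of "(x @\<^sub>v y) @\<^sub>v 0\<^sub>v r"] form[OF that] that by auto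
  have "blk r a\<^sup>T b b\<^sup>T d\<^sup>T = blk r a b b\<^sup>T d"
    using blk_transpose[OF 1] psdD(3)[OF psd] by simp
  moreover have "block_carrier a\<^sup>T b b\<^sup>T d\<^sup>T" using c by (auto simp: block_carrier_def)
  ultimately have sym: "a\<^sup>T = a" "d\<^sup>T = d" using blk_inject[OF _ 1] by blast+
  have z: "b *\<^sub>v 0\<^sub>v q = 0\<^sub>v p" "b\<^sup>T *\<^sub>v 0\<^sub>v p = 0\<^sub>v q" using c by (auto intro!: eq_vecI)
  show "psd p a" unfolding psd_def sym_mat_def
  proof (intro conjI ballI)
    fix x :: "real vec" assume x: "x \<in> carrier_vec p"
    have "0\<^sub>v q \<bullet> (b\<^sup>T *\<^sub>v x + d *\<^sub>v 0\<^sub>v q) = 0" using c x by simp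
    thus "0 \<le> x \<bullet> (a *\<^sub>v x)" using nonneg[OF x, of "0\<^sub>v q"] z c x by simp
  qed (use c sym in auto)
  show "psd q d" unfolding psd_def sym_mat_def
  proof (intro conjI ballI)
    fix y :: "real vec" assume y: "y \<in> carrier_vec q"
    have "0\<^sub>v p \<bullet> (a *\<^sub>v 0\<^sub>v p + b *\<^sub>v y) = 0" using c y by simp
    thus "0 \<le> y \<bullet> (d *\<^sub>v y)" using nonneg[OF _ y, of "0\<^sub>v p"] z c y by simp
  qed (use c sym in auto)
qed

definition signature :: "nat \<Rightarrow> real" where
  "signature i = (if i < p then 1 else if i < p + q then -1 else 0)"

lemma J_mat_eq_mat_diag: "J_mat p q r = mat_diag (p + q + r) signature"
  unfolding J_mat_def mat_diag_def
  by (intro eq_matI) (auto simp: Let_def signature_def)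

lemma J_mat_eq_blk: "J_mat p q r = blk r (1\<^sub>m p) (0\<^sub>m p q) (0\<^sub>m q p) (- 1\<^sub>m q)"
  unfolding J_mat_def blk_def dsum_def by (intro eq_matI) (auto simp: Let_def)

lemma Ip0_mat_eq_blk: "Ip0_mat p q r = blk r (1\<^sub>m p) (0\<^sub>m p q) (0\<^sub>m q p) (0\<^sub>m q q)"
  unfolding Ip0_mat_def blk_def dsum_def by (intro eq_matI) (auto simp: Let_def)

lemma Ip0_mat_eq_mat_diag:
  "Ip0_mat p q r = mat_diag (p + q + r) (\<lambda>i. if i \<in> {..<p} then 1 else 0)"
  unfolding Ip0_mat_def mat_diag_def by (intro eq_matI) (auto simp: Let_def)

lemma blk_one_lower_eq_mat_diag:
  "blk r (0\<^sub>m p p) (0\<^sub>m p q) (0\<^sub>m q p) (1\<^sub>m q)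
    = mat_diag (p + q + r) (\<lambda>i. if i \<in> {p..<p + q} then 1 else 0)"
  unfolding blk_def dsum_def mat_diag_def by (intro eq_matI) auto

lemma S_mat_eq_blk:
  "S_mat p q r M = blk r (psd_sqrt p (1\<^sub>m p + M * M\<^sup>T)) M M\<^sup>T (psd_sqrt q (1\<^sub>m q + M\<^sup>T * M))"
  unfolding S_mat_def blk_def ..

end

section \<open>Matrix algebra with dimension premises, and matrices above the identity\<close>

text \<open>The premises equate dimensions instead of naming carriers, so the simplifier can
  discharge them for blocks of mixed shapes without instantiating size parameters by hand.\<close>

lemma mult_assoc_dim:
  fixes A B C :: "real mat"
  shows "dim_col A = dim_row B \<Longrightarrow> dim_col B = dim_row C \<Longrightarrow> A * B * C = A * (B * C)"
  by (rule assoc_mult_mat[of _ "dim_row A" "dim_row B" _ "dim_row C" _ "dim_col C"]) auto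

lemma transpose_mult_dim:
  fixes A B :: "real mat"
  shows "dim_col A = dim_row B \<Longrightarrow> (A * B)\<^sup>T = B\<^sup>T * A\<^sup>T"
  by (rule transpose_mult[of _ "dim_row A" "dim_row B" _ "dim_col B"]) auto

lemma add_zero_mat_dim:
  fixes A :: "real mat"
  assumes "dim_row A = n" "dim_col A = m"
  shows "0\<^sub>m n m + A = A" "A + 0\<^sub>m n m = A" "A - 0\<^sub>m n m = A"
  using assms by (auto intro!: eq_matI)

lemma mult_minus_dim:
  fixes A B C :: "real mat"
  shows "dim_col A = dim_row B \<Longrightarrow> dim_row B = dim_row C \<Longrightarrow> dim_col B = dim_col C \<Longrightarrow>
    A * (B - C) = A * B - A * C"
  by (rule mult_minus_distrib_mat[of _ "dim_row A" "dim_row B" _ "dim_col B"]) auto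

lemma minus_mult_dim:
  fixes A B C :: "real mat"
  shows "dim_col A = dim_row C \<Longrightarrow> dim_row B = dim_row A \<Longrightarrow> dim_col B = dim_col A \<Longrightarrow>
    (A - B) * C = A * C - B * C"
  by (rule minus_mult_distrib_mat[of _ "dim_row A" "dim_row C" _ _ "dim_col C"]) auto

lemma uminus_zero_mat: "- 0\<^sub>m n m = (0\<^sub>m n m :: real mat)"
  by (intro eq_matI) auto

lemmas mat_dim_simps = mult_assoc_dim transpose_mult_dim add_zero_mat_dim uminus_zero_mat

lemma mult_left_cancel_dim:
  fixes A B C :: "real mat"
  assumes "A * B = 1\<^sub>m n" "dim_col A = dim_row B" "dim_col B = n" "dim_row C = n"
  shows "A * (B * C) = C"
  using assms mult_assoc_dim[of A B C] by simp

lemma inverse_mat_transpose: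
  fixes A B :: "real mat"
  assumes A: "A \<in> carrier_mat n n" and B: "B \<in> carrier_mat n n" and AT: "A\<^sup>T = A" and AB: "A * B = 1\<^sub>m n"
  shows "B\<^sup>T = B"
proof -
  have BA: "B * A = 1\<^sub>m n" by (rule mat_mult_left_right_inverse[OF A B AB])
  have "(A * B)\<^sup>T = B\<^sup>T * A" using A B AT by (simp add: transpose_mult_dim)
  hence BTA: "B\<^sup>T * A = 1\<^sub>m n" using AB by simp
  have "B\<^sup>T = B\<^sup>T * (A * B)" unfolding AB using B by simp
  also have "\<dots> = B\<^sup>T * A * B" using A B by (simp add: mult_assoc_dim)
  also have "\<dots> = B" unfolding BTA using B by simp
  finally show ?thesis .
qed

text \<open>On the kernel of \<open>T\<close> the form of \<open>T - 1\<close> equals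
  \<open>- (v \<bullet> v)\<close>, which is nonnegative only at 0.\<close>

lemma ge_one_mat_inverse:
  assumes T: "T \<in> carrier_mat n n" and psd: "psd n (T - 1\<^sub>m n)"
  obtains Ti where "Ti \<in> carrier_mat n n" "T * Ti = 1\<^sub>m n" "Ti * T = 1\<^sub>m n"
proof (rule trivial_kernel_inverse[OF T _ that])
  fix v :: "real vec" assume v: "v \<in> carrier_vec n" and z: "T *\<^sub>v v = 0\<^sub>v n"
  have "0 \<le> v \<bullet> ((T - 1\<^sub>m n) *\<^sub>v v)" by (rule psdD(4)[OF psd v])
  also have "(T - 1\<^sub>m n) *\<^sub>v v = T *\<^sub>v v - v"
    using minus_mult_distrib_mat_vec[OF T one_carrier_mat v] v by simp
  also have "v \<bullet> (T *\<^sub>v v - v) = - (v \<bullet> v)" unfolding z using v by simp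
  finally have "v \<bullet> v = 0" using scalar_prod_self_nonneg[of v] by linarith
  thus "v = 0\<^sub>v n" using scalar_prod_self_eq_0[OF v] by simp
qed blast

lemma psd_ge_one:
  assumes T: "T \<in> carrier_mat n n" and psd: "psd n (T - 1\<^sub>m n)"
  shows "psd n T"
  unfolding psd_def
proof (intro conjI ballI)
  define R where "R = T - 1\<^sub>m n"
  have R: "R \<in> carrier_mat n n" "R\<^sup>T = R" unfolding R_def by (rule psdD(2)[OF psd], rule psdD(3)[OF psd])
  have TR: "R + 1\<^sub>m n = T" unfolding R_def using T by (intro eq_matI) auto
  have "(R + 1\<^sub>m n)\<^sup>T = R + 1\<^sub>m n" using R by (simp add: transpose_add[of _ n n])
  hence "T\<^sup>T = T" unfolding TR .
  thus "sym_mat n T" using T by (simp add: sym_mat_def)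
  fix v :: "real vec" assume v: "v \<in> carrier_vec n"
  have "0 \<le> v \<bullet> ((T - 1\<^sub>m n) *\<^sub>v v)" by (rule psdD(4)[OF psd v])
  also have "(T - 1\<^sub>m n) *\<^sub>v v = T *\<^sub>v v - v"
    using minus_mult_distrib_mat_vec[OF T one_carrier_mat v] v by simp
  also have "v \<bullet> (T *\<^sub>v v - v) = v \<bullet> (T *\<^sub>v v) - v \<bullet> v"
    using T v by (simp add: scalar_prod_minus_distrib[of _ n])
  finally show "0 \<le> v \<bullet> (T *\<^sub>v v)" using scalar_prod_self_nonneg[of v] by linarith
qed

lemma psd_one_plus_gram:
  fixes M :: "real mat"
  assumes M: "M \<in> carrier_mat p q"
  shows "psd p (1\<^sub>m p + M * M\<^sup>T)" "psd p (1\<^sub>m p + M * M\<^sup>T - 1\<^sub>m p)"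
proof -
  have "1\<^sub>m p + M * M\<^sup>T - 1\<^sub>m p = M * M\<^sup>T" using M by (intro eq_matI) auto
  thus *: "psd p (1\<^sub>m p + M * M\<^sup>T - 1\<^sub>m p)" using psd_mult_transpose[OF M] by simp
  show "psd p (1\<^sub>m p + M * M\<^sup>T)" by (rule psd_ge_one[OF _ *]) (use M in simp)
qed

section \<open>The matrices S (I + 0 + 0) S and their identities\<close>

context
  fixes p q r :: nat
begin

lemma S_Ip0_S_eq_blk:
  assumes M: "M \<in> carrier_mat p q"
  defines "H \<equiv> psd_sqrt p (1\<^sub>m p + M * M\<^sup>T)"
  shows "S_mat p q r M * Ip0_mat p q r * S_mat p q r M = blk r (H * H) (H * M) (M\<^sup>T * H) (M\<^sup>T * M)"
proof -
  define K where "K = psd_sqrt q (1\<^sub>m q + M\<^sup>T * M)"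
  have H: "H \<in> carrier_mat p p" unfolding H_def by (rule psdD(2)[OF psd_sqrt(1)[OF psd_one_plus_gram(1)[OF M]]])
  have "psd q (1\<^sub>m q + M\<^sup>T * M)" using psd_one_plus_gram(1)[of "M\<^sup>T" q p] M by simp
  hence K: "K \<in> carrier_mat q q" unfolding K_def by (rule psdD(2)[OF psd_sqrt(1)])
  have bc: "block_carrier p q H M M\<^sup>T K" "block_carrier p q (1\<^sub>m p) (0\<^sub>m p q) (0\<^sub>m q p) (0\<^sub>m q q)"
    "block_carrier p q H (0\<^sub>m p q) M\<^sup>T (0\<^sub>m q q)"
    using H K M by (auto simp: block_carrier_def)
  have "S_mat p q r M * Ip0_mat p q r = blk r H (0\<^sub>m p q) M\<^sup>T (0\<^sub>m q q)"
    unfolding S_mat_eq_blk H_def[symmetric] K_def[symmetric] Ip0_mat_eq_blk blk_mult[OF bc(1,2)]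
    using H K M by (simp add: mat_dim_simps)
  thus ?thesis
    unfolding S_mat_eq_blk H_def[symmetric] K_def[symmetric]
    using H K M by (simp add: blk_mult[OF bc(3,1)] mat_dim_simps)
qed

text \<open>\<open>X\<close> factors as \<open>L * L'\<close> through the first \<open>p\<close>
  coordinates, and \<open>L' * J * L\<close> is the identity there, so \<open>X * J * X\<close>
  collapses to \<open>L * L'\<close>. The second identity follows because \<open>J * J\<close> is
  the projection onto the first \<open>p + q\<close> coordinates, where \<open>X\<close>
  lives.\<close>

lemma S_Ip0_S_reflexive:
  assumes M: "M \<in> carrier_mat p q"
  defines "X \<equiv> S_mat p q r M * Ip0_mat p q r * S_mat p q r M"
  shows "X * J_mat p q r * X = X" "(X - J_mat p q r) * J_mat p q r * X = 0\<^sub>m (p + q + r) (p + q + r)"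
proof -
  let ?J = "J_mat p q r"
  let ?n = "p + q + r"
  define H where "H = psd_sqrt p (1\<^sub>m p + M * M\<^sup>T)"
  note psdH = psd_sqrt[OF psd_one_plus_gram(1)[OF M], folded H_def]
  have H: "H \<in> carrier_mat p p" by (rule psdD(2)[OF psdH(1)])
  have HH: "H * H - M * M\<^sup>T = 1\<^sub>m p" unfolding psdH(2) using M by (intro eq_matI) auto
  have X: "X = blk r (H * H) (H * M) (M\<^sup>T * H) (M\<^sup>T * M)"
    unfolding X_def H_def by (rule S_Ip0_S_eq_blk[OF M])
  define L where "L = blk r H (0\<^sub>m p q) M\<^sup>T (0\<^sub>m q q)"
  define L' where "L' = blk r H M (0\<^sub>m q p) (0\<^sub>m q q)"
  have bc: "block_carrier p q H (0\<^sub>m p q) M\<^sup>T (0\<^sub>m q q)" "block_carrier p q H M (0\<^sub>m q p) (0\<^sub>m q q)"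
    "block_carrier p q (1\<^sub>m p) (0\<^sub>m p q) (0\<^sub>m q p) (- 1\<^sub>m q)"
    "block_carrier p q H (- M) (0\<^sub>m q p) (0\<^sub>m q q)"
    "block_carrier p q (1\<^sub>m p) (0\<^sub>m p q) (0\<^sub>m q p) (0\<^sub>m q q)"
    "block_carrier p q (1\<^sub>m p) (0\<^sub>m p q) (0\<^sub>m q p) (1\<^sub>m q)"
    "block_carrier p q (H * H) (H * M) (M\<^sup>T * H) (M\<^sup>T * M)"
    using H M by (auto simp: block_carrier_def)
  have c: "L \<in> carrier_mat ?n ?n" "L' \<in> carrier_mat ?n ?n" "?J \<in> carrier_mat ?n ?n"
    unfolding L_def L'_def J_mat_eq_blk using bc by (auto intro: blk_carrier)
  have XLL: "X = L * L'" unfolding X L_def L'_def blk_mult[OF bc(1,2)]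
    using H M by (simp add: mat_dim_simps)
  have "L' * ?J = blk r H (- M) (0\<^sub>m q p) (0\<^sub>m q q)"
    unfolding L'_def J_mat_eq_blk blk_mult[OF bc(2,3)] using H M by (simp add: mat_dim_simps)
  hence "L' * ?J * L = blk r (H * H + (- M) * M\<^sup>T) (0\<^sub>m p q) (0\<^sub>m q p) (0\<^sub>m q q)"
    unfolding L_def using H M by (simp add: blk_mult[OF bc(4,1)] mat_dim_simps)
  also have "H * H + (- M) * M\<^sup>T = H * H - M * M\<^sup>T" using H M by (intro eq_matI) auto
  \<comment> \<open>The only surviving block is \<open>H * H - M * M\<^sup>T\<close>, which is the
    identity by the choice of \<open>H\<close>: the analogue of cosh^2 - sinh^2 = 1.\<close>
  finally have LJL: "L' * ?J * L = blk r (1\<^sub>m p) (0\<^sub>m p q) (0\<^sub>m q p) (0\<^sub>m q q)" unfolding HH .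
  have LL: "blk r (1\<^sub>m p) (0\<^sub>m p q) (0\<^sub>m q p) (0\<^sub>m q q) * L' = L'"
    unfolding L'_def blk_mult[OF bc(5,2)] using H M by (simp add: mat_dim_simps)
  have "X * ?J * X = L * ((L' * ?J * L) * L')"
    unfolding XLL using c by (simp add: mat_dim_simps)
  also have "\<dots> = X" unfolding LJL LL XLL ..
  finally show XJX: "X * ?J * X = X" .
  have "?J * ?J = blk r (1\<^sub>m p) (0\<^sub>m p q) (0\<^sub>m q p) (1\<^sub>m q)"
    unfolding J_mat_eq_blk blk_mult[OF bc(3,3)] by (simp add: mat_dim_simps)
  hence JJX: "?J * ?J * X = X"
    unfolding X using H M by (simp add: blk_mult[OF bc(6,7)] mat_dim_simps)
  have Xc: "X \<in> carrier_mat ?n ?n" unfolding X using bc by (auto intro: blk_carrier)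
  have "(X - ?J) * ?J * X = X * ?J * X - ?J * ?J * X"
    using Xc c by (simp add: minus_mult_dim)
  thus "(X - ?J) * ?J * X = 0\<^sub>m ?n ?n" unfolding XJX JJX using Xc by simp
qed

end

section \<open>The normal form under congruence\<close>

context
  fixes p q r :: nat
begin

lemma S_mat_carrier:
  assumes M: "M \<in> carrier_mat p q"
  shows "S_mat p q r M \<in> carrier_mat (p + q + r) (p + q + r)"
proof -
  have "psd_sqrt p (1\<^sub>m p + M * M\<^sup>T) \<in> carrier_mat p p"
    by (rule psdD(2)[OF psd_sqrt(1)[OF psd_one_plus_gram(1)[OF M]]])
  moreover have "psd_sqrt q (1\<^sub>m q + M\<^sup>T * M) \<in> carrier_mat q q"
    using psdD(2)[OF psd_sqrt(1)[OF psd_one_plus_gram(1)[of "M\<^sup>T" q p]]] M by simp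
  ultimately show ?thesis unfolding S_mat_eq_blk
    using M by (intro blk_carrier) (auto simp: block_carrier_def)
qed

lemma S_Ip0_S_carrier:
  assumes "M \<in> carrier_mat p q"
  shows "S_mat p q r M * Ip0_mat p q r * S_mat p q r M \<in> carrier_mat (p + q + r) (p + q + r)"
  using S_mat_carrier[OF assms]
  by (auto intro!: mult_carrier_mat[of _ "p + q + r" "p + q + r"] simp: Ip0_mat_eq_mat_diag)

text \<open>The identities alone force \<open>X\<close> to vanish on the last \<open>r\<close>
  coordinates, where \<open>J\<close> gives no information. The three block equations are then
  blocks of \<open>X * J * X = X\<close>.\<close>

lemma reflexive_block_form:
  assumes X: "psd (p + q + r) X" and Y: "psd (p + q + r) Y" and XY: "X - Y = J_mat p q r"
    and XJX: "X * J_mat p q r * X = X" and YJX: "Y * J_mat p q r * X = 0\<^sub>m (p + q + r) (p + q + r)"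
  obtains a m b where "block_carrier p q a m m\<^sup>T b" "X = blk r a m m\<^sup>T b"
    "Y = blk r (a - 1\<^sub>m p) m m\<^sup>T (b + 1\<^sub>m q)"
    "psd p (a - 1\<^sub>m p)" "psd q b"
    "a * a - m * m\<^sup>T = a" "a * m - m * b = m" "m\<^sup>T * m - b * b = b"
proof -
  let ?n = "p + q + r"
  let ?J = "J_mat p q r"
  note Xc = psdD(2)[OF X] and Yc = psdD(2)[OF Y] and XT = psdD(3)[OF X] and YT = psdD(3)[OF Y]
  have Jc: "?J \<in> carrier_mat ?n ?n" and JT: "?J\<^sup>T = ?J" unfolding J_mat_eq_mat_diag by simp_all
  have "(Y * ?J * X)\<^sup>T = X * ?J * Y"
    using Xc Yc Jc by (simp add: mat_dim_simps XT YT JT)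
  hence XJY: "X * ?J * Y = 0\<^sub>m ?n ?n" unfolding YJX by simp
  \<comment> \<open>Since \<open>X - Y = J\<close>, one factor \<open>J\<close> can be replaced by
    the difference. The result \<open>X * J * J = X\<close> kills the columns where the signature is
    0; symmetry handles the rows.\<close>
  have "X * (?J * ?J) = X * ?J * (X - Y)" unfolding XY using Xc Jc by (simp add: mat_dim_simps)
  also have "\<dots> = X * ?J * X - X * ?J * Y" using Xc Yc Jc by (subst mult_minus_dim) auto
  also have "\<dots> = X" unfolding XJX XJY using Xc by (simp add: mat_dim_simps)
  finally have "X * mat_diag ?n (\<lambda>i. signature p q i * signature p q i) = X"
    unfolding J_mat_eq_mat_diag mat_diag_diag .
  hence ent: "X $$ (i,j) = X $$ (i,j) * (signature p q j * signature p q j)" if "i < ?n" "j < ?n" for i j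
    using that unfolding mat_diag_mult_right[OF Xc]
    by (metis (mono_tags, lifting) index_mat(1) old.prod.case)
  have zr: "X $$ (i,j) = 0" if "i < ?n" "j < ?n" "p + q \<le> j" for i j
    using ent[OF that(1,2)] that(3) by (simp add: signature_def)
  have symX: "X $$ (i,j) = X $$ (j,i)" if "i < ?n" "j < ?n" for i j
  proof -
    have "X\<^sup>T $$ (i,j) = X $$ (j,i)" using that Xc by simp
    thus ?thesis unfolding XT .
  qed
  have zl: "X $$ (i,j) = 0" if "i < ?n" "j < ?n" "p + q \<le> i" for i j
    using zr[of j i] symX[of i j] that by simp
  define a where "a = Matrix.mat p p (\<lambda>(i,j). X $$ (i,j))"
  define m where "m = Matrix.mat p q (\<lambda>(i,j). X $$ (i,p + j))"
  define b where "b = Matrix.mat q q (\<lambda>(i,j). X $$ (p + i,p + j))"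
  have c: "a \<in> carrier_mat p p" "m \<in> carrier_mat p q" "b \<in> carrier_mat q q"
    by (simp_all add: a_def m_def b_def)
  have bc: "block_carrier p q a m m\<^sup>T b" "block_carrier p q (1\<^sub>m p) (0\<^sub>m p q) (0\<^sub>m q p) (- 1\<^sub>m q)"
    using c by (auto simp: block_carrier_def)
  have Xb: "X = blk r a m m\<^sup>T b"
  proof (rule eq_matI)
    fix i j assume "i < dim_row (blk r a m m\<^sup>T b)" "j < dim_col (blk r a m m\<^sup>T b)"
    hence ij: "i < ?n" "j < ?n" using blk_carrier[OF bc(1), of r] by auto
    show "X $$ (i,j) = blk r a m m\<^sup>T b $$ (i,j)"
      unfolding blk_index[OF bc(1) ij] using ij zr[OF ij] zl[OF ij] symX[OF ij]
      by (auto simp: a_def m_def b_def)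
  qed (use Xc blk_carrier[OF bc(1), of r] in auto)
  have Yb': "Y = X - ?J" unfolding XY[symmetric] using Xc Yc by (intro eq_matI) auto
  have "b - - 1\<^sub>m q = b + 1\<^sub>m q" using c by (intro eq_matI) auto
  hence Yb: "Y = blk r (a - 1\<^sub>m p) m m\<^sup>T (b + 1\<^sub>m q)"
    unfolding Yb' Xb J_mat_eq_blk blk_minus[OF bc] using c by (simp add: mat_dim_simps)
  have bcY: "block_carrier p q (a - 1\<^sub>m p) m m\<^sup>T (b + 1\<^sub>m q)"
    using c by (auto simp: block_carrier_def)
  \<comment> \<open>Positivity of \<open>Y\<close> rather than of \<open>X\<close> yields the bound
    \<open>a \<ge> 1\<close>, because subtracting \<open>J\<close> lowers the upper left block by
    1.\<close>
  have psda: "psd p (a - 1\<^sub>m p)" using psd_blk_diagonal(1)[OF bcY] Y Yb by simp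
  have psdb: "psd q b" using psd_blk_diagonal(2)[OF bc(1)] X Xb by simp
  have bc2: "block_carrier p q a (- m) m\<^sup>T (- b)"
    "block_carrier p q (a * a - m * m\<^sup>T) (a * m - m * b) (m\<^sup>T * a - b * m\<^sup>T) (m\<^sup>T * m - b * b)"
    using c by (auto simp: block_carrier_def)
  have "X * ?J = blk r a (- m) m\<^sup>T (- b)"
    unfolding Xb J_mat_eq_blk blk_mult[OF bc(1,2)] using c by (simp add: mat_dim_simps)
  hence "X * ?J * X = blk r (a * a + (- m) * m\<^sup>T) (a * m + (- m) * b) (m\<^sup>T * a + (- b) * m\<^sup>T) (m\<^sup>T * m + (- b) * b)"
    unfolding Xb using blk_mult[OF bc2(1) bc(1)] by simp
  also have "a * a + (- m) * m\<^sup>T = a * a - m * m\<^sup>T" using c by (intro eq_matI) auto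
  also have "a * m + (- m) * b = a * m - m * b" using c by (intro eq_matI) auto
  also have "m\<^sup>T * a + (- b) * m\<^sup>T = m\<^sup>T * a - b * m\<^sup>T" using c by (intro eq_matI) auto
  also have "m\<^sup>T * m + (- b) * b = m\<^sup>T * m - b * b" using c by (intro eq_matI) auto
  finally have "blk r (a * a - m * m\<^sup>T) (a * m - m * b) (m\<^sup>T * a - b * m\<^sup>T) (m\<^sup>T * m - b * b) = blk r a m m\<^sup>T b"
    using XJX unfolding Xb by simp
  from blk_inject[OF bc2(2) bc(1) this] show ?thesis using that bc(1) Xb Yb psda psdb by blast
qed

text \<open>With \<open>T = b + 1\<close> the equations read \<open>a * m = m * T\<close> and
  \<open>m\<^sup>T * m = b * T\<close>. Both \<open>a\<close> and \<open>T\<close> are at least 1,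
  hence invertible, and \<open>ai * m = m * Ti\<close>. The resulting formulas for \<open>b\<close>
  and \<open>a - 1\<close> say that the Schur complements of \<open>a\<close> and of
  \<open>T\<close> vanish in the block matrices with blocks \<open>a\<close>, \<open>m\<close>,
  \<open>m\<^sup>T\<close>, \<open>b\<close> and \<open>a - 1\<close>, \<open>m\<close>,
  \<open>m\<^sup>T\<close>, \<open>b + 1\<close>.\<close>

lemma reflexive_block_consequences:
  assumes bc: "block_carrier p q a m m\<^sup>T b"
    and psda: "psd p (a - 1\<^sub>m p)" and psdb: "psd q b"
    and e: "a * a - m * m\<^sup>T = a" "a * m - m * b = m" "m\<^sup>T * m - b * b = b"
  obtains ai Ti where "ai \<in> carrier_mat p p" "Ti \<in> carrier_mat q q"
    "a * ai = 1\<^sub>m p" "ai * a = 1\<^sub>m p" "Ti * (b + 1\<^sub>m q) = 1\<^sub>m q" "(b + 1\<^sub>m q) * Ti = 1\<^sub>m q"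
    "m\<^sup>T * (ai * m) = b" "m * (Ti * m\<^sup>T) = a - 1\<^sub>m p" "m * m\<^sup>T = a * a - a"
proof -
  have c: "a \<in> carrier_mat p p" "m \<in> carrier_mat p q" "b \<in> carrier_mat q q"
    using bc by (auto simp: block_carrier_def)
  define T where "T = b + 1\<^sub>m q"
  have T: "T \<in> carrier_mat q q" using c by (simp add: T_def)
  have "T - 1\<^sub>m q = b" using c unfolding T_def by (intro eq_matI) auto
  then obtain Ti where Ti: "Ti \<in> carrier_mat q q" "T * Ti = 1\<^sub>m q" "Ti * T = 1\<^sub>m q"
    using ge_one_mat_inverse[OF T] psdb by metis
  obtain ai where ai: "ai \<in> carrier_mat p p" "a * ai = 1\<^sub>m p" "ai * a = 1\<^sub>m p"
    using ge_one_mat_inverse[OF c(1) psda] by blast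
  have rearr: "U = V + W" if "U - V = W" "U \<in> carrier_mat k l" "V \<in> carrier_mat k l" for U V W :: "real mat" and k l
    using that by (intro eq_matI) auto
  have mm: "m * m\<^sup>T = a * a - a"
  proof -
    have "a * a = m * m\<^sup>T + a" by (rule rearr[OF e(1), of p p]) (use c in auto)
    moreover have "m * m\<^sup>T + a - a = m * m\<^sup>T" using c by (intro eq_matI) auto
    ultimately show ?thesis by simp
  qed
  have "a * m = m * b + m" by (rule rearr[OF e(2), of p q]) (use c in auto)
  also have "\<dots> = m * T" unfolding T_def using c by (simp add: mult_add_distrib_mat[of _ p q _ q])
  finally have am: "a * m = m * T" .
  have "m\<^sup>T * m = b * b + b" by (rule rearr[OF e(3), of q q]) (use c in auto)
  also have "\<dots> = b * T" unfolding T_def using c by (simp add: mult_add_distrib_mat[of _ q q _ q])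
  finally have mTm: "m\<^sup>T * m = b * T" .
  have "ai * (a * m) = m" using c ai by (intro mult_left_cancel_dim[of _ _ p]) auto
  hence aimT: "ai * (m * T) = m" unfolding am .
  have "m\<^sup>T * (ai * m) = m\<^sup>T * (ai * (m * (T * Ti)))" unfolding Ti(2) using c by simp
  also have "\<dots> = m\<^sup>T * (ai * (m * T)) * Ti" using c ai T Ti(1) by (simp add: mult_assoc_dim)
  also have "\<dots> = b * (T * Ti)" unfolding aimT mTm using c T Ti(1) by (simp add: mult_assoc_dim)
  also have "\<dots> = b" unfolding Ti(2) using c by simp
  finally have E1: "m\<^sup>T * (ai * m) = b" .
  have "m * Ti = ai * (m * T) * Ti" unfolding aimT ..
  also have "\<dots> = ai * (m * (T * Ti))" using c ai T Ti(1) by (simp add: mult_assoc_dim)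
  also have "\<dots> = ai * m" unfolding Ti(2) using c by simp
  finally have mTi: "m * Ti = ai * m" .
  have "m * (Ti * m\<^sup>T) = (m * Ti) * m\<^sup>T" using c Ti(1) by (simp add: mult_assoc_dim)
  also have "\<dots> = ai * (a * a - a)" unfolding mTi mm[symmetric] using c ai by (simp add: mult_assoc_dim)
  also have "\<dots> = ai * (a * a) - ai * a" using c ai by (intro mult_minus_dim) auto
  also have "ai * (a * a) = a" using c ai by (intro mult_left_cancel_dim[of _ _ p]) auto
  also have "ai * a = 1\<^sub>m p" by (rule ai(3))
  finally have E2: "m * (Ti * m\<^sup>T) = a - 1\<^sub>m p" .
  show ?thesis using that[OF ai(1) Ti(1) ai(2,3)] Ti(2,3) E1 E2 mm unfolding T_def by blast
qed

text \<open>A block matrix with zero Schur complement factors through its pivot block: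
  \<open>X\<close> through \<open>a\<close>, of size \<open>p\<close>, and \<open>Y\<close> through
  \<open>b + 1\<close>, of size \<open>q\<close>.\<close>

lemma reflexive_factorization:
  assumes "psd (p + q + r) X" "psd (p + q + r) Y" "X - Y = J_mat p q r"
    "X * J_mat p q r * X = X" "Y * J_mat p q r * X = 0\<^sub>m (p + q + r) (p + q + r)"
  defines "n \<equiv> p + q + r"
  shows "\<exists>F G. F \<in> carrier_mat n n \<and> G \<in> carrier_mat n n \<and>
      X = F * mat_diag n (\<lambda>i. if i \<in> {..<p} then 1 else 0) * G" (is ?thesis1)
    and "\<exists>F G. F \<in> carrier_mat n n \<and> G \<in> carrier_mat n n \<and>
      Y = F * mat_diag n (\<lambda>i. if i \<in> {p..<p + q} then 1 else 0) * G" (is ?thesis2)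
proof -
  obtain a m b where bc: "block_carrier p q a m m\<^sup>T b" and X: "X = blk r a m m\<^sup>T b"
    and Y: "Y = blk r (a - 1\<^sub>m p) m m\<^sup>T (b + 1\<^sub>m q)"
    and e: "psd p (a - 1\<^sub>m p)" "psd q b"
    "a * a - m * m\<^sup>T = a" "a * m - m * b = m" "m\<^sup>T * m - b * b = b"
    by (rule reflexive_block_form[OF assms(1-5)])
  obtain ai Ti where i: "ai \<in> carrier_mat p p" "Ti \<in> carrier_mat q q"
    and inv: "a * ai = 1\<^sub>m p" "ai * a = 1\<^sub>m p" "Ti * (b + 1\<^sub>m q) = 1\<^sub>m q" "(b + 1\<^sub>m q) * Ti = 1\<^sub>m q"
    and E: "m\<^sup>T * (ai * m) = b" "m * (Ti * m\<^sup>T) = a - 1\<^sub>m p" "m * m\<^sup>T = a * a - a"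
    by (rule reflexive_block_consequences[OF bc e])
  have c: "a \<in> carrier_mat p p" "m \<in> carrier_mat p q" "b \<in> carrier_mat q q"
    using bc by (auto simp: block_carrier_def)
  define T where "T = b + 1\<^sub>m q"
  have T: "T \<in> carrier_mat q q" using c by (simp add: T_def)
  have aaim: "a * (ai * m) = m" using c i inv by (intro mult_left_cancel_dim[of _ _ p]) auto
  have TTim: "T * (Ti * m\<^sup>T) = m\<^sup>T" unfolding T_def using c i inv by (intro mult_left_cancel_dim[of _ _ q]) auto
  have bc': "block_carrier p q a (0\<^sub>m p q) m\<^sup>T (0\<^sub>m q q)"
    "block_carrier p q (1\<^sub>m p) (0\<^sub>m p q) (0\<^sub>m q p) (0\<^sub>m q q)"
    "block_carrier p q (1\<^sub>m p) (ai * m) (0\<^sub>m q p) (0\<^sub>m q q)"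
    "block_carrier p q (0\<^sub>m p p) m (0\<^sub>m q p) T"
    "block_carrier p q (0\<^sub>m p p) (0\<^sub>m p q) (0\<^sub>m q p) (1\<^sub>m q)"
    "block_carrier p q (0\<^sub>m p p) (0\<^sub>m p q) (Ti * m\<^sup>T) (1\<^sub>m q)"
    using c i T by (auto simp: block_carrier_def)
  have "blk r a (0\<^sub>m p q) m\<^sup>T (0\<^sub>m q q) * blk r (1\<^sub>m p) (0\<^sub>m p q) (0\<^sub>m q p) (0\<^sub>m q q)
     = blk r a (0\<^sub>m p q) m\<^sup>T (0\<^sub>m q q)"
    unfolding blk_mult[OF bc'(1,2)] using c by (simp add: mat_dim_simps)
  moreover have "blk r a (0\<^sub>m p q) m\<^sup>T (0\<^sub>m q q) * blk r (1\<^sub>m p) (ai * m) (0\<^sub>m q p) (0\<^sub>m q q) = X"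
    unfolding blk_mult[OF bc'(1,3)] X aaim E(1) using c i by (simp add: mat_dim_simps)
  ultimately have "X = blk r a (0\<^sub>m p q) m\<^sup>T (0\<^sub>m q q)
      * mat_diag n (\<lambda>i. if i \<in> {..<p} then 1 else 0) * blk r (1\<^sub>m p) (ai * m) (0\<^sub>m q p) (0\<^sub>m q q)"
    unfolding n_def Ip0_mat_eq_mat_diag[symmetric] Ip0_mat_eq_blk by simp
  thus ?thesis1 using blk_carrier[OF bc'(1), of r] blk_carrier[OF bc'(3), of r] unfolding n_def by blast
  have "blk r (0\<^sub>m p p) m (0\<^sub>m q p) T * blk r (0\<^sub>m p p) (0\<^sub>m p q) (0\<^sub>m q p) (1\<^sub>m q)
     = blk r (0\<^sub>m p p) m (0\<^sub>m q p) T"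
    unfolding blk_mult[OF bc'(4,5)] using c T by (simp add: mat_dim_simps)
  moreover have "blk r (0\<^sub>m p p) m (0\<^sub>m q p) T * blk r (0\<^sub>m p p) (0\<^sub>m p q) (Ti * m\<^sup>T) (1\<^sub>m q) = Y"
    unfolding blk_mult[OF bc'(4,6)] Y TTim E(2) T_def[symmetric] using c i T by (simp add: mat_dim_simps)
  ultimately have "Y = blk r (0\<^sub>m p p) m (0\<^sub>m q p) T
      * mat_diag n (\<lambda>i. if i \<in> {p..<p + q} then 1 else 0) * blk r (0\<^sub>m p p) (0\<^sub>m p q) (Ti * m\<^sup>T) (1\<^sub>m q)"
    unfolding n_def blk_one_lower_eq_mat_diag[symmetric] by simp
  thus ?thesis2 using blk_carrier[OF bc'(4), of r] blk_carrier[OF bc'(6), of r] unfolding n_def by blast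
qed

lemma reflexive_S_Ip0_S:
  assumes "psd (p + q + r) X" "psd (p + q + r) Y" "X - Y = J_mat p q r"
    "X * J_mat p q r * X = X" "Y * J_mat p q r * X = 0\<^sub>m (p + q + r) (p + q + r)"
  shows "\<exists>!M. M \<in> carrier_mat p q \<and> X = S_mat p q r M * Ip0_mat p q r * S_mat p q r M"
proof -
  obtain a m b where bc: "block_carrier p q a m m\<^sup>T b" and X: "X = blk r a m m\<^sup>T b"
    and e: "psd p (a - 1\<^sub>m p)" "psd q b"
    "a * a - m * m\<^sup>T = a" "a * m - m * b = m" "m\<^sup>T * m - b * b = b"
    by (rule reflexive_block_form[OF assms])
  obtain ai where ai: "ai \<in> carrier_mat p p" "a * ai = 1\<^sub>m p" "ai * a = 1\<^sub>m p"
    and E: "m\<^sup>T * (ai * m) = b" "m * m\<^sup>T = a * a - a"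
    by (rule reflexive_block_consequences[OF bc e])
  have c: "a \<in> carrier_mat p p" "m \<in> carrier_mat p q" "b \<in> carrier_mat q q"
    using bc by (auto simp: block_carrier_def)
  note psda = psd_ge_one[OF c(1) e(1)]
  define H where "H = psd_sqrt p a"
  note psdH = psd_sqrt[OF psda, folded H_def]
  note H = psdD(2)[OF psdH(1)] and HT = psdD(3)[OF psdH(1)]
  \<comment> \<open>An inverse of the root without inverting it separately:
    \<open>H * (H * ai) = a * ai = 1\<close>.\<close>
  define Hi where "Hi = H * ai"
  have Hi: "Hi \<in> carrier_mat p p" using H ai by (simp add: Hi_def)
  have HHi: "H * Hi = 1\<^sub>m p"
  proof -
    have "H * Hi = (H * H) * ai" unfolding Hi_def using H ai by (simp add: mult_assoc_dim)
    thus ?thesis unfolding psdH(2) ai(2) .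
  qed
  have HiH: "Hi * H = 1\<^sub>m p" by (rule mat_mult_left_right_inverse[OF H Hi HHi])
  have HiT: "Hi\<^sup>T = Hi" by (rule inverse_mat_transpose[OF H Hi HT HHi])
  have HiHX: "Hi * (H * Z) = Z" "H * (Hi * Z) = Z" if "dim_row Z = p" for Z
    using that H Hi HHi HiH by (auto intro!: mult_left_cancel_dim[of _ _ p])
  have HiHi: "Hi * Hi = ai"
  proof -
    have "Hi * Hi = Hi * (H * ai)" by (simp add: Hi_def)
    thus ?thesis using HiHX(1)[of ai] ai by simp
  qed
  define M where "M = Hi * m"
  have M: "M \<in> carrier_mat p q" using Hi c by (simp add: M_def)
  have HM: "H * M = m" unfolding M_def using HiHX c by simp
  have MT: "M\<^sup>T = m\<^sup>T * Hi" unfolding M_def using Hi c by (simp add: transpose_mult_dim HiT)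
  have MTH: "M\<^sup>T * H = m\<^sup>T" unfolding MT using c Hi H HiH by (simp add: mult_assoc_dim)
  have "M\<^sup>T * M = m\<^sup>T * ((Hi * Hi) * m)" unfolding MT unfolding M_def using c Hi by (simp add: mult_assoc_dim)
  hence MTM: "M\<^sup>T * M = b" unfolding HiHi E(1) .
  \<comment> \<open>With \<open>m * m\<^sup>T = a * a - a\<close>, conjugation by the inverse root
    of \<open>a\<close> leaves \<open>a - 1\<close>; thus \<open>H\<close> is the root demanded by
    \<open>S_mat\<close>.\<close>
  have "M * M\<^sup>T = Hi * ((m * m\<^sup>T) * Hi)" unfolding MT unfolding M_def using c Hi by (simp add: mult_assoc_dim)
  also have "\<dots> = Hi * ((a * a) * Hi - a * Hi)"
    unfolding E(2) using c Hi by (subst minus_mult_dim) auto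
  also have "\<dots> = Hi * ((a * a) * Hi) - Hi * (a * Hi)"
    using c Hi by (intro mult_minus_dim) auto
  also have "Hi * (a * Hi) = 1\<^sub>m p"
    unfolding psdH(2)[symmetric] using H Hi by (simp add: mult_assoc_dim HiHX HHi HiH)
  also have "Hi * ((a * a) * Hi) = a"
    unfolding psdH(2)[symmetric] using H Hi by (simp add: mult_assoc_dim HiHX HHi HiH)
  finally have MM: "M * M\<^sup>T = a - 1\<^sub>m p" .
  have aM: "1\<^sub>m p + M * M\<^sup>T = a" unfolding MM using c by (intro eq_matI) auto
  have XM: "X = S_mat p q r M * Ip0_mat p q r * S_mat p q r M"
    unfolding S_Ip0_S_eq_blk[OF M] aM H_def[symmetric] HM MTH MTM psdH(2) X ..
  show ?thesis
  proof (rule ex1I[of _ M])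
    fix N assume N: "N \<in> carrier_mat p q \<and> X = S_mat p q r N * Ip0_mat p q r * S_mat p q r N"
    hence Nc: "N \<in> carrier_mat p q" by simp
    define K where "K = psd_sqrt p (1\<^sub>m p + N * N\<^sup>T)"
    note psdK = psd_sqrt(1)[OF psd_one_plus_gram(1)[OF Nc], folded K_def]
    have K: "K \<in> carrier_mat p p" by (rule psdD(2)[OF psdK])
    have XN: "blk r a m m\<^sup>T b = blk r (K * K) (K * N) (N\<^sup>T * K) (N\<^sup>T * N)"
      using N S_Ip0_S_eq_blk[OF Nc, of r, folded K_def] X by metis
    have "block_carrier p q (K * K) (K * N) (N\<^sup>T * K) (N\<^sup>T * N)"
      using K Nc by (auto simp: block_carrier_def)
    from blk_inject[OF bc this XN] have aK: "a = K * K" and mK: "m = K * N" by auto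
    \<comment> \<open>Uniqueness of \<open>M\<close> comes from uniqueness of the psd root: the
      upper left block determines \<open>K\<close>, and then the upper right block determines
      \<open>N\<close>.\<close>
    have KH: "K = H" unfolding H_def by (rule psd_sqrt_eqI[OF psdK aK[symmetric], symmetric])
    have "Hi * (H * N) = N" using HiHX Nc by simp
    thus "N = M" unfolding M_def mK KH by simp
  qed (use M XM in simp)
qed

end

section \<open>Transfer along the congruence A - B = P J P^T\<close>

lemma psd_congruence:
  assumes X: "psd n X" and Q: "Q \<in> carrier_mat n n"
  shows "psd n (Q * X * Q\<^sup>T)"
  unfolding psd_def
proof (intro conjI ballI)
  note Xc = psdD(2)[OF X] and XT = psdD(3)[OF X]
  show "sym_mat n (Q * X * Q\<^sup>T)" unfolding sym_mat_def
    using Xc Q by (simp add: mat_dim_simps XT)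
  fix x :: "real vec" assume x: "x \<in> carrier_vec n"
  have "x \<bullet> ((Q * X * Q\<^sup>T) *\<^sub>v x) = x \<bullet> (Q *\<^sub>v (X *\<^sub>v (Q\<^sup>T *\<^sub>v x)))"
    using Xc Q x by (simp add: assoc_mult_mat_vec[of _ n n _ n] mult_carrier_mat[of _ n n _ n])
  also have "\<dots> = (Q\<^sup>T *\<^sub>v x) \<bullet> (X *\<^sub>v (Q\<^sup>T *\<^sub>v x))"
    using transpose_vec_mult_scalar[OF Q _ x, of "X *\<^sub>v (Q\<^sup>T *\<^sub>v x)"] Xc Q x by simp
  finally show "0 \<le> x \<bullet> ((Q * X * Q\<^sup>T) *\<^sub>v x)"
    using psdD(4)[OF X, of "Q\<^sup>T *\<^sub>v x"] Q x by simp
qed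

context
  fixes p q r n :: nat and P Q X Y :: "real mat"
  assumes n: "n = p + q + r"
    and P: "P \<in> carrier_mat n n" and Q: "Q \<in> carrier_mat n n"
    and PQ: "P * Q = 1\<^sub>m n" and QP: "Q * P = 1\<^sub>m n"
    and X: "psd n X" and Y: "psd n Y"
    and XY: "X - Y = P * J_mat p q r * P\<^sup>T"
begin

lemma carriers: "X \<in> carrier_mat n n" "Y \<in> carrier_mat n n" "J_mat p q r \<in> carrier_mat n n"
  using psdD(2)[OF X] psdD(2)[OF Y] n by (simp_all add: J_mat_eq_mat_diag)

lemma transpose_inverse: "Q\<^sup>T * P\<^sup>T = 1\<^sub>m n" "P\<^sup>T * Q\<^sup>T = 1\<^sub>m n"
  unfolding transpose_mult[OF P Q, symmetric] transpose_mult[OF Q P, symmetric] PQ QP by simp_all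

lemma inverse_cancel:
  assumes "dim_row Z = n"
  shows "P * (Q * Z) = Z" "Q * (P * Z) = Z" "Q\<^sup>T * (P\<^sup>T * Z) = Z" "P\<^sup>T * (Q\<^sup>T * Z) = Z"
  using assms P Q PQ QP transpose_inverse by (auto intro!: mult_left_cancel_dim[of _ _ n])

lemma congruence_eq_iff:
  assumes "Z \<in> carrier_mat n n" "W \<in> carrier_mat n n"
  shows "Z = P * W * P\<^sup>T \<longleftrightarrow> Q * Z * Q\<^sup>T = W"
proof
  assume "Z = P * W * P\<^sup>T"
  thus "Q * Z * Q\<^sup>T = W" using assms P Q
    by (simp add: mult_assoc_dim inverse_cancel transpose_inverse)
next
  assume *: "Q * Z * Q\<^sup>T = W"
  show "Z = P * W * P\<^sup>T" unfolding *[symmetric] using assms P Q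
    by (simp add: mult_assoc_dim inverse_cancel transpose_inverse)
qed

lemma normalized_reflexive:
  assumes "kernel_sum X Y = carrier_vec n"
  defines "X' \<equiv> Q * X * Q\<^sup>T" and "Y' \<equiv> Q * Y * Q\<^sup>T"
  shows "psd n X'" "psd n Y'" "X' - Y' = J_mat p q r" "X' * J_mat p q r * X' = X'"
    "Y' * J_mat p q r * X' = 0\<^sub>m n n"
proof -
  let ?J = "J_mat p q r"
  note c = carriers P Q
  show "psd n X'" "psd n Y'" unfolding X'_def Y'_def by (rule psd_congruence[OF X Q], rule psd_congruence[OF Y Q])
  have "X' - Y' = Q * (X - Y) * Q\<^sup>T"
    unfolding X'_def Y'_def using c by (simp add: mult_minus_dim minus_mult_dim)
  also have "\<dots> = ?J" using congruence_eq_iff[OF minus_carrier_mat[OF c(2)] c(3), of X] XY by blast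
  finally show "X' - Y' = ?J" .
  \<comment> \<open>\<open>J\<close> transported by the congruence. It is a generalized inverse of
    \<open>X - Y\<close> because \<open>J * J * J = J\<close>, and conjugating by \<open>Q\<close>
    turns its identities into those for \<open>J\<close>.\<close>
  define Z where "Z = Q\<^sup>T * ?J * Q"
  have Z: "Z \<in> carrier_mat n n" using c unfolding Z_def by auto
  have JJJ: "?J * ?J * ?J = ?J" unfolding J_mat_eq_mat_diag mat_diag_diag
    by (intro arg_cong[of _ _ "mat_diag _"]) (auto simp: signature_def)
  have "(X - Y) * Z * (X - Y) = P * (?J * ?J * ?J) * P\<^sup>T"
    unfolding XY Z_def using c by (simp add: mult_assoc_dim inverse_cancel)
  hence "(X - Y) * Z * (X - Y) = X - Y" unfolding JJJ XY .
  note refl = reflexive_if_kernel_sum[OF psdD(1)[OF X] psdD(1)[OF Y] Z assms(1) this]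
  have "X' * ?J * X' = Q * (X * Z * X) * Q\<^sup>T"
    unfolding X'_def Z_def using c by (simp add: mult_assoc_dim)
  thus "X' * ?J * X' = X'" unfolding refl X'_def .
  have "Y' * ?J * X' = Q * (Y * Z * X) * Q\<^sup>T"
    unfolding X'_def Y'_def Z_def using c by (simp add: mult_assoc_dim)
  thus "Y' * ?J * X' = 0\<^sub>m n n" unfolding refl using c by simp
qed

text \<open>The identities of the normal form are transported back, with
  \<open>Q\<^sup>T * J * Q\<close> as the generalized inverse.\<close>

lemma kernel_sum_if_S_mat:
  assumes M: "M \<in> carrier_mat p q"
    and eq: "X = P * (S_mat p q r M * Ip0_mat p q r * S_mat p q r M) * P\<^sup>T"
  shows "kernel_sum X Y = carrier_vec n"
proof -
  let ?J = "J_mat p q r"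
  define W where "W = S_mat p q r M * Ip0_mat p q r * S_mat p q r M"
  note refl = S_Ip0_S_reflexive[OF M, of r, folded W_def n]
  note c = carriers P Q
  have W: "W \<in> carrier_mat n n" using S_Ip0_S_carrier[OF M, of r] unfolding W_def n .
  have X': "X = P * W * P\<^sup>T" unfolding eq W_def ..
  have "Y = X - P * ?J * P\<^sup>T" unfolding XY[symmetric] using c by (intro eq_matI) auto
  also have "\<dots> = P * (W - ?J) * P\<^sup>T"
    unfolding X' using c W by (simp add: mult_minus_dim minus_mult_dim)
  finally have Y': "Y = P * (W - ?J) * P\<^sup>T" .
  have "X * (Q\<^sup>T * ?J * Q) * X = P * (W * ?J * W) * P\<^sup>T"
    unfolding X' using c W by (simp add: mult_assoc_dim inverse_cancel)
  hence 1: "X * (Q\<^sup>T * ?J * Q) * X = X" unfolding refl X' .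
  have "Y * (Q\<^sup>T * ?J * Q) * X = P * ((W - ?J) * ?J * W) * P\<^sup>T"
    unfolding X' Y' using c W by (simp add: mult_assoc_dim inverse_cancel)
  hence 2: "Y * (Q\<^sup>T * ?J * Q) * X = 0\<^sub>m n n" unfolding refl using c by simp
  show ?thesis using kernel_sum_if_reflexive[OF carriers(1,2) _ 1 2] c by auto
qed

text \<open>The diagonal of \<open>J\<close> with its zeros replaced by ones. Having only entries 1
  and -1 it is an involution, so the completed difference is invertible with an explicit
  inverse.\<close>

definition complete_signature :: "nat \<Rightarrow> real" where
  "complete_signature i = (if p \<le> i \<and> i < p + q then -1 else 1)"

lemma J_mat_completion:
  "P * mat_diag n complete_signature * P\<^sup>T
    = X - Y + P * mat_diag n (\<lambda>i. if i \<in> {p + q..<n} then 1 else 0) * P\<^sup>T" (is "_ = _ + ?R")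
  "(P * mat_diag n complete_signature * P\<^sup>T) * (Q\<^sup>T * mat_diag n complete_signature * Q) = 1\<^sub>m n"
proof -
  have d: "mat_diag n complete_signature = J_mat p q r + mat_diag n (\<lambda>i. if i \<in> {p + q..<n} then 1 else 0)"
    unfolding J_mat_eq_mat_diag n[symmetric]
    by (intro eq_matI) (auto simp: mat_diag_def complete_signature_def signature_def)
  show "P * mat_diag n complete_signature * P\<^sup>T = X - Y + ?R"
    unfolding XY d using carriers(3) P
    by (simp add: mult_add_distrib_mat[of _ n n _ n] add_mult_distrib_mat[of _ n n _ _ n] mult_carrier_mat[of _ n n _ n])
  have "mat_diag n complete_signature * mat_diag n complete_signature = 1\<^sub>m n"
    unfolding mat_diag_diag by (intro eq_matI) (auto simp: mat_diag_def complete_signature_def)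
  hence "mat_diag n complete_signature * (mat_diag n complete_signature * Q) = Q"
    using Q by (intro mult_left_cancel_dim[of _ _ n]) (auto simp: mat_diag_def)
  thus "(P * mat_diag n complete_signature * P\<^sup>T) * (Q\<^sup>T * mat_diag n complete_signature * Q) = 1\<^sub>m n"
    using P Q PQ by (simp add: mult_assoc_dim inverse_cancel carrier_matD[OF mat_diag_dim])
qed

text \<open>The factorizations bound the two ranks by \<open>p\<close> and \<open>q\<close>. The
  completed difference has rank \<open>n\<close> and is assembled from \<open>X\<close>,
  \<open>-Y\<close> and a part of rank at most \<open>r\<close>, so neither bound can be
  strict.\<close>

lemma rank_if_kernel_sum:
  assumes "kernel_sum X Y = carrier_vec n"
  shows "vec_space.rank n X = p" "vec_space.rank n Y = q"
proof -
  note c = carriers P Q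
  note fac = reflexive_factorization[OF normalized_reflexive[OF assms, unfolded n], folded n]
  have rank_le: "vec_space.rank n Z \<le> card I"
    if Z: "Z \<in> carrier_mat n n" and I: "I \<subseteq> {..<n}"
      and ex: "\<exists>F G. F \<in> carrier_mat n n \<and> G \<in> carrier_mat n n \<and>
        Q * Z * Q\<^sup>T = F * mat_diag n (\<lambda>i. if i \<in> I then 1 else 0) * G" for Z I
  proof -
    obtain F G where FG: "F \<in> carrier_mat n n" "G \<in> carrier_mat n n"
      and eq: "Q * Z * Q\<^sup>T = F * mat_diag n (\<lambda>i. if i \<in> I then 1 else 0) * G" using ex by (elim exE conjE)
    have "Q * Z * Q\<^sup>T \<in> carrier_mat n n" using Z Q by auto
    hence "Z = P * (Q * Z * Q\<^sup>T) * P\<^sup>T" using congruence_eq_iff[OF Z] by blast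
    also have "\<dots> = (P * F) * mat_diag n (\<lambda>i. if i \<in> I then 1 else 0) * (G * P\<^sup>T)"
      unfolding eq using FG c by (simp add: mult_assoc_dim carrier_matD[OF mat_diag_dim])
    finally have Z': "Z = (P * F) * mat_diag n (\<lambda>i. if i \<in> I then 1 else 0) * (G * P\<^sup>T)" .
    have "vec_space.rank n Z \<le> card {i. i < n \<and> (if i \<in> I then 1 else 0) \<noteq> (0::real)}"
      unfolding Z' by (rule rank_mat_diag_sandwich_le) (use FG P in auto)
    also have "{i. i < n \<and> (if i \<in> I then 1 else 0) \<noteq> (0::real)} = I" using I by auto
    finally show ?thesis .
  qed
  have "{..<p} \<subseteq> {..<n}" "{p..<p + q} \<subseteq> {..<n}" unfolding n by auto
  note rank_le[OF c(1) this(1) fac(1)] rank_le[OF c(2) this(2) fac(2)]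
  hence le: "vec_space.rank n X \<le> p" "vec_space.rank n Y \<le> q" by simp_all
  let ?V = "P * mat_diag n complete_signature * P\<^sup>T"
  let ?R = "P * mat_diag n (\<lambda>i. if i \<in> {p + q..<n} then 1 else 0) * P\<^sup>T"
  have Rc: "?R \<in> carrier_mat n n" using c by (auto intro: mult_carrier_mat[of _ n n])
  \<comment> \<open>The sign is written as a factor on the right, so that
    \<open>rank_mult_le\<close> bounds the rank of \<open>-Y\<close>.\<close>
  have V: "?V = X + Y * (- 1\<^sub>m n) + ?R"
    unfolding J_mat_completion(1) using c Rc by (intro eq_matI) auto
  have "n = vec_space.rank n (?V * (Q\<^sup>T * mat_diag n complete_signature * Q))"
    unfolding J_mat_completion(2) by (rule rank_one_mat[symmetric])
  also have "\<dots> \<le> vec_space.rank n ?V"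
    using c by (intro rank_mult_le[of _ n n _ n]) (auto intro!: mult_carrier_mat[of _ n n])
  finally have 1: "n \<le> vec_space.rank n ?V" .
  have 2: "vec_space.rank n ?V \<le> vec_space.rank n (X + Y * (- 1\<^sub>m n)) + vec_space.rank n ?R"
    unfolding V using c Rc by (intro rank_add_le[of _ n n]) auto
  have 3: "vec_space.rank n (X + Y * (- 1\<^sub>m n)) \<le> vec_space.rank n X + vec_space.rank n (Y * (- 1\<^sub>m n))"
    using c by (intro rank_add_le[of _ n n]) auto
  have 4: "vec_space.rank n (Y * (- 1\<^sub>m n)) \<le> vec_space.rank n Y"
    using c by (intro rank_mult_le[of _ n n _ n]) auto
  have 5: "vec_space.rank n ?R \<le> card {i. i < n \<and> (if i \<in> {p + q..<n} then 1 else 0) \<noteq> (0::real)}"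
    by (rule rank_mat_diag_sandwich_le) (use P in auto)
  have "{i. i < n \<and> (if i \<in> {p + q..<n} then 1 else 0) \<noteq> (0::real)} = {p + q..<n}" by auto
  with 5 have "vec_space.rank n ?R \<le> r" using n by simp
  with 1 2 3 4 have "n \<le> vec_space.rank n X + vec_space.rank n Y + r" by linarith
  thus "vec_space.rank n X = p" "vec_space.rank n Y = q" using le n by linarith+
qed

text \<open>Rank factorizations of \<open>X\<close> and \<open>-Y\<close> together with \<open>P\<close> on the kernel part form square
  matrices \<open>N\<close>, \<open>N'\<close> whose product \<open>N N'\<close> is an invertible completion of \<open>X - Y\<close>. Multiplying by its
  inverse \<open>W\<close> in the other order gives \<open>N' W N = 1\<close>, whose blocks are the required identities.\<close>

lemma kernel_sum_if_rank:
  assumes rX: "vec_space.rank n X = p" and rY: "vec_space.rank n Y = q"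
  shows "kernel_sum X Y = carrier_vec n"
proof -
  note c = carriers P Q
  \<comment> \<open>Coordinate projections onto three disjoint intervals of lengths
    \<open>p\<close>, \<open>q\<close>, \<open>r\<close>. They mark the columns of \<open>N\<close>
    and rows of \<open>N'\<close> that belong to \<open>X\<close>, to \<open>Y\<close> and to the
    completion.\<close>
  define mask where "mask I = mat_diag n (\<lambda>i. if i \<in> I then 1 else 0 :: real)" for I
  have mc: "mask I \<in> carrier_mat n n" for I by (simp add: mask_def)
  have mm: "mask I * mask K = mask (I \<inter> K)" for I K
    unfolding mask_def mat_diag_diag by (intro arg_cong[of _ _ "mat_diag n"]) auto
  have m0: "mask {} = 0\<^sub>m n n" unfolding mask_def by (intro eq_matI) (auto simp: mat_diag_def)
  define E1 where "E1 = mask {..<p}"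
  define E2 where "E2 = mask {p..<p + q}"
  define E3 where "E3 = mask {p + q..<n}"
  have Ec: "E1 \<in> carrier_mat n n" "E2 \<in> carrier_mat n n" "E3 \<in> carrier_mat n n"
    by (simp_all add: E1_def E2_def E3_def mc)
  have "{..<p} \<inter> {p..<p + q} = {}" "{..<p} \<inter> {p + q..<n} = {}" "{p..<p + q} \<inter> {p + q..<n} = {}" by auto
  hence EE: "E1 * E1 = E1" "E2 * E2 = E2" "E3 * E3 = E3" "E1 * E2 = 0\<^sub>m n n" "E2 * E1 = 0\<^sub>m n n"
    "E1 * E3 = 0\<^sub>m n n" "E3 * E1 = 0\<^sub>m n n" "E2 * E3 = 0\<^sub>m n n" "E3 * E2 = 0\<^sub>m n n"
    by (simp_all add: E1_def E2_def E3_def mm m0 Int_commute)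
  have EEX: "E * (E' * Z) = (E * E') * Z" if "E \<in> carrier_mat n n" "E' \<in> carrier_mat n n" "dim_row Z = n"
    for E E' Z :: "real mat" using that by (simp add: mult_assoc_dim)
  note EE' = EEX[OF Ec(1) Ec(1)] EEX[OF Ec(2) Ec(2)] EEX[OF Ec(3) Ec(3)]
    EEX[OF Ec(1) Ec(2)] EEX[OF Ec(2) Ec(1)] EEX[OF Ec(1) Ec(3)] EEX[OF Ec(3) Ec(1)]
    EEX[OF Ec(2) Ec(3)] EEX[OF Ec(3) Ec(2)]
  obtain F F' where F: "F \<in> carrier_mat n n" "F' \<in> carrier_mat n n" and XF: "X = F * E1 * F'"
  proof (rule rank_factorization[OF psdD(1)[OF X], of "{..<p}", folded mask_def, folded E1_def])
    show "{..<p} \<subseteq> {..<n}" using n by auto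
  qed (use rX in simp_all)
  obtain G G' where G: "G \<in> carrier_mat n n" "G' \<in> carrier_mat n n" and YG: "Y = G * E2 * G'"
  proof (rule rank_factorization[OF psdD(1)[OF Y], of "{p..<p + q}", folded mask_def, folded E2_def])
    show "{p..<p + q} \<subseteq> {..<n}" using n by auto
  qed (use rY in simp_all)
  define N where "N = F * E1 + G * E2 + P * E3"
  \<comment> \<open>The minus sign makes \<open>N * N'\<close> contain \<open>X - Y\<close>; mixed
    terms vanish since the projections are mutually orthogonal.\<close>
  define N' where "N' = E1 * F' - E2 * G' + E3 * P\<^sup>T"
  define W where "W = Q\<^sup>T * mat_diag n complete_signature * Q"
  have cc: "F * E1 \<in> carrier_mat n n" "G * E2 \<in> carrier_mat n n" "P * E3 \<in> carrier_mat n n"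
    "E1 * F' \<in> carrier_mat n n" "E2 * G' \<in> carrier_mat n n" "E3 * P\<^sup>T \<in> carrier_mat n n"
    using F G c Ec by auto
  have cm: "E1 * F' - E2 * G' \<in> carrier_mat n n" by (rule minus_carrier_mat[OF cc(5)])
  have N: "N \<in> carrier_mat n n" "N' \<in> carrier_mat n n" unfolding N_def N'_def using cc by auto
  have W: "W \<in> carrier_mat n n" unfolding W_def using c by (auto intro: mult_carrier_mat[of _ n n])
  have zero: "A * E * (E' * B) = 0\<^sub>m n n" if "E * E' = 0\<^sub>m n n" "A \<in> carrier_mat n n" "B \<in> carrier_mat n n"
    "E \<in> carrier_mat n n" "E' \<in> carrier_mat n n" for A B E E' :: "real mat"
  proof -
    have "A * E * (E' * B) = A * ((E * E') * B)" using that(2-) by (simp add: mult_assoc_dim)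
    thus ?thesis unfolding that(1) using that(2-) by simp
  qed
  have one: "A * E * (E * B) = A * E * B" if "E * E = E" "A \<in> carrier_mat n n" "B \<in> carrier_mat n n"
    "E \<in> carrier_mat n n" for A B E :: "real mat"
  proof -
    have "A * E * (E * B) = A * ((E * E) * B)" using that(2-) by (simp add: mult_assoc_dim)
    thus ?thesis unfolding that(1) using that(2-) by (simp add: mult_assoc_dim)
  qed
  have PT: "P\<^sup>T \<in> carrier_mat n n" using P by simp
  have col: "(A1 + A2 + A3) * B = A1 * B + A2 * B + A3 * B" if "A1 \<in> carrier_mat n n" "A2 \<in> carrier_mat n n"
    "A3 \<in> carrier_mat n n" "B \<in> carrier_mat n n" for A1 A2 A3 B :: "real mat"
    unfolding add_mult_distrib_mat[OF add_carrier_mat[OF that(2)] that(3,4)]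
      add_mult_distrib_mat[OF that(1,2,4)] ..
  have N1: "N * (E1 * F') = X" unfolding N_def XF using col[OF cc(1-3,4)]
      zero[OF EE(5) G(1) F(2) Ec(2,1)] zero[OF EE(7) P F(2) Ec(3,1)] one[OF EE(1) F Ec(1)] F Ec
    by simp
  have N2: "N * (E2 * G') = Y" unfolding N_def YG using col[OF cc(1-3,5)]
      zero[OF EE(4) F(1) G(2) Ec(1,2)] zero[OF EE(9) P G(2) Ec(3,2)] one[OF EE(2) G Ec(2)] G Ec
    by simp
  have N3: "N * (E3 * P\<^sup>T) = P * E3 * P\<^sup>T" unfolding N_def using col[OF cc(1-3,6)]
      zero[OF EE(6) F(1) PT Ec(1,3)] zero[OF EE(8) G(1) PT Ec(2,3)] one[OF EE(3) P PT Ec(3)] P Ec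
    by simp
  have "N * N' = N * (E1 * F' - E2 * G') + N * (E3 * P\<^sup>T)"
    unfolding N'_def by (rule mult_add_distrib_mat[OF N(1) cm cc(6)])
  also have "N * (E1 * F' - E2 * G') = X - Y"
    unfolding N1[symmetric] N2[symmetric] using N cc by (intro mult_minus_distrib_mat[of _ n n _ n]) auto
  also have "N * (E3 * P\<^sup>T) = P * E3 * P\<^sup>T" by (rule N3)
  also have "X - Y + P * E3 * P\<^sup>T = P * mat_diag n complete_signature * P\<^sup>T"
    unfolding J_mat_completion(1) E3_def mask_def ..
  finally have NN': "N * N' = P * mat_diag n complete_signature * P\<^sup>T" .
  have "N * (N' * W) = N * N' * W" using N W by (simp add: mult_assoc_dim)
  hence "N * (N' * W) = 1\<^sub>m n" unfolding NN' W_def J_mat_completion(2) .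
  \<comment> \<open>The decisive use of squareness: \<open>N' * W\<close> is a right inverse of
    \<open>N\<close>, hence also a left inverse.\<close>
  hence NWN: "N' * W * N = 1\<^sub>m n"
    by (intro mat_mult_left_right_inverse[OF N(1)]) (use N W in auto)
  have E1N': "E1 * N' = E1 * F'"
  proof -
    have "E1 * N' = E1 * (E1 * F') - E1 * (E2 * G') + E1 * (E3 * P\<^sup>T)"
      unfolding N'_def mult_add_distrib_mat[OF Ec(1) cm cc(6)] mult_minus_distrib_mat[OF Ec(1) cc(4,5)] ..
    thus ?thesis using F G P Ec cc by (simp add: EE' EE add_zero_mat_dim)
  qed
  have E2N': "E2 * N' = - (E2 * G')"
  proof -
    have "E2 * N' = E2 * (E1 * F') - E2 * (E2 * G') + E2 * (E3 * P\<^sup>T)"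
      unfolding N'_def mult_add_distrib_mat[OF Ec(2) cm cc(6)] mult_minus_distrib_mat[OF Ec(2) cc(4,5)] ..
    also have "\<dots> = 0\<^sub>m n n - E2 * G' + 0\<^sub>m n n" using F G P Ec cc by (simp add: EE' EE)
    also have "0\<^sub>m n n - Z + 0\<^sub>m n n = - Z" if "Z \<in> carrier_mat n n" for Z :: "real mat"
      using that by (intro eq_matI) auto
    hence "0\<^sub>m n n - E2 * G' + 0\<^sub>m n n = - (E2 * G')" using cc(5) by blast
    finally show ?thesis .
  qed
  have NE1: "N * E1 = F * E1"
  proof -
    have "N * E1 = F * E1 * E1 + G * E2 * E1 + P * E3 * E1" unfolding N_def by (rule col[OF cc(1-3) Ec(1)])
    thus ?thesis using F G P Ec cc by (simp add: mult_assoc_dim EE add_zero_mat_dim)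
  qed
  \<comment> \<open>The diagonal block of \<open>N' * W * N = 1\<close> that belongs to
    \<open>X\<close>; it is what \<open>X * W * X = X\<close> needs.\<close>
  have F'WF: "E1 * F' * W * (F * E1) = E1"
  proof -
    have "E1 * F' * W * (F * E1) = E1 * (N' * W * N) * E1"
      unfolding E1N'[symmetric] NE1[symmetric] using Ec N W by (simp add: mult_assoc_dim)
    thus ?thesis unfolding NWN using Ec EE by simp
  qed
  \<comment> \<open>An off-diagonal block of the same identity, hence zero; it yields
    \<open>Y * W * X = 0\<close>.\<close>
  have "- (E2 * G') * W * (F * E1) = E2 * (N' * W * N) * E1"
    unfolding E2N'[symmetric] NE1[symmetric] using Ec N W by (simp add: mult_assoc_dim)
  hence "- (E2 * G' * W * (F * E1)) = 0\<^sub>m n n" unfolding NWN using Ec EE F G W by simp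
  hence "- (- (E2 * G' * W * (F * E1))) = - 0\<^sub>m n n" by simp
  hence G'WF: "E2 * G' * W * (F * E1) = 0\<^sub>m n n"
    by (simp add: uminus_zero_mat)
  have XF2: "X = F * E1 * (E1 * F')" unfolding XF by (rule one[OF EE(1) F Ec(1), symmetric])
  have YG2: "Y = G * E2 * (E2 * G')" unfolding YG by (rule one[OF EE(2) G Ec(2), symmetric])
  have "X * W * X = (F * E1) * ((E1 * F' * W * (F * E1)) * (E1 * F'))"
    unfolding XF2 using F Ec W by (simp add: mult_assoc_dim)
  also have "\<dots> = F * E1 * (E1 * F')" unfolding F'WF using F Ec by (simp add: EE' EE)
  finally have XWX: "X * W * X = X" using XF2 by simp
  have "Y * W * X = (G * E2) * ((E2 * G' * W * (F * E1)) * (E1 * F'))"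
    unfolding XF2 YG2 using F G Ec W by (simp add: mult_assoc_dim)
  also have "\<dots> = 0\<^sub>m n n" unfolding G'WF using F G Ec by simp
  finally have YWX: "Y * W * X = 0\<^sub>m n n" .
  show ?thesis by (rule kernel_sum_if_reflexive[OF carriers(1,2) W XWX YWX])
qed

lemma ex1_S_mat_if_kernel_sum:
  assumes "kernel_sum X Y = carrier_vec n"
  shows "\<exists>!M. M \<in> carrier_mat p q \<and> X = P * (S_mat p q r M * Ip0_mat p q r * S_mat p q r M) * P\<^sup>T"
proof -
  have "\<exists>!M. M \<in> carrier_mat p q \<and> Q * X * Q\<^sup>T = S_mat p q r M * Ip0_mat p q r * S_mat p q r M"
    by (rule reflexive_S_Ip0_S[OF normalized_reflexive[OF assms, unfolded n], folded n])
  moreover have "X = P * (S_mat p q r M * Ip0_mat p q r * S_mat p q r M) * P\<^sup>T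
      \<longleftrightarrow> Q * X * Q\<^sup>T = S_mat p q r M * Ip0_mat p q r * S_mat p q r M" if "M \<in> carrier_mat p q" for M
    using congruence_eq_iff[OF carriers(1) S_Ip0_S_carrier[OF that, of r, folded n]] .
  ultimately show ?thesis by metis
qed

end

section \<open>Assembling the equivalences\<close>

lemma invertible_mat_obtain_inverse:
  fixes P :: "real mat"
  assumes P: "P \<in> carrier_mat n n" and inv: "invertible_mat P"
  obtains Q where "Q \<in> carrier_mat n n" "P * Q = 1\<^sub>m n" "Q * P = 1\<^sub>m n"
proof -
  obtain Q where 1: "P * Q = 1\<^sub>m (dim_row P)" and 2: "Q * P = 1\<^sub>m (dim_row Q)"
    using inv unfolding invertible_mat_def inverts_mat_def by blast
  \<comment> \<open>The inverse inside \<open>invertible_mat\<close> comes without a carrier; its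
    dimensions are read off from the two products.\<close>
  have "dim_col Q = n" using arg_cong[OF 1, of dim_col] P by simp
  moreover have "dim_row Q = n" using arg_cong[OF 2, of dim_col] P by simp
  ultimately show ?thesis using that[of Q] 1 2 P by auto
qed

lemma psd_minus_if_loewner_le:
  assumes A: "sym_mat n A" and C: "sym_mat n C" and CA: "loewner_le n C A"
  shows "psd n (A - C)"
  unfolding psd_def
proof (intro conjI ballI)
  have c: "A \<in> carrier_mat n n" "C \<in> carrier_mat n n" "A\<^sup>T = A" "C\<^sup>T = C"
    using A C unfolding sym_mat_def by blast+
  show "sym_mat n (A - C)" unfolding sym_mat_def
    using transpose_minus[OF c(1,2)] minus_carrier_mat[OF c(2)] c(3,4) by simp
  fix x :: "real vec" assume x: "x \<in> carrier_vec n"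
  have "x \<bullet> ((A - C) *\<^sub>v x) = x \<bullet> (A *\<^sub>v x) - x \<bullet> (C *\<^sub>v x)"
    using x c by (simp add: minus_mult_distrib_mat_vec[of _ n n] scalar_prod_minus_distrib[of _ n])
  moreover have "x \<bullet> (C *\<^sub>v x) \<le> x \<bullet> (A *\<^sub>v x)" using CA x unfolding loewner_le_def by blast
  ultimately show "0 \<le> x \<bullet> ((A - C) *\<^sub>v x)" by simp
qed

lemma inertia_sum:
  assumes A: "sym_mat n A" and "inertia A = (p, q, r)"
  shows "n = p + q + r"
proof -
  obtain U e where U: "orthonormal_mat n U" and Ae: "A = U * mat_diag n e * U\<^sup>T"
    using spectral_theorem[OF A] by blast
  have pqr: "p = card {i. i < n \<and> e i > 0}" "q = card {i. i < n \<and> e i < 0}" "r = card {i. i < n \<and> e i = 0}"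
    using assms(2) inertia_diagonalized[OF U, of e] unfolding Ae by simp_all
  have "{..<n} = ({i. i < n \<and> e i > 0} \<union> {i. i < n \<and> e i < 0}) \<union> {i. i < n \<and> e i = 0}" by auto
  hence "n = card (({i. i < n \<and> e i > 0} \<union> {i. i < n \<and> e i < 0}) \<union> {i. i < n \<and> e i = 0})"
    by (metis card_lessThan)
  also have "\<dots> = card ({i. i < n \<and> e i > 0} \<union> {i. i < n \<and> e i < 0}) + r"
    unfolding pqr by (rule card_Un_disjoint) auto
  also have "card ({i. i < n \<and> e i > 0} \<union> {i. i < n \<and> e i < 0}) = p + q"
    unfolding pqr by (rule card_Un_disjoint) auto
  finally show ?thesis .
qed

text \<open>Guarantees that the quantifier over \<open>P\<close> in (iv) is not vacuous.\<close>

lemma sym_mat_congruent_J_mat: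
  assumes A: "sym_mat n A" and inertia: "inertia A = (p, q, r)"
  obtains P where "P \<in> carrier_mat n n" "invertible_mat P" "A = P * J_mat p q r * P\<^sup>T"
proof -
  note n = inertia_sum[OF assms]
  have "{i. i < n \<and> signature p q i = 1} = {..<p}"
    "{i. i < n \<and> signature p q i = -1} = {p..<p + q}"
    "{i. i < n \<and> signature p q i = 0} = {p + q..<n}"
    unfolding n by (auto simp: signature_def split: if_splits)
  hence in': "inertia A = (card {i. i < n \<and> signature p q i = 1},
      card {i. i < n \<and> signature p q i = -1}, card {i. i < n \<and> signature p q i = 0})"
    unfolding inertia using n by simp
  have "signature p q k \<in> {-1, 0, 1}" for k by (simp add: signature_def)
  from sym_mat_congruent_diag[OF A this in'] obtain P
    where "P \<in> carrier_mat n n" "invertible_mat P" "A = P * mat_diag n (signature p q) * P\<^sup>T"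
    by metis
  thus ?thesis using that unfolding J_mat_eq_mat_diag n[symmetric] by blast
qed

theorem theorem3p1:
  fixes n p q r :: nat and A B C :: "real mat"
  assumes "sym_mat n A" and "sym_mat n B" and "sym_mat n C"
    and "loewner_le n C A" and "loewner_le n C B"
    and "inertia (A - B) = (p, q, r)"
  shows "(maximal_lower_bound n A B C
            \<longleftrightarrow> {u + v | u v. u \<in> mat_kernel (A - C) \<and> v \<in> mat_kernel (B - C)} = carrier_vec n)
       \<and> ({u + v | u v. u \<in> mat_kernel (A - C) \<and> v \<in> mat_kernel (B - C)} = carrier_vec n
            \<longleftrightarrow> vec_space.rank n (A - C) = p \<and> vec_space.rank n (B - C) = q)
       \<and> (vec_space.rank n (A - C) = p \<and> vec_space.rank n (B - C) = q
            \<longleftrightarrow> (\<forall>P \<in> carrier_mat n n. invertible_mat P \<and> A - B = P * J_mat p q r * P\<^sup>T \<longrightarrow>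
                   (\<exists>!M. M \<in> carrier_mat p q \<and>
                      C = A - P * S_mat p q r M * Ip0_mat p q r * S_mat p q r M * P\<^sup>T)))"
proof -
  define X where "X = A - C"
  define Y where "Y = B - C"
  have c: "A \<in> carrier_mat n n" "B \<in> carrier_mat n n" "C \<in> carrier_mat n n"
    using assms(1-3) unfolding sym_mat_def by blast+
  have X: "psd n X" and Y: "psd n Y" unfolding X_def Y_def
    using psd_minus_if_loewner_le assms(1-5) by blast+
  have D: "sym_mat n (A - B)"
    using assms(1,2) transpose_minus[OF c(1,2)] minus_carrier_mat[OF c(2)] unfolding sym_mat_def by simp
  note n = inertia_sum[OF D assms(6)]
  have XY: "X - Y = A - B" unfolding X_def Y_def using c by (intro eq_matI) auto
  let ?W = "\<lambda>M. S_mat p q r M * Ip0_mat p q r * S_mat p q r M"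
  have normal: "\<exists>Q\<in>carrier_mat n n. P * Q = 1\<^sub>m n \<and> Q * P = 1\<^sub>m n"
    if "P \<in> carrier_mat n n" "invertible_mat P" for P :: "real mat"
    using invertible_mat_obtain_inverse[OF that] by metis
  have C_eq: "C = A - P * S_mat p q r M * Ip0_mat p q r * S_mat p q r M * P\<^sup>T \<longleftrightarrow> X = P * ?W M * P\<^sup>T"
    if P: "P \<in> carrier_mat n n" and M: "M \<in> carrier_mat p q" for P M
  proof -
    have S: "S_mat p q r M \<in> carrier_mat n n" using S_mat_carrier[OF M] unfolding n .
    have I: "Ip0_mat p q r \<in> carrier_mat n n" unfolding n Ip0_mat_eq_mat_diag by simp
    define Z where "Z = P * ?W M * P\<^sup>T"
    have Z: "Z \<in> carrier_mat n n" unfolding Z_def using P S I by auto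
    have "P * S_mat p q r M * Ip0_mat p q r * S_mat p q r M * P\<^sup>T = Z"
      unfolding Z_def using P S I by (simp add: mult_assoc_dim)
    moreover have "C = A - Z \<longleftrightarrow> X = Z"
    proof
      assume C: "C = A - Z"
      show "X = Z" unfolding X_def C using c Z by (intro eq_matI) auto
    next
      assume Z': "X = Z"
      show "C = A - Z" unfolding Z'[symmetric] X_def using c by (intro eq_matI) auto
    qed
    ultimately show ?thesis unfolding Z_def by simp
  qed
  \<comment> \<open>One fixed congruence serves for the rank statement, which does not mention
    \<open>P\<close>, and for the passage from (iv) back to (ii).\<close>
  obtain P0 where P0: "P0 \<in> carrier_mat n n" "invertible_mat P0" "A - B = P0 * J_mat p q r * P0\<^sup>T"
    by (rule sym_mat_congruent_J_mat[OF D assms(6)])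
  obtain Q0 where Q0: "Q0 \<in> carrier_mat n n" "P0 * Q0 = 1\<^sub>m n" "Q0 * P0 = 1\<^sub>m n"
    using normal[OF P0(1,2)] by blast
  note at_P0 = n P0(1) Q0 X Y P0(3)[folded XY]
  have i_ii: "maximal_lower_bound n A B C \<longleftrightarrow> kernel_sum X Y = carrier_vec n"
    unfolding maximal_lower_bound_iff[OF assms(1-5), folded X_def Y_def]
    using kernel_sum_if_none_below_both[OF X Y]
      below_both_eq_0_if_kernel_sum[OF psdD(2)[OF X] psdD(2)[OF Y]] by metis
  have ii_iii: "kernel_sum X Y = carrier_vec n \<longleftrightarrow> vec_space.rank n X = p \<and> vec_space.rank n Y = q"
    using rank_if_kernel_sum[OF at_P0] kernel_sum_if_rank[OF at_P0] by blast
  have ii_iv: "kernel_sum X Y = carrier_vec n \<longleftrightarrow>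
    (\<forall>P \<in> carrier_mat n n. invertible_mat P \<and> A - B = P * J_mat p q r * P\<^sup>T \<longrightarrow>
      (\<exists>!M. M \<in> carrier_mat p q \<and>
        C = A - P * S_mat p q r M * Ip0_mat p q r * S_mat p q r M * P\<^sup>T))" (is "_ \<longleftrightarrow> ?iv")
  proof
    assume ker: "kernel_sum X Y = carrier_vec n"
    show ?iv
    proof (intro ballI impI, elim conjE)
      fix P assume P: "P \<in> carrier_mat n n" "invertible_mat P" "A - B = P * J_mat p q r * P\<^sup>T"
      obtain Q where Q: "Q \<in> carrier_mat n n" "P * Q = 1\<^sub>m n" "Q * P = 1\<^sub>m n"
        using normal[OF P(1,2)] by blast
      have "\<exists>!M. M \<in> carrier_mat p q \<and> X = P * ?W M * P\<^sup>T"
        by (rule ex1_S_mat_if_kernel_sum[OF n P(1) Q X Y P(3)[folded XY] ker])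
      thus "\<exists>!M. M \<in> carrier_mat p q \<and>
          C = A - P * S_mat p q r M * Ip0_mat p q r * S_mat p q r M * P\<^sup>T"
        using C_eq[OF P(1)] by (simp cong: conj_cong)
    qed
  next
    assume ?iv
    then obtain M where M: "M \<in> carrier_mat p q"
      and "C = A - P0 * S_mat p q r M * Ip0_mat p q r * S_mat p q r M * P0\<^sup>T"
      using P0 by blast
    hence "X = P0 * ?W M * P0\<^sup>T" using C_eq[OF P0(1) M] by blast
    thus "kernel_sum X Y = carrier_vec n" by (rule kernel_sum_if_S_mat[OF at_P0 M])
  qed
  show ?thesis
    unfolding kernel_sum_def[symmetric] X_def[symmetric] Y_def[symmetric]
    using i_ii ii_iii ii_iv by blast
qed

end
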